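(* Let $n\ge1$, $v_i=(i,1)\in N=\mathbb{Z}^2$ for $0\le i\le n$, let $C$ be the cone with rays through $v_0,v_n$, and let $\Sigma$ be the simplicial subdivision of $C$ with rays through $v_{i_0},\dots,v_{i_{r+1}}$, $0=i_0<i_1<\dots<i_{r+1}=n$. The inverse $\chi_H^{-1}\in H\otimes H^c$ of the Euler characteristic pairing $\chi_H\in(H\otimes H^c)^\vee$ is $$\chi_H^{-1}=\sum_{\gamma\ne(0,0),\ \sigma(\gamma)=\sigma_{ij}}4(j-i)\sin^2(\pi\gamma_i)\,1_\gamma\otimes F_{\emptyset,\gamma^*}+1_{(0,0)}\otimes F-\sum_{1\le k,l\le r}g_{kl}\,D_{i_k}\otimes F_{i_l},$$ where $g_{kl}=-\frac{i_k}{n}(n-i_l)$ if $k\le l$ and $g_{kl}=-\frac{i_l}{n}(n-i_k)$ if $k\ge l$.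
   Context: **Fan.** The two-dimensional cones of $\Sigma$ are $\sigma_{i_ki_{k+1}}$, where $\sigma_{ij}$ ($i<j$) is the cone generated by $v_i,v_j$. Write $i\in\Sigma$ if $i\in\{i_0,\dots,i_{r+1}\}$, $i\in\Sigma^\circ$ if $i\in\{i_1,\dots,i_r\}$; consecutive $i_k,i_{k+1}$ are adjacent. $\mathrm{Box}(\Sigma)$ consists of $(0,0)$ and of the $\gamma\in N$ (nontrivial twisted sectors) of the form $\gamma=\gamma_iv_i+\gamma_jv_j$, $0<\gamma_i,\gamma_j<1$, with $i<j$ adjacent; for the latter $\sigma(\gamma)=\sigma_{ij}$, $\gamma_i+\gamma_j=1$, and $\gamma^*=(1-\gamma_i)v_i+(1-\gamma_j)v_j$. Also $(0,0)^*=(0,0)$. For a cone $\sigma$, $|\mathrm{Box}(\sigma)|$ is the number of $\gamma\in N$ that are combinations of its generators with coefficients in $[0,1)$; so $|\mathrm{Box}(\sigma_{ij})|=j-i$ and $|\mathrm{Box}(\{0\})|=1$. **$H$ and $H^c$.** $H=\bigoplus_{\gamma\in\mathrm{Box}(\Sigma)}H_\gamma$, $H^c=\bigoplus_\gamma H^c_\gamma$. For $\gamma\ne(0,0)$: $H_\gamma=\mathbb{C}1_\gamma$ (a copy of the ring $\mathbb{C}$), $H^c_\gamma=\mathbb{C}F_{\emptyset,\gamma}$. $H_{(0,0)}$ is the quotient of $\mathbb{C}[D_i,i\in\Sigma]$ by all $D_iD_j$, $\sum_iD_i$ and $\sum_iiD_i$, with unit $1_{(0,0)}$. $H_{(0,0)}^c$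 is the $H_{(0,0)}$-module generated by $F_k$ ($k\in\Sigma^\circ$) and $F_{\{i,j\}}$ ($i,j$ adjacent), with relations $D_iF_j=F_{\{i,j\}}$ ($i,j$ adjacent, $j\in\Sigma^\circ$), $D_iF_j=0$ ($i\ne j$ not adjacent), $D_kF_{\{i,j\}}=0$. It contains a unique element $F$ with $F_{\{i,j\}}=\frac1{|j-i|}F$ for all adjacent $i,j$. Bases: $1_\gamma$ ($\gamma\ne(0,0)$), $1_{(0,0)}$, $D_i$ ($i\in\Sigma^\circ$) for $H$; $F_{\emptyset,\gamma}$ ($\gamma\neq(0,0)$), $F$, $F_i$ ($i\in\Sigma^\circ$) for $H^c$. The involution $*:H\to H$ is the linear map with $(1_\gamma)^*=1_{\gamma^*}$, $D_i^*=-D_i$. **Pairing.** $\chi_H(\alpha,\beta)=\sum_{\gamma}\frac1{|\mathrm{Box}(\sigma(\gamma))|}\int_\gamma Td(\gamma)\,\alpha^*\beta$ for $\alpha\in H,\beta\in H^c$ (componentwise action of $H_\gamma$ on $H_\gamma^c$), where $Td(\gamma)=\frac1{(1-e^{-2\pi\mathrm{i}\gamma_i})(1-e^{-2\pi\mathrm{i}\gamma_j})}$ if $\sigma(\gamma)=\sigma_{ij}$, and $Td((0,0))=\prod_{i\in\Sigma}\frac{D_i}{1-e^{-D_i}}$. Here $\int_\gamma:H_\gamma^c\to\mathbb{C}$ is linear with $\int_\gamma F_{\emptyset,\gamma}=1$ for $\gamma\neq(0,0)$, and $\int_{(0,0)}F=1$, $\int_{(0,0)}F_i=0$. The inverse of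 a nondegenerate pairing $\chi_H$ is the element of $H\otimes H^c$ corresponding to the inverse $(H^c)^\vee\to H$ of the map $H\to(H^c)^\vee$, $\alpha\mapsto\chi_H(\alpha,\cdot)$. *)

theory Defs
  imports
    "HOL-Library.Poly_Mapping"
    "HOL-Computational_Algebra.Formal_Power_Series"
    "HOL-Analysis.Product_Vector"
    "HOL-Algebra.QuotRing"
    "HOL-Algebra.Module"
begin

section \<open>Linear algebra over records\<close>

text \<open>
  Modules that carry no ring structure leave the fields \<open>mult\<close> and \<open>one\<close> of the record
  undefined.
\<close>

definition CC :: "(complex, complex) module" where
  "CC = \<lparr>carrier = UNIV, mult = (*), one = 1, zero = 0, add = (+), smult = (*)\<rparr>"

definition linear_maps :: "(complex, 'a) module \<Rightarrow> (complex, 'b) module \<Rightarrow> ('a \<Rightarrow> 'b) set" where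
  "linear_maps V W = {f \<in> carrier V \<rightarrow>\<^sub>E carrier W.
     (\<forall>x\<in>carrier V. \<forall>y\<in>carrier V. f (x \<oplus>\<^bsub>V\<^esub> y) = f x \<oplus>\<^bsub>W\<^esub> f y) \<and>
     (\<forall>c. \<forall>x\<in>carrier V. f (c \<odot>\<^bsub>V\<^esub> x) = c \<odot>\<^bsub>W\<^esub> f x)}"

definition dual_space :: "(complex, 'a) module \<Rightarrow> ('a \<Rightarrow> complex) set" where
  "dual_space V = linear_maps V CC"

definition free_module :: "('r, 'm) ring_scheme \<Rightarrow> 'g set \<Rightarrow> ('r, 'g \<Rightarrow> 'r) module" where
  "free_module R G = \<lparr>
     carrier = {f. (\<forall>g\<in>G. f g \<in> carrier R) \<and> (\<forall>g. g \<notin> G \<longrightarrow> f g = \<zero>\<^bsub>R\<^esub>) \<and>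
                   finite {g. f g \<noteq> \<zero>\<^bsub>R\<^esub>}},
     mult = undefined, one = undefined,
     zero = (\<lambda>_. \<zero>\<^bsub>R\<^esub>),
     add = (\<lambda>f h g. f g \<oplus>\<^bsub>R\<^esub> h g),
     smult = (\<lambda>a f g. a \<otimes>\<^bsub>R\<^esub> f g)\<rparr>"

definition free_gen :: "('r, 'm) ring_scheme \<Rightarrow> 'g \<Rightarrow> 'g \<Rightarrow> 'r" where
  "free_gen R g = (\<lambda>h. if h = g then \<one>\<^bsub>R\<^esub> else \<zero>\<^bsub>R\<^esub>)"

definition submodule_generated ::
    "('r, 'm) ring_scheme \<Rightarrow> ('r, 'a) module \<Rightarrow> 'a set \<Rightarrow> 'a set" where
  "submodule_generated R M X = \<Inter>{N. submodule N R M \<and> X \<subseteq> N}"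

definition quotient_module :: "('r, 'a) module \<Rightarrow> 'a set \<Rightarrow> ('r, 'a set) module" where
  "quotient_module M N = \<lparr>
     carrier = a_rcosets\<^bsub>M\<^esub> N,
     mult = undefined, one = undefined,
     zero = N,
     add = set_add M,
     smult = (\<lambda>a X. \<Union>x\<in>X. N +>\<^bsub>M\<^esub> (a \<odot>\<^bsub>M\<^esub> x))\<rparr>"

section \<open>Tensor products and inverse pairings\<close>

definition tensor_relations ::
    "(complex, 'a) module \<Rightarrow> (complex, 'b) module \<Rightarrow> ('a \<times> 'b \<Rightarrow> complex) set" where
  "tensor_relations V W =
     (let P = free_module CC (carrier V \<times> carrier W); \<delta> = free_gen CC in
      {\<delta> (x \<oplus>\<^bsub>V\<^esub> x', y) \<ominus>\<^bsub>P\<^esub> (\<delta> (x, y) \<oplus>\<^bsub>P\<^esub> \<delta> (x', y)) | x x' y.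
         x \<in> carrier V \<and> x' \<in> carrier V \<and> y \<in> carrier W} \<union>
      {\<delta> (x, y \<oplus>\<^bsub>W\<^esub> y') \<ominus>\<^bsub>P\<^esub> (\<delta> (x, y) \<oplus>\<^bsub>P\<^esub> \<delta> (x, y')) | x y y'.
         x \<in> carrier V \<and> y \<in> carrier W \<and> y' \<in> carrier W} \<union>
      {\<delta> (c \<odot>\<^bsub>V\<^esub> x, y) \<ominus>\<^bsub>P\<^esub> c \<odot>\<^bsub>P\<^esub> \<delta> (x, y) | c x y.
         x \<in> carrier V \<and> y \<in> carrier W} \<union>
      {\<delta> (x, c \<odot>\<^bsub>W\<^esub> y) \<ominus>\<^bsub>P\<^esub> c \<odot>\<^bsub>P\<^esub> \<delta> (x, y) | c x y.
         x \<in> carrier V \<and> y \<in> carrier W})"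

definition tensor_null ::
    "(complex, 'a) module \<Rightarrow> (complex, 'b) module \<Rightarrow> ('a \<times> 'b \<Rightarrow> complex) set" where
  "tensor_null V W =
     submodule_generated CC (free_module CC (carrier V \<times> carrier W)) (tensor_relations V W)"

definition tensor_product ::
    "(complex, 'a) module \<Rightarrow> (complex, 'b) module \<Rightarrow> (complex, ('a \<times> 'b \<Rightarrow> complex) set) module"
  where
  "tensor_product V W =
     quotient_module (free_module CC (carrier V \<times> carrier W)) (tensor_null V W)"

definition pure_tensor ::
    "(complex, 'a) module \<Rightarrow> (complex, 'b) module \<Rightarrow> 'a \<Rightarrow> 'b \<Rightarrow> ('a \<times> 'b \<Rightarrow> complex) set" where
  "pure_tensor V W x y =
     tensor_null V W +>\<^bsub>free_module CC (carrier V \<times> carrier W)\<^esub> free_gen CC (x, y)"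

text \<open>
  The map \<open>dual_space W \<rightarrow> V\<close> corresponding to an element of the tensor product: \<open>x \<otimes> y\<close> corresponds to
  \<open>f \<mapsto> f(y) x\<close>.  The value does not depend on the representative \<open>u\<close>, so that the image
  below is a singleton.
\<close>

definition tensor_to_map ::
    "(complex, 'a) module \<Rightarrow> (complex, 'b) module \<Rightarrow> ('a \<times> 'b \<Rightarrow> complex) set \<Rightarrow>
     ('b \<Rightarrow> complex) \<Rightarrow> 'a" where
  "tensor_to_map V W t f =
     the_elem ((\<lambda>u. \<Oplus>\<^bsub>V\<^esub>p\<in>{p. u p \<noteq> 0}. (u p * f (snd p)) \<odot>\<^bsub>V\<^esub> fst p) ` t)"

definition pairing_map :: "(complex, 'b) module \<Rightarrow> ('a \<Rightarrow> 'b \<Rightarrow> complex) \<Rightarrow> 'a \<Rightarrow> 'b \<Rightarrow> complex" where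
  "pairing_map W \<chi> x = restrict (\<chi> x) (carrier W)"

definition nondegenerate_pairing ::
    "(complex, 'a) module \<Rightarrow> (complex, 'b) module \<Rightarrow> ('a \<Rightarrow> 'b \<Rightarrow> complex) \<Rightarrow> bool" where
  "nondegenerate_pairing V W \<chi> \<longleftrightarrow> bij_betw (pairing_map W \<chi>) (carrier V) (dual_space W)"

definition pairing_inverse ::
    "(complex, 'a) module \<Rightarrow> (complex, 'b) module \<Rightarrow> ('a \<Rightarrow> 'b \<Rightarrow> complex) \<Rightarrow>
     ('a \<times> 'b \<Rightarrow> complex) set" where
  "pairing_inverse V W \<chi> =
     (THE t. t \<in> carrier (tensor_product V W) \<and>
        (\<forall>f\<in>dual_space W. tensor_to_map V W t f = inv_into (carrier V) (pairing_map W \<chi>) f))"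

section \<open>The fan and its twisted sectors\<close>

text \<open>
  The lattice \<open>N\<close> sits inside \<open>\<real>\<^sup>2\<close>, where the real combinations of the generators \<open>v\<^sub>i\<close> (\<open>ray i\<close>) live.
  The fan is given by the finite set \<open>S\<close> of the indices of its rays, and a cone by the set of
  the indices of its generators (so that \<open>{}\<close> is the zero cone).
\<close>

definition lattice_N :: "(real \<times> real) set" where
  "lattice_N = \<int> \<times> \<int>"

definition ray :: "nat \<Rightarrow> real \<times> real" where
  "ray i = (real i, 1)"

definition interior_rays :: "nat set \<Rightarrow> nat set" where
  "interior_rays S = S - {Min S, Max S}"

definition consecutive :: "nat set \<Rightarrow> nat \<Rightarrow> nat \<Rightarrow> bool" where
  "consecutive S i j \<longleftrightarrow> i \<in> S \<and> j \<in> S \<and> i < j \<and> (\<forall>k\<in>S. \<not> (i < k \<and> k < j))"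

definition adjacent :: "nat set \<Rightarrow> nat \<Rightarrow> nat \<Rightarrow> bool" where
  "adjacent S i j \<longleftrightarrow> consecutive S i j \<or> consecutive S j i"

definition box_cone :: "nat set \<Rightarrow> (real \<times> real) set" where
  "box_cone J = {\<gamma> \<in> lattice_N. \<exists>c. (\<forall>i\<in>J. 0 \<le> c i \<and> c i < 1) \<and> \<gamma> = (\<Sum>i\<in>J. c i *\<^sub>R ray i)}"

definition interior_combination ::
    "nat set \<Rightarrow> real \<times> real \<Rightarrow> nat \<Rightarrow> nat \<Rightarrow> real \<Rightarrow> real \<Rightarrow> bool" where
  "interior_combination S \<gamma> i j a b \<longleftrightarrow>
     consecutive S i j \<and> 0 < a \<and> a < 1 \<and> 0 < b \<and> b < 1 \<and> \<gamma> = a *\<^sub>R ray i + b *\<^sub>R ray j"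

definition twisted :: "nat set \<Rightarrow> (real \<times> real) set" where
  "twisted S = {\<gamma> \<in> lattice_N. \<exists>i j a b. interior_combination S \<gamma> i j a b}"

text \<open>For twisted \<open>\<gamma>\<close>, the unique \<open>(i, j, \<gamma>\<^sub>i, \<gamma>\<^sub>j)\<close>.\<close>

definition coords :: "nat set \<Rightarrow> real \<times> real \<Rightarrow> nat \<times> nat \<times> real \<times> real" where
  "coords S \<gamma> = (THE (i, j, a, b). interior_combination S \<gamma> i j a b)"

definition sector_cone :: "nat set \<Rightarrow> real \<times> real \<Rightarrow> nat set" where
  "sector_cone S \<gamma> = (if \<gamma> = 0 then {} else case coords S \<gamma> of (i, j, a, b) \<Rightarrow> {i, j})"

definition box_star :: "nat set \<Rightarrow> real \<times> real \<Rightarrow> real \<times> real" where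
  "box_star S \<gamma> =
     (if \<gamma> = 0 then 0
      else case coords S \<gamma> of (i, j, a, b) \<Rightarrow> (1 - a) *\<^sub>R ray i + (1 - b) *\<^sub>R ray j)"

section \<open>The untwisted sector\<close>

text \<open>
  Polynomials are finitely supported functions on monomials, and monomials are finitely supported
  exponent functions on the indices of the variables.
\<close>

type_synonym cpoly = "((nat, nat) poly_mapping, complex) poly_mapping"

definition poly_const :: "complex \<Rightarrow> cpoly" where
  "poly_const c = Poly_Mapping.single 0 c"

definition poly_var :: "nat \<Rightarrow> cpoly" where
  "poly_var i = Poly_Mapping.single (Poly_Mapping.single i 1) 1"

definition poly_ring :: "nat set \<Rightarrow> cpoly ring" where
  "poly_ring S = \<lparr>carrier = {p. \<forall>m\<in>Poly_Mapping.keys p. Poly_Mapping.keys m \<subseteq> S},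
     mult = (*), one = 1, zero = 0, add = (+)\<rparr>"

definition H0_ideal :: "nat set \<Rightarrow> cpoly set" where
  "H0_ideal S = Idl\<^bsub>poly_ring S\<^esub>
     ({poly_var i * poly_var j | i j. i \<in> S \<and> j \<in> S} \<union>
      {\<Sum>i\<in>S. poly_var i, \<Sum>i\<in>S. poly_const (of_nat i) * poly_var i})"

definition H0_class :: "nat set \<Rightarrow> cpoly \<Rightarrow> cpoly set" where
  "H0_class S p = H0_ideal S +>\<^bsub>poly_ring S\<^esub> p"

definition H0 :: "nat set \<Rightarrow> (complex, cpoly set) module" where
  "H0 S = (let Q = poly_ring S Quot H0_ideal S in
     \<lparr>carrier = carrier Q, mult = mult Q, one = one Q, zero = zero Q, add = add Q,
      smult = (\<lambda>c x. H0_class S (poly_const c) \<otimes>\<^bsub>Q\<^esub> x)\<rparr>)"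

definition D0 :: "nat set \<Rightarrow> nat \<Rightarrow> cpoly set" where
  "D0 S i = H0_class S (poly_var i)"

text \<open>The generators \<open>F\<^sub>k\<close> and \<open>F\<^bsub>{i,j}\<^esub>\<close> are indexed by \<open>{k}\<close> and \<open>{i, j}\<close>.\<close>

definition H0c_gens :: "nat set \<Rightarrow> nat set set" where
  "H0c_gens S = {{k} | k. k \<in> interior_rays S} \<union> {{i, j} | i j. adjacent S i j}"

definition H0c_free :: "nat set \<Rightarrow> (cpoly set, nat set \<Rightarrow> cpoly set) module" where
  "H0c_free S = free_module (H0 S) (H0c_gens S)"

definition H0c_null :: "nat set \<Rightarrow> (nat set \<Rightarrow> cpoly set) set" where
  "H0c_null S =
     (let M = H0c_free S; G = free_gen (H0 S) in
      submodule_generated (H0 S) M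
       ({D0 S i \<odot>\<^bsub>M\<^esub> G {j} \<ominus>\<^bsub>M\<^esub> G {i, j} | i j. adjacent S i j \<and> j \<in> interior_rays S} \<union>
        {D0 S i \<odot>\<^bsub>M\<^esub> G {j} | i j.
           i \<in> S \<and> j \<in> interior_rays S \<and> i \<noteq> j \<and> \<not> adjacent S i j} \<union>
        {D0 S k \<odot>\<^bsub>M\<^esub> G {i, j} | k i j. k \<in> S \<and> adjacent S i j}))"

definition H0c :: "nat set \<Rightarrow> (cpoly set, (nat set \<Rightarrow> cpoly set) set) module" where
  "H0c S = quotient_module (H0c_free S) (H0c_null S)"

definition H0c_CC :: "nat set \<Rightarrow> (complex, (nat set \<Rightarrow> cpoly set) set) module" where
  "H0c_CC S = \<lparr>carrier = carrier (H0c S), mult = undefined, one = undefined,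
     zero = zero (H0c S), add = add (H0c S),
     smult = (\<lambda>c x. H0_class S (poly_const c) \<odot>\<^bsub>H0c S\<^esub> x)\<rparr>"

definition F0_gen :: "nat set \<Rightarrow> nat set \<Rightarrow> (nat set \<Rightarrow> cpoly set) set" where
  "F0_gen S J = H0c_null S +>\<^bsub>H0c_free S\<^esub> free_gen (H0 S) J"

definition F0 :: "nat set \<Rightarrow> (nat set \<Rightarrow> cpoly set) set" where
  "F0 S = (THE x. x \<in> carrier (H0c S) \<and>
     (\<forall>i j. adjacent S i j \<longrightarrow>
        F0_gen S {i, j} = complex_of_real (1 / \<bar>real j - real i\<bar>) \<odot>\<^bsub>H0c_CC S\<^esub> x))"

definition integral0 :: "nat set \<Rightarrow> (nat set \<Rightarrow> cpoly set) set \<Rightarrow> complex" where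
  "integral0 S = (THE f. f \<in> dual_space (H0c_CC S) \<and> f (F0 S) = 1 \<and>
     (\<forall>k\<in>interior_rays S. f (F0_gen S {k}) = 0))"

section \<open>The full spaces\<close>

text \<open>
  \<open>V \<oplus> \<Oplus>\<^bsub>\<gamma>\<in>B\<^esub> \<complex>\<close> with componentwise operations.  The function component gives the coefficients
  of \<open>1\<^sub>\<gamma>\<close> in \<open>H\<close>, respectively of \<open>F\<^bsub>\<emptyset>,\<gamma>\<^esub>\<close> in \<open>H\<^sup>c\<close>, for the twisted sectors \<open>\<gamma>\<close>.
\<close>

definition sector_sum ::
    "(complex, 'a) module \<Rightarrow> 'g set \<Rightarrow> (complex, 'a \<times> ('g \<Rightarrow> complex)) module" where
  "sector_sum V B = \<lparr>
     carrier = carrier V \<times> {f. \<forall>\<gamma>. \<gamma> \<notin> B \<longrightarrow> f \<gamma> = 0},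
     mult = (\<lambda>x y. (fst x \<otimes>\<^bsub>V\<^esub> fst y, \<lambda>\<gamma>. snd x \<gamma> * snd y \<gamma>)),
     one = (\<one>\<^bsub>V\<^esub>, \<lambda>\<gamma>. if \<gamma> \<in> B then 1 else 0),
     zero = (\<zero>\<^bsub>V\<^esub>, \<lambda>_. 0),
     add = (\<lambda>x y. (fst x \<oplus>\<^bsub>V\<^esub> fst y, \<lambda>\<gamma>. snd x \<gamma> + snd y \<gamma>)),
     smult = (\<lambda>c x. (c \<odot>\<^bsub>V\<^esub> fst x, \<lambda>\<gamma>. c * snd x \<gamma>))\<rparr>"

definition untwisted_elt :: "'a \<Rightarrow> 'a \<times> ('g \<Rightarrow> complex)" where
  "untwisted_elt x = (x, \<lambda>_. 0)"

definition twisted_elt :: "(complex, 'a) module \<Rightarrow> 'g \<Rightarrow> 'a \<times> ('g \<Rightarrow> complex)" where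
  "twisted_elt V \<gamma> = (\<zero>\<^bsub>V\<^esub>, \<lambda>\<delta>. if \<delta> = \<gamma> then 1 else 0)"

type_synonym H_elt = "cpoly set \<times> (real \<times> real \<Rightarrow> complex)"
type_synonym Hc_elt = "(nat set \<Rightarrow> cpoly set) set \<times> (real \<times> real \<Rightarrow> complex)"

definition H_space :: "nat set \<Rightarrow> (complex, H_elt) module" where
  "H_space S = sector_sum (H0 S) (twisted S)"

definition Hc_space :: "nat set \<Rightarrow> (complex, Hc_elt) module" where
  "Hc_space S = sector_sum (H0c_CC S) (twisted S)"

definition unit_sector :: "nat set \<Rightarrow> real \<times> real \<Rightarrow> H_elt" where
  "unit_sector S \<gamma> =
     (if \<gamma> = 0 then untwisted_elt \<one>\<^bsub>H0 S\<^esub> else twisted_elt (H0 S) \<gamma>)"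

definition D_elt :: "nat set \<Rightarrow> nat \<Rightarrow> H_elt" where
  "D_elt S i = untwisted_elt (D0 S i)"

definition F_twisted :: "nat set \<Rightarrow> real \<times> real \<Rightarrow> Hc_elt" where
  "F_twisted S \<gamma> = twisted_elt (H0c_CC S) \<gamma>"

definition F_elt :: "nat set \<Rightarrow> Hc_elt" where
  "F_elt S = untwisted_elt (F0 S)"

definition F_ray :: "nat set \<Rightarrow> nat \<Rightarrow> Hc_elt" where
  "F_ray S k = untwisted_elt (F0_gen S {k})"

definition involution :: "nat set \<Rightarrow> H_elt \<Rightarrow> H_elt" where
  "involution S = (THE f. f \<in> linear_maps (H_space S) (H_space S) \<and>
     (\<forall>\<gamma>\<in>insert 0 (twisted S). f (unit_sector S \<gamma>) = unit_sector S (box_star S \<gamma>)) \<and>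
     (\<forall>i\<in>S. f (D_elt S i) = \<ominus>\<^bsub>H_space S\<^esub> D_elt S i))"

section \<open>The Euler characteristic pairing\<close>

text \<open>
  A power series at a nilpotent element \<open>x\<close>: only finitely many powers of \<open>x\<close> are nonzero.
\<close>

definition fps_at_nilpotent :: "(complex, 'a) module \<Rightarrow> complex fps \<Rightarrow> 'a \<Rightarrow> 'a" where
  "fps_at_nilpotent A f x =
     (\<Oplus>\<^bsub>A\<^esub>k\<in>{k::nat. x [^]\<^bsub>A\<^esub> k \<noteq> \<zero>\<^bsub>A\<^esub>}. fps_nth f k \<odot>\<^bsub>A\<^esub> (x [^]\<^bsub>A\<^esub> k))"

definition todd_series :: "complex fps" where
  "todd_series = fps_X / (1 - fps_exp (-1))"

definition Td0 :: "nat set \<Rightarrow> cpoly set" where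
  "Td0 S = (\<Otimes>\<^bsub>H0 S\<^esub>i\<in>S. fps_at_nilpotent (H0 S) todd_series (D0 S i))"

definition Td_twisted :: "nat set \<Rightarrow> real \<times> real \<Rightarrow> complex" where
  "Td_twisted S \<gamma> = (case coords S \<gamma> of (i, j, a, b) \<Rightarrow>
     1 / ((1 - exp (- 2 * of_real pi * \<i> * of_real a)) *
          (1 - exp (- 2 * of_real pi * \<i> * of_real b))))"

definition euler_pairing :: "nat set \<Rightarrow> H_elt \<Rightarrow> Hc_elt \<Rightarrow> complex" where
  "euler_pairing S \<alpha> \<beta> =
     1 / of_nat (card (box_cone (sector_cone S 0))) *
       integral0 S ((Td0 S \<otimes>\<^bsub>H0 S\<^esub> fst (involution S \<alpha>)) \<odot>\<^bsub>H0c S\<^esub> fst \<beta>) +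
     (\<Sum>\<gamma>\<in>twisted S. 1 / of_nat (card (box_cone (sector_cone S \<gamma>))) *
        (Td_twisted S \<gamma> * snd (involution S \<alpha>) \<gamma> * snd \<beta> \<gamma>))"

end

theory Submission
  imports Defs
begin

text \<open>
  The inverse of a pairing is read off from dual bases. Suppose that \<open>e\<^sub>b\<close> spans \<open>V\<close>, that \<open>w\<^sub>b\<close> spans
  \<open>W\<close> and that \<open>\<chi> e\<^sub>b w\<^sub>c\<close> is \<open>1\<close> for \<open>b = c\<close> and \<open>0\<close> otherwise. Then \<open>x = \<Sum>\<^sub>b \<chi> x w\<^sub>b e\<^sub>b\<close> and
  \<open>y = \<Sum>\<^sub>b \<chi> e\<^sub>b y w\<^sub>b\<close> for all \<open>x\<close> and \<open>y\<close>, so \<open>f \<mapsto> \<Sum>\<^sub>b f w\<^sub>b e\<^sub>b\<close> inverts \<open>x \<mapsto> \<chi> x\<close>, and the tensor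
  \<open>\<Sum>\<^sub>b e\<^sub>b \<otimes> w\<^sub>b\<close> induces this map. It is the only one that does, because every tensor \<open>t\<close> is
  recovered from the values of its map on the functionals \<open>\<chi> e\<^sub>b\<close> (\<open>dual_bases.tensor_expansion\<close>,
  \<open>dual_bases.pairing_inverse_eq\<close>). Biorthogonality also yields the linear independence of both
  families, so that for \<open>H\<close> and \<open>H\<^sup>c\<close> two things remain: spanning sets (\<open>H_spanned\<close>, \<open>Hc_spanned\<close>)
  and the values of the pairing on them (\<open>euler_pairing_F\<close>).

  On the untwisted sector the Todd class is \<open>1\<close>: since \<open>D\<^sub>i D\<^sub>j = 0\<close>, it is \<open>\<Prod>\<^sub>i (1 + c D\<^sub>i) = 1 + c \<Sum>\<^sub>i D\<^sub>i\<close>,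
  and \<open>\<Sum>\<^sub>i D\<^sub>i = 0\<close>. The involution is \<open>X \<mapsto> 2 \<epsilon>(X) - X\<close> with \<open>\<epsilon>\<close> the augmentation. Hence
  \<open>\<chi>(X, F) = \<epsilon>(X)\<close> and \<open>\<chi>(X, F\<^sub>k) = - \<delta>\<^sub>k(X)\<close>, where \<open>\<delta>\<^sub>k\<close> vanishes at \<open>1\<close> and sends \<open>D\<^sub>i\<close> to
  \<open>\<integral> D\<^sub>i F\<^sub>k\<close>. The numbers \<open>- \<integral> D\<^sub>i F\<^sub>k\<close> form the Laplacian of the path through the indices of the
  rays, an edge between neighbours \<open>i\<close> and \<open>j\<close> having weight \<open>1 / \<bar>j - i\<bar>\<close>. Such a Laplacian takes
  a function to the differences of its slopes on adjacent intervals. In particular it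
  kills affine functions, which is what makes \<open>\<delta>\<^sub>k\<close> compatible with the relations \<open>\<Sum>\<^sub>i D\<^sub>i = 0\<close> and
  \<open>\<Sum>\<^sub>i i D\<^sub>i = 0\<close> (\<open>descending_weight\<close>). Its inverse with zero boundary values at \<open>0\<close> and \<open>n\<close> is the
  Green's function \<open>min k l (n - max k l) / n\<close>, which as a function of \<open>l\<close> is piecewise linear with a
  single change of slope, by \<open>-1\<close>, at \<open>k\<close> (\<open>green_weight\<close>).

  On the twisted sectors \<open>1\<^sub>\<gamma>\<close> pairs only with \<open>F\<close> in the sector \<open>\<gamma>\<^sup>*\<close>, and because the coordinates of
  \<open>\<gamma>\<close> add up to \<open>1\<close> the two factors of the Todd class are complex conjugate, with product
  \<open>4 sin\<^sup>2 (\<pi> \<gamma>\<^sub>i)\<close> in the denominator (\<open>todd_denominator\<close>).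
\<close>

section \<open>Linear maps over the complex numbers\<close>

lemma CC_simps [simp]:
  "carrier CC = UNIV" "mult CC = (*)" "one CC = 1" "zero CC = 0" "add CC = (+)" "smult CC = (*)"
  by (simp_all add: CC_def)

lemma cring_CC: "cring CC"
proof (intro cringI abelian_groupI comm_monoidI)
  show "\<exists>y\<in>carrier CC. y \<oplus>\<^bsub>CC\<^esub> x = \<zero>\<^bsub>CC\<^esub>" for x
    by (simp add: exI[of _ "- x"])
qed (simp_all add: algebra_simps)

lemma module_CC: "module CC CC"
  by (intro moduleI cring_CC cring.axioms(1)[THEN ring.is_abelian_group])
    (simp_all add: algebra_simps)

lemma a_inv_CC [simp]: "\<ominus>\<^bsub>CC\<^esub> x = - x"
proof -
  interpret cring CC by (rule cring_CC)
  show ?thesis by (rule minus_equality) simp_all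
qed

lemma finsum_CC [simp]: "finsum CC f A = sum f A"
proof -
  interpret cring CC by (rule cring_CC)
  show ?thesis by (induction A rule: infinite_finite_induct) simp_all
qed

lemma module_CC_smult_uminus_one:
  assumes "module CC V" "x \<in> carrier V"
  shows "(-1) \<odot>\<^bsub>V\<^esub> x = \<ominus>\<^bsub>V\<^esub> x"
proof -
  interpret module CC V by fact
  show ?thesis using smult_l_minus[of 1 x] assms(2) smult_one[of x] by simp
qed

locale linear_map = V: module CC V + W: module CC W for V :: "(complex, 'a) module"
    and W :: "(complex, 'b) module" +
  fixes f :: "'a \<Rightarrow> 'b"
  assumes closed [simp, intro]: "x \<in> carrier V \<Longrightarrow> f x \<in> carrier W"
    and add: "x \<in> carrier V \<Longrightarrow> y \<in> carrier V \<Longrightarrow> f (x \<oplus>\<^bsub>V\<^esub> y) = f x \<oplus>\<^bsub>W\<^esub> f y"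
    and smult: "x \<in> carrier V \<Longrightarrow> f (c \<odot>\<^bsub>V\<^esub> x) = c \<odot>\<^bsub>W\<^esub> f x"
begin

lemma zero [simp]: "f \<zero>\<^bsub>V\<^esub> = \<zero>\<^bsub>W\<^esub>"
  using smult[of "\<zero>\<^bsub>V\<^esub>" 0] V.smult_l_null[of "\<zero>\<^bsub>V\<^esub>"] W.smult_l_null[of "f \<zero>\<^bsub>V\<^esub>"] by simp

lemma uminus: "x \<in> carrier V \<Longrightarrow> f (\<ominus>\<^bsub>V\<^esub> x) = \<ominus>\<^bsub>W\<^esub> f x"
  using smult[of x "-1"]
  by (simp add: module_CC_smult_uminus_one V.module_axioms W.module_axioms)

lemma minus:
  "x \<in> carrier V \<Longrightarrow> y \<in> carrier V \<Longrightarrow> f (x \<ominus>\<^bsub>V\<^esub> y) = f x \<ominus>\<^bsub>W\<^esub> f y"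
  by (simp add: a_minus_def add uminus)

lemma finsum:
  "g \<in> A \<rightarrow> carrier V \<Longrightarrow> f (\<Oplus>\<^bsub>V\<^esub>i\<in>A. g i) = (\<Oplus>\<^bsub>W\<^esub>i\<in>A. f (g i))"
  by (induction A rule: infinite_finite_induct) (auto simp: local.add Pi_def)

lemma in_linear_maps: "restrict f (carrier V) \<in> linear_maps V W"
  unfolding linear_maps_def using add smult by auto

end

lemma linear_mapI_linear_maps:
  assumes "module CC V" "module CC W" "f \<in> linear_maps V W"
  shows "linear_map V W f"
  using assms unfolding linear_maps_def
  by (auto intro!: linear_map.intro linear_map_axioms.intro)

lemma linear_mapI:
  assumes "module CC V" "module CC W"
    and "\<And>x. x \<in> carrier V \<Longrightarrow> f x \<in> carrier W"
    and "\<And>x y. x \<in> carrier V \<Longrightarrow> y \<in> carrier V \<Longrightarrow> f (x \<oplus>\<^bsub>V\<^esub> y) = f x \<oplus>\<^bsub>W\<^esub> f y"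
    and "\<And>c x. x \<in> carrier V \<Longrightarrow> f (c \<odot>\<^bsub>V\<^esub> x) = c \<odot>\<^bsub>W\<^esub> f x"
  shows "linear_map V W f"
  using assms by (auto intro!: linear_map.intro linear_map_axioms.intro)

lemma linear_map_id: "module CC V \<Longrightarrow> linear_map V V (\<lambda>x. x)"
  by (rule linear_mapI) auto

lemma linear_map_comp:
  assumes "linear_map V W f" "linear_map W U g"
  shows "linear_map V U (\<lambda>x. g (f x))"
proof -
  interpret f: linear_map V W f by fact
  interpret g: linear_map W U g by fact
  show ?thesis
    by (rule linear_mapI)
      (auto simp: f.V.module_axioms g.W.module_axioms f.add g.add f.smult g.smult)
qed

lemma linear_map_cong:
  assumes "linear_map V W f" "\<And>x. x \<in> carrier V \<Longrightarrow> g x = f x"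
  shows "linear_map V W g"
proof -
  interpret f: linear_map V W f by fact
  show ?thesis
    by (rule linear_mapI)
      (auto simp: assms(2) f.add f.smult f.V.module_axioms f.W.module_axioms)
qed

lemma linear_map_CC_add:
  assumes "linear_map V CC f" "linear_map V CC g"
  shows "linear_map V CC (\<lambda>x. f x + g x)"
proof -
  interpret f: linear_map V CC f by fact
  interpret g: linear_map V CC g by fact
  show ?thesis
    by (rule linear_mapI)
      (auto simp: f.add g.add f.smult g.smult distrib_left f.V.module_axioms module_CC)
qed

lemma linear_map_smult_left:
  assumes "module CC V" "x \<in> carrier V"
  shows "linear_map CC V (\<lambda>c. c \<odot>\<^bsub>V\<^esub> x)"
proof -
  interpret V: module CC V by fact
  show ?thesis
    using assms(2) V.smult_l_distr[of _ _ x] V.smult_assoc1[of _ _ x]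
    by (intro linear_mapI module_CC V.module_axioms) auto
qed

lemma linear_map_finsum:
  assumes "module CC V" "module CC W"
    and f: "\<And>b. b \<in> B \<Longrightarrow> linear_map V W (f b)"
  shows "linear_map V W (\<lambda>x. \<Oplus>\<^bsub>W\<^esub>b\<in>B. f b x)"
proof -
  interpret V: module CC V by fact
  interpret W: module CC W by fact
  have closed: "f b x \<in> carrier W" if "b \<in> B" "x \<in> carrier V" for b x
    using linear_map.closed[OF f] that by blast
  have fadd: "f b (x \<oplus>\<^bsub>V\<^esub> y) = f b x \<oplus>\<^bsub>W\<^esub> f b y"
    if "b \<in> B" "x \<in> carrier V" "y \<in> carrier V" for b x y
    using linear_map.add[OF f] that by blast
  have fsmult: "f b (c \<odot>\<^bsub>V\<^esub> x) = c \<odot>\<^bsub>W\<^esub> f b x" if "b \<in> B" "x \<in> carrier V" for b c x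
    using linear_map.smult[OF f] that by blast
  show ?thesis
  proof (rule linear_mapI)
    show "(\<Oplus>\<^bsub>W\<^esub>b\<in>B. f b x) \<in> carrier W" if "x \<in> carrier V" for x
      using closed that by (auto intro: W.finsum_closed)
    show "(\<Oplus>\<^bsub>W\<^esub>b\<in>B. f b (x \<oplus>\<^bsub>V\<^esub> y)) = (\<Oplus>\<^bsub>W\<^esub>b\<in>B. f b x) \<oplus>\<^bsub>W\<^esub> (\<Oplus>\<^bsub>W\<^esub>b\<in>B. f b y)"
      if "x \<in> carrier V" "y \<in> carrier V" for x y
      using closed that
      by (subst W.finsum_addf[symmetric]) (auto simp: fadd simp del: W.finsum_addf intro!: W.finsum_cong')
    show "(\<Oplus>\<^bsub>W\<^esub>b\<in>B. f b (c \<odot>\<^bsub>V\<^esub> x)) = c \<odot>\<^bsub>W\<^esub> (\<Oplus>\<^bsub>W\<^esub>b\<in>B. f b x)" if "x \<in> carrier V" for c x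
    proof (cases "finite B")
      case True
      then show ?thesis using closed that
        by (subst W.finsum_smult_ldistr) (auto simp: fsmult intro!: W.finsum_cong')
    next
      case False
      then show ?thesis using W.smult_r_null[of c] by (simp add: W.finsum_infinite)
    qed
  qed fact+
qed

section \<open>Generated submodules, free modules and quotients\<close>

context module
begin

lemma submoduleI':
  assumes "H \<subseteq> carrier M" "\<zero>\<^bsub>M\<^esub> \<in> H" "\<And>a b. \<lbrakk>a \<in> H ; b \<in> H\<rbrakk> \<Longrightarrow> a \<oplus>\<^bsub>M\<^esub> b \<in> H"
    and "\<And>a x. \<lbrakk>a \<in> carrier R; x \<in> H\<rbrakk> \<Longrightarrow> a \<odot>\<^bsub>M\<^esub> x \<in> H"
  shows "submodule H R M"
proof (rule submoduleI)
  show "\<ominus>\<^bsub>M\<^esub> a \<in> H" if "a \<in> H" for a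
    using assms(4)[of "\<ominus>\<^bsub>R\<^esub> \<one>\<^bsub>R\<^esub>" a] assms(1) that smult_l_minus[of "\<one>\<^bsub>R\<^esub>" a] by auto
qed (use assms in auto)

lemma submodule_zero: "submodule N R M \<Longrightarrow> \<zero>\<^bsub>M\<^esub> \<in> N"
  using subgroup.one_closed[of N "add_monoid M"] submodule.axioms(1) by auto

lemma submodule_finsum:
  assumes "submodule N R M" "f \<in> A \<rightarrow> N"
  shows "(\<Oplus>\<^bsub>M\<^esub>i\<in>A. f i) \<in> N"
  using assms(2)
proof (induction A rule: infinite_finite_induct)
  case (insert a A)
  then have "f a \<in> N" "f \<in> A \<rightarrow> N" "f \<in> A \<rightarrow> carrier M" "f a \<in> carrier M"
    using submoduleE(1)[OF assms(1)] by auto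
  with insert show ?case using submoduleE(5)[OF assms(1)] by simp
qed (simp_all add: submodule_zero assms(1))

end

text \<open>
  Generated submodules and quotients live in module records without extension fields, whereas
  \<open>module\<close> leaves the extension open; this locale fixes the type.
\<close>

locale plain_module = module R M for R (structure) and M :: "('a, 'b) module" (structure)
begin

lemma submodule_generated_submodule:
  assumes "X \<subseteq> carrier M"
  shows "submodule (submodule_generated R M X) R M"
proof (rule submoduleI')
  show "submodule_generated R M X \<subseteq> carrier M"
    unfolding submodule_generated_def using carrier_is_submodule assms by blast
  show "\<zero>\<^bsub>M\<^esub> \<in> submodule_generated R M X"
    unfolding submodule_generated_def using submodule_zero by blast
  show "a \<oplus>\<^bsub>M\<^esub> b \<in> submodule_generated R M X"
    if "a \<in> submodule_generated R M X" "b \<in> submodule_generated R M X" for a b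
    using that submoduleE(5) unfolding submodule_generated_def by blast
  show "a \<odot>\<^bsub>M\<^esub> x \<in> submodule_generated R M X"
    if "a \<in> carrier R" "x \<in> submodule_generated R M X" for a x
    using that submoduleE(4) unfolding submodule_generated_def by blast
qed

lemma submodule_generated_incl: "X \<subseteq> submodule_generated R M X"
  unfolding submodule_generated_def by blast

lemma submodule_generated_least:
  "submodule N R M \<Longrightarrow> X \<subseteq> N \<Longrightarrow> submodule_generated R M X \<subseteq> N"
  unfolding submodule_generated_def by blast

end

lemma (in linear_map) submodule_vimage:
  assumes "submodule N CC W"
  shows "submodule {x \<in> carrier V. f x \<in> N} CC V"
  using W.submoduleE[OF assms] W.submodule_zero[OF assms]
  by (intro V.submoduleI') (auto simp: local.add local.smult)

text \<open>
  The set on which two linear maps agree is a submodule. The integral and the involution are unique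
  for this reason, and the expansions in dual bases are verified in this way.
\<close>

lemma linear_map_eq_on_span:
  assumes "linear_map V W f" "linear_map V W g"
    and X: "X \<subseteq> carrier V" "carrier V \<subseteq> submodule_generated CC V X"
    and agree: "\<And>x. x \<in> X \<Longrightarrow> f x = g x" and "x \<in> carrier V"
  shows "f x = g x"
proof -
  interpret f: linear_map V W f by fact
  interpret g: linear_map V W g by fact
  have "submodule {x \<in> carrier V. f x = g x} CC V"
    by (rule f.V.submoduleI') (auto simp: f.add g.add f.smult g.smult)
  then have "submodule_generated CC V X \<subseteq> {x \<in> carrier V. f x = g x}"
    by (rule plain_module.submodule_generated_least[OF plain_module.intro[OF f.V.module_axioms]]) (use X agree in auto)
  then show ?thesis using X \<open>x \<in> carrier V\<close> by auto
qed

lemma free_module_simps: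
  "carrier (free_module R G) = {f. (\<forall>g\<in>G. f g \<in> carrier R) \<and> (\<forall>g. g \<notin> G \<longrightarrow> f g = \<zero>\<^bsub>R\<^esub>) \<and>
                   finite {g. f g \<noteq> \<zero>\<^bsub>R\<^esub>}}"
  "zero (free_module R G) = (\<lambda>_. \<zero>\<^bsub>R\<^esub>)"
  "add (free_module R G) = (\<lambda>f h g. f g \<oplus>\<^bsub>R\<^esub> h g)"
  "smult (free_module R G) = (\<lambda>a f g. a \<otimes>\<^bsub>R\<^esub> f g)"
  by (simp_all add: free_module_def)

context cring
begin

lemma free_module_apply_closed:
  "f \<in> carrier (free_module R G) \<Longrightarrow> f g \<in> carrier R"
  by (cases "g \<in> G") (auto simp: free_module_simps)

lemma module_free_module: "module R (free_module R G)" (is "module R ?M")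
proof (rule moduleI)
  show "abelian_group ?M"
  proof (rule abelian_groupI)
    fix f h assume f: "f \<in> carrier ?M" and h: "h \<in> carrier ?M"
    have "finite {g. f g \<oplus> h g \<noteq> \<zero>}"
    proof (rule finite_subset)
      show "{g. f g \<oplus> h g \<noteq> \<zero>} \<subseteq> {g. f g \<noteq> \<zero>} \<union> {g. h g \<noteq> \<zero>}" by auto
    qed (use f h in \<open>auto simp: free_module_simps\<close>)
    then show "f \<oplus>\<^bsub>?M\<^esub> h \<in> carrier ?M"
      using f h by (auto simp: free_module_simps)
    show "f \<oplus>\<^bsub>?M\<^esub> h = h \<oplus>\<^bsub>?M\<^esub> f"
      using free_module_apply_closed[OF f] free_module_apply_closed[OF h]
      by (auto simp: free_module_simps a_comm)
  next
    fix f assume f: "f \<in> carrier ?M"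
    show "\<exists>h\<in>carrier ?M. h \<oplus>\<^bsub>?M\<^esub> f = \<zero>\<^bsub>?M\<^esub>"
    proof
      have "finite {g. \<ominus> f g \<noteq> \<zero>}"
        by (rule finite_subset[of _ "{g. f g \<noteq> \<zero>}"]) (use f in \<open>auto simp: free_module_simps\<close>)
      then show "(\<lambda>g. \<ominus> f g) \<in> carrier ?M"
        using f by (auto simp: free_module_simps)
    qed (use free_module_apply_closed[OF f] in \<open>auto simp: free_module_simps l_neg\<close>)
    show "\<zero>\<^bsub>?M\<^esub> \<oplus>\<^bsub>?M\<^esub> f = f"
      using free_module_apply_closed[OF f] by (auto simp: free_module_simps)
  next
    fix f h k assume "f \<in> carrier ?M" "h \<in> carrier ?M"
      "k \<in> carrier ?M"
    note this [THEN free_module_apply_closed]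
    then show "f \<oplus>\<^bsub>?M\<^esub> h \<oplus>\<^bsub>?M\<^esub> k =
        f \<oplus>\<^bsub>?M\<^esub> (h \<oplus>\<^bsub>?M\<^esub> k)"
      by (auto simp: free_module_simps a_assoc)
  qed (auto simp: free_module_simps)
next
  fix a f assume a: "a \<in> carrier R" and f: "f \<in> carrier ?M"
  have "finite {g. a \<otimes> f g \<noteq> \<zero>}"
    by (rule finite_subset[of _ "{g. f g \<noteq> \<zero>}"]) (use a f in \<open>auto simp: free_module_simps\<close>)
  then show "a \<odot>\<^bsub>?M\<^esub> f \<in> carrier ?M"
    using a f by (auto simp: free_module_simps)
qed (auto simp: is_cring free_module_simps(2-4) free_module_apply_closed l_distr r_distr m_assoc)

lemma free_gen_closed: "g \<in> G \<Longrightarrow> free_gen R g \<in> carrier (free_module R G)"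
  by (auto simp: free_module_simps free_gen_def)

text \<open>
  Induction on a finite set containing the support: a function is the sum of its restriction to
  the complement of one point and a multiple of the generator at that point.
\<close>

lemma free_module_spanned:
  "carrier (free_module R G) \<subseteq> submodule_generated R (free_module R G) (free_gen R ` G)"
    (is "_ \<subseteq> ?N")
proof
  let ?M = "free_module R G"
  interpret M: plain_module R "free_module R G"
    by (rule plain_module.intro[OF module_free_module])
  have N: "submodule ?N R (free_module R G)"
    by (rule M.submodule_generated_submodule) (auto intro: free_gen_closed)
  have "u \<in> ?N" if "finite A" "u \<in> carrier ?M" "{g. u g \<noteq> \<zero>} \<subseteq> A" for A u
    using that
  proof (induction A arbitrary: u rule: finite_induct)
    case empty
    then have "u = \<zero>\<^bsub>?M\<^esub>" by (auto simp: free_module_simps)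
    then show ?case using M.submodule_zero[OF N] by simp
  next
    case (insert a A)
    note cl = free_module_apply_closed[OF insert.prems(1)]
    let ?v = "u(a := \<zero>)"
    have supp: "{g. ?v g \<noteq> \<zero>} \<subseteq> A" using insert.prems(2) by auto
    then have "finite {g. ?v g \<noteq> \<zero>}" using insert.hyps(1) finite_subset by blast
    with insert.prems(1) have v: "?v \<in> carrier ?M"
      by (auto simp: free_module_simps)
    show ?case
    proof (cases "a \<in> G")
      case True
      have "u = ?v \<oplus>\<^bsub>?M\<^esub> u a \<odot>\<^bsub>?M\<^esub> free_gen R a"
        using cl by (auto simp: free_module_simps free_gen_def fun_eq_iff)
      moreover have "free_gen R a \<in> ?N"
        using True M.submodule_generated_incl[of "free_gen R ` G"] by auto
      ultimately show ?thesis
        using insert.IH[OF v supp] M.submoduleE(4,5)[OF N] cl[of a] by metis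
    next
      case False
      then have "u a = \<zero>" using insert.prems(1) by (auto simp: free_module_simps)
      then have "u = ?v" by auto
      then show ?thesis using insert.IH[OF v supp] by simp
    qed
  qed
  then show "u \<in> ?N" if "u \<in> carrier ?M" for u
    using that by (auto simp: free_module_simps)
qed

end

locale quotient_of_module = plain_module R M for R (structure) and M (structure) +
  fixes N :: "'b set"
  assumes submodule: "submodule N R M"
begin

sublocale N: abelian_subgroup N M
proof (rule abelian_subgroupI3)
  show "additive_subgroup N M"
    using submodule by (auto intro: additive_subgroupI submodule.axioms(1))
qed (rule abelian_group_axioms)

lemma quotient_carrier: "carrier (quotient_module M N) = (\<lambda>x. N +>\<^bsub>M\<^esub> x) ` carrier M"
  by (auto simp: quotient_module_def A_RCOSETS_def' )

lemma quotient_zero: "\<zero>\<^bsub>quotient_module M N\<^esub> = N +>\<^bsub>M\<^esub> \<zero>\<^bsub>M\<^esub>"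
  using N.a_rcos_const[of "\<zero>\<^bsub>M\<^esub>"] by (simp add: quotient_module_def)

lemma quotient_add:
  "x \<in> carrier M \<Longrightarrow> y \<in> carrier M \<Longrightarrow>
    (N +>\<^bsub>M\<^esub> x) \<oplus>\<^bsub>quotient_module M N\<^esub> (N +>\<^bsub>M\<^esub> y) = N +>\<^bsub>M\<^esub> (x \<oplus>\<^bsub>M\<^esub> y)"
  by (simp add: quotient_module_def N.a_rcos_sum)

lemma coset_eq_iff:
  assumes "x \<in> carrier M" "y \<in> carrier M"
  shows "N +>\<^bsub>M\<^esub> x = N +>\<^bsub>M\<^esub> y \<longleftrightarrow> x \<ominus>\<^bsub>M\<^esub> y \<in> N"
proof -
  have "N +>\<^bsub>M\<^esub> x = N +>\<^bsub>M\<^esub> y \<longleftrightarrow> x \<in> N +>\<^bsub>M\<^esub> y"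
    using N.a_repr_independence'[of x y] N.a_repr_independenceD[of x y] assms by auto
  then show ?thesis using N.a_rcos_module[of y x] assms by (simp add: a_minus_def)
qed

text \<open>
  The multiple of a coset is defined as a union over all its elements. This is a single coset,
  because for \<open>y\<close> in the coset of \<open>x\<close> the difference of \<open>a y\<close> and \<open>a x\<close> is \<open>a (y - x)\<close>, which lies in \<open>N\<close>.
\<close>

lemma quotient_smult:
  assumes "a \<in> carrier R" "x \<in> carrier M"
  shows "a \<odot>\<^bsub>quotient_module M N\<^esub> (N +>\<^bsub>M\<^esub> x) = N +>\<^bsub>M\<^esub> (a \<odot>\<^bsub>M\<^esub> x)"
proof -
  have "N +>\<^bsub>M\<^esub> (a \<odot>\<^bsub>M\<^esub> y) = N +>\<^bsub>M\<^esub> (a \<odot>\<^bsub>M\<^esub> x)" if "y \<in> N +>\<^bsub>M\<^esub> x" for y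
  proof -
    have y: "y \<in> carrier M" using that assms(2) N.a_elemrcos_carrier by blast
    have "y \<ominus>\<^bsub>M\<^esub> x \<in> N" using that assms(2) y N.a_rcos_module[of x y] by (simp add: a_minus_def)
    then have "a \<odot>\<^bsub>M\<^esub> (y \<ominus>\<^bsub>M\<^esub> x) \<in> N" using submoduleE(4)[OF submodule] assms(1) by blast
    moreover have "a \<odot>\<^bsub>M\<^esub> (y \<ominus>\<^bsub>M\<^esub> x) = a \<odot>\<^bsub>M\<^esub> y \<ominus>\<^bsub>M\<^esub> a \<odot>\<^bsub>M\<^esub> x"
      using assms y by (simp add: a_minus_def smult_r_distr smult_r_minus)
    ultimately show ?thesis using coset_eq_iff assms y by simp
  qed
  moreover have "x \<in> N +>\<^bsub>M\<^esub> x" using assms by (simp add: N.a_rcos_self)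
  ultimately have "(\<Union>y\<in>N +>\<^bsub>M\<^esub> x. N +>\<^bsub>M\<^esub> (a \<odot>\<^bsub>M\<^esub> y)) = N +>\<^bsub>M\<^esub> (a \<odot>\<^bsub>M\<^esub> x)"
    by blast
  then show ?thesis by (simp add: quotient_module_def)
qed

lemma module_quotient: "module R (quotient_module M N)"
proof (rule moduleI)
  show "abelian_group (quotient_module M N)"
  proof (rule abelian_groupI)
    fix X assume "X \<in> carrier (quotient_module M N)"
    then obtain x where x: "x \<in> carrier M" "X = N +>\<^bsub>M\<^esub> x" by (auto simp: quotient_carrier)
    show "\<exists>Y\<in>carrier (quotient_module M N). Y \<oplus>\<^bsub>quotient_module M N\<^esub> X = \<zero>\<^bsub>quotient_module M N\<^esub>"
      by (rule bexI[of _ "N +>\<^bsub>M\<^esub> (\<ominus>\<^bsub>M\<^esub> x)"])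
        (use x in \<open>auto simp: quotient_carrier quotient_add quotient_zero l_neg\<close>)
  qed (auto simp: quotient_carrier quotient_add quotient_zero a_ac)
qed (auto simp: quotient_carrier quotient_add quotient_smult is_cring smult_l_distr
  smult_r_distr smult_assoc1)

lemma coset_closed: "x \<in> carrier M \<Longrightarrow> N +>\<^bsub>M\<^esub> x \<in> carrier (quotient_module M N)"
  by (auto simp: quotient_carrier)

lemma quotient_spanned:
  assumes X: "X \<subseteq> carrier M" "carrier M \<subseteq> submodule_generated R M X"
  shows "carrier (quotient_module M N) \<subseteq>
    submodule_generated R (quotient_module M N) ((\<lambda>x. N +>\<^bsub>M\<^esub> x) ` X)" (is "_ \<subseteq> ?L")
proof -
  interpret Q: plain_module R "quotient_module M N"
    by (rule plain_module.intro[OF module_quotient])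
  let ?J = "{x \<in> carrier M. N +>\<^bsub>M\<^esub> x \<in> ?L}"
  have L: "submodule ?L R (quotient_module M N)"
    by (rule Q.submodule_generated_submodule) (use X in \<open>auto simp: coset_closed\<close>)
  have "submodule ?J R M"
  proof (rule submoduleI')
    show "\<zero>\<^bsub>M\<^esub> \<in> ?J"
      using Q.submodule_zero[OF L] by (simp add: quotient_zero)
    show "a \<oplus>\<^bsub>M\<^esub> b \<in> ?J" if "a \<in> ?J" "b \<in> ?J" for a b
      using that Q.submoduleE(5)[OF L, of "N +>\<^bsub>M\<^esub> a" "N +>\<^bsub>M\<^esub> b"] by (simp add: quotient_add)
    show "a \<odot>\<^bsub>M\<^esub> x \<in> ?J" if "a \<in> carrier R" "x \<in> ?J" for a x
      using that Q.submoduleE(4)[OF L, of a "N +>\<^bsub>M\<^esub> x"] by (simp add: quotient_smult)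
  qed auto
  moreover have "X \<subseteq> ?J"
    using X Q.submodule_generated_incl[of "(\<lambda>x. N +>\<^bsub>M\<^esub> x) ` X"] by auto
  ultimately have "submodule_generated R M X \<subseteq> ?J"
    by (rule submodule_generated_least)
  then show ?thesis using X by (auto simp: quotient_carrier)
qed

text \<open>
  Maps out of a quotient are given as \<open>the_elem\<close> of the image of a coset; this computes them.
\<close>

lemma value_constant_on_coset:
  assumes "\<And>x y. x \<in> carrier M \<Longrightarrow> y \<in> carrier M \<Longrightarrow> f (x \<oplus>\<^bsub>M\<^esub> y) = f x \<oplus>\<^bsub>A\<^esub> f y"
    and "\<And>x. x \<in> N \<Longrightarrow> f x = \<zero>\<^bsub>A\<^esub>" "abelian_group A"
    and "\<And>x. x \<in> carrier M \<Longrightarrow> f x \<in> carrier A" "x \<in> carrier M"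
  shows "f ` (N +>\<^bsub>M\<^esub> x) = {f x}"
proof -
  interpret A: abelian_group A by fact
  have "f y = f x" if y: "y \<in> N +>\<^bsub>M\<^esub> x" for y
  proof -
    obtain n where n: "n \<in> N" "y = n \<oplus>\<^bsub>M\<^esub> x" using y by (auto simp: a_r_coset_def')
    have "f y = f n \<oplus>\<^bsub>A\<^esub> f x"
      unfolding n(2) using n(1) by (intro assms(1) N.a_Hcarr assms(5))
    then show ?thesis using assms(2)[OF n(1)] assms(4)[OF assms(5)] by simp
  qed
  moreover have "x \<in> N +>\<^bsub>M\<^esub> x" by (rule N.a_rcos_self) fact
  ultimately show ?thesis by blast
qed

end

section \<open>Tensor products and inverse pairings\<close>

locale two_spaces = V: module CC V + W: module CC W
  for V :: "(complex, 'a) module" and W :: "(complex, 'b) module"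
begin

abbreviation "P \<equiv> free_module CC (carrier V \<times> carrier W)"
abbreviation "T \<equiv> tensor_product V W"
abbreviation "tens \<equiv> pure_tensor V W"
abbreviation gen :: "'a \<Rightarrow> 'b \<Rightarrow> 'a \<times> 'b \<Rightarrow> complex" where "gen x y \<equiv> free_gen CC (x, y)"

sublocale P: plain_module CC P
  by (rule plain_module.intro cring.module_free_module cring_CC)+

lemma gen_closed [simp, intro]: "x \<in> carrier V \<Longrightarrow> y \<in> carrier W \<Longrightarrow> gen x y \<in> carrier P"
  by (rule cring.free_gen_closed[OF cring_CC]) simp

lemma tensor_relations_closed: "tensor_relations V W \<subseteq> carrier P"
  unfolding tensor_relations_def Let_def
  by (auto intro!: P.minus_closed P.add.m_closed P.smult_closed gen_closed
        V.add.m_closed W.add.m_closed V.smult_closed W.smult_closed simp del: P.smult_closed)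

lemma tensor_null_submodule: "submodule (tensor_null V W) CC P"
  unfolding tensor_null_def by (rule P.submodule_generated_submodule tensor_relations_closed)+

sublocale Q: quotient_of_module CC P "tensor_null V W"
  by (intro quotient_of_module.intro quotient_of_module_axioms.intro P.plain_module_axioms
      tensor_null_submodule)

lemma module_tensor_product: "module CC T"
  unfolding tensor_product_def by (rule Q.module_quotient)

sublocale T: module CC T
  by (rule module_tensor_product)

lemma relation_null: "u \<in> tensor_relations V W \<Longrightarrow> u \<in> tensor_null V W"
  unfolding tensor_null_def using P.submodule_generated_incl by blast

lemma tens_closed [simp, intro]: "x \<in> carrier V \<Longrightarrow> y \<in> carrier W \<Longrightarrow> tens x y \<in> carrier T"
  unfolding tensor_product_def pure_tensor_def by (intro Q.coset_closed gen_closed)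

lemma linear_map_tens_left:
  assumes y: "y \<in> carrier W"
  shows "linear_map V T (\<lambda>x. tens x y)"
proof (rule linear_mapI)
  show "tens (x \<oplus>\<^bsub>V\<^esub> x') y = tens x y \<oplus>\<^bsub>T\<^esub> tens x' y" if x: "x \<in> carrier V" "x' \<in> carrier V" for x x'
  proof -
    have "gen (x \<oplus>\<^bsub>V\<^esub> x') y \<ominus>\<^bsub>P\<^esub> (gen x y \<oplus>\<^bsub>P\<^esub> gen x' y) \<in> tensor_relations V W"
      using x y unfolding tensor_relations_def Let_def by blast
    from relation_null[OF this] show ?thesis using x y unfolding tensor_product_def pure_tensor_def
      by (subst Q.quotient_add) (auto simp: Q.coset_eq_iff)
  qed
  show "tens (c \<odot>\<^bsub>V\<^esub> x) y = c \<odot>\<^bsub>T\<^esub> tens x y" if x: "x \<in> carrier V" for c x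
  proof -
    have "gen (c \<odot>\<^bsub>V\<^esub> x) y \<ominus>\<^bsub>P\<^esub> c \<odot>\<^bsub>P\<^esub> gen x y \<in> tensor_relations V W"
      using x y unfolding tensor_relations_def Let_def by blast
    from relation_null[OF this] show ?thesis using x y unfolding tensor_product_def pure_tensor_def
      by (subst Q.quotient_smult) (auto simp: Q.coset_eq_iff)
  qed
qed (auto simp: y V.module_axioms T.module_axioms)

lemma linear_map_tens_right:
  assumes x: "x \<in> carrier V"
  shows "linear_map W T (tens x)"
proof (rule linear_mapI)
  show "tens x (y \<oplus>\<^bsub>W\<^esub> y') = tens x y \<oplus>\<^bsub>T\<^esub> tens x y'" if y: "y \<in> carrier W" "y' \<in> carrier W" for y y'
  proof -
    have "gen x (y \<oplus>\<^bsub>W\<^esub> y') \<ominus>\<^bsub>P\<^esub> (gen x y \<oplus>\<^bsub>P\<^esub> gen x y') \<in> tensor_relations V W"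
      using x y unfolding tensor_relations_def Let_def by blast
    from relation_null[OF this] show ?thesis using x y unfolding tensor_product_def pure_tensor_def
      by (subst Q.quotient_add) (auto simp: Q.coset_eq_iff)
  qed
  show "tens x (c \<odot>\<^bsub>W\<^esub> y) = c \<odot>\<^bsub>T\<^esub> tens x y" if y: "y \<in> carrier W" for c y
  proof -
    have "gen x (c \<odot>\<^bsub>W\<^esub> y) \<ominus>\<^bsub>P\<^esub> c \<odot>\<^bsub>P\<^esub> gen x y \<in> tensor_relations V W"
      using x y unfolding tensor_relations_def Let_def by blast
    from relation_null[OF this] show ?thesis using x y unfolding tensor_product_def pure_tensor_def
      by (subst Q.quotient_smult) (auto simp: Q.coset_eq_iff)
  qed
qed (auto simp: x W.module_axioms T.module_axioms)

lemma tensor_product_spanned: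
  "carrier T \<subseteq> submodule_generated CC T ((\<lambda>(x, y). tens x y) ` (carrier V \<times> carrier W))"
proof -
  have "(\<lambda>u. tensor_null V W +>\<^bsub>P\<^esub> u) ` free_gen CC ` (carrier V \<times> carrier W) =
      (\<lambda>(x, y). tens x y) ` (carrier V \<times> carrier W)"
    unfolding image_image by (rule image_cong) (auto simp: pure_tensor_def)
  moreover have "free_gen CC ` (carrier V \<times> carrier W) \<subseteq> carrier P" by auto
  ultimately show ?thesis
    using Q.quotient_spanned[OF _ cring.free_module_spanned[OF cring_CC]]
    unfolding tensor_product_def by metis
qed

text \<open>
  The map on formal combinations of pairs that sends \<open>(x, y)\<close> to \<open>f(y) x\<close>; passing to the quotient
  gives \<open>tensor_to_map\<close>.
\<close>

definition contract :: "('b \<Rightarrow> complex) \<Rightarrow> ('a \<times> 'b \<Rightarrow> complex) \<Rightarrow> 'a" where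
  "contract f u = (\<Oplus>\<^bsub>V\<^esub>p\<in>{p. u p \<noteq> 0}. (u p * f (snd p)) \<odot>\<^bsub>V\<^esub> fst p)"

text \<open>
  The sum in \<open>contract\<close> runs over the support of \<open>u\<close>. Comparing different \<open>u\<close> requires a common
  finite index set, on which the additional terms vanish.
\<close>

lemma contract_eq_finsum:
  assumes "finite A" "{p. u p \<noteq> 0} \<subseteq> A" "A \<subseteq> carrier V \<times> carrier W"
  shows "contract f u = (\<Oplus>\<^bsub>V\<^esub>p\<in>A. (u p * f (snd p)) \<odot>\<^bsub>V\<^esub> fst p)"
  unfolding contract_def
proof (rule V.add.finprod_mono_neutral_cong_left)
  show "(u p * f (snd p)) \<odot>\<^bsub>V\<^esub> fst p = \<zero>\<^bsub>V\<^esub>" if "p \<in> A - {p. u p \<noteq> 0}" for p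
    using that assms V.smult_l_null[of "fst p"] by (cases p) (auto simp: subset_iff)
qed (use assms in auto)

lemma contract_closed:
  assumes "u \<in> carrier P"
  shows "contract f u \<in> carrier V"
proof -
  have "{p. u p \<noteq> 0} \<subseteq> carrier V \<times> carrier W" using assms by (auto simp: free_module_simps)
  then show ?thesis unfolding contract_def by (intro V.finsum_closed) auto
qed

lemma linear_map_contract: "linear_map P V (contract f)"
proof (rule linear_mapI)
  fix u v assume u: "u \<in> carrier P" and v: "v \<in> carrier P"
  let ?A = "{p. u p \<noteq> 0} \<union> {p. v p \<noteq> 0}"
  have A: "finite ?A" "?A \<subseteq> carrier V \<times> carrier W"
    using u v by (auto simp: free_module_simps)
  have "contract f (u \<oplus>\<^bsub>P\<^esub> v) = (\<Oplus>\<^bsub>V\<^esub>p\<in>?A. ((u p + v p) * f (snd p)) \<odot>\<^bsub>V\<^esub> fst p)"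
    using A by (subst contract_eq_finsum[of ?A]) (auto simp: free_module_simps)
  also have "\<dots> = (\<Oplus>\<^bsub>V\<^esub>p\<in>?A. (u p * f (snd p)) \<odot>\<^bsub>V\<^esub> fst p \<oplus>\<^bsub>V\<^esub> (v p * f (snd p)) \<odot>\<^bsub>V\<^esub> fst p)"
  proof (rule V.finsum_cong')
    show "((u p + v p) * f (snd p)) \<odot>\<^bsub>V\<^esub> fst p =
        (u p * f (snd p)) \<odot>\<^bsub>V\<^esub> fst p \<oplus>\<^bsub>V\<^esub> (v p * f (snd p)) \<odot>\<^bsub>V\<^esub> fst p" if "p \<in> ?A" for p
      using V.smult_l_distr[of "u p * f (snd p)" "v p * f (snd p)" "fst p"] A that
      by (auto simp: distrib_right)
  qed (use A in auto)
  also have "\<dots> = (\<Oplus>\<^bsub>V\<^esub>p\<in>?A. (u p * f (snd p)) \<odot>\<^bsub>V\<^esub> fst p) \<oplus>\<^bsub>V\<^esub>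
      (\<Oplus>\<^bsub>V\<^esub>p\<in>?A. (v p * f (snd p)) \<odot>\<^bsub>V\<^esub> fst p)"
    by (rule V.finsum_addf) (use A in auto)
  also have "\<dots> = contract f u \<oplus>\<^bsub>V\<^esub> contract f v"
    using A by (simp add: contract_eq_finsum[of ?A])
  finally show "contract f (u \<oplus>\<^bsub>P\<^esub> v) = contract f u \<oplus>\<^bsub>V\<^esub> contract f v" .
next
  fix c u assume u: "u \<in> carrier P"
  let ?A = "{p. u p \<noteq> 0}"
  have A: "finite ?A" "?A \<subseteq> carrier V \<times> carrier W"
    using u by (auto simp: free_module_simps)
  have "contract f (c \<odot>\<^bsub>P\<^esub> u) = (\<Oplus>\<^bsub>V\<^esub>p\<in>?A. ((c * u p) * f (snd p)) \<odot>\<^bsub>V\<^esub> fst p)"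
    using A by (subst contract_eq_finsum[of ?A]) (auto simp: free_module_simps)
  also have "\<dots> = (\<Oplus>\<^bsub>V\<^esub>p\<in>?A. c \<odot>\<^bsub>V\<^esub> ((u p * f (snd p)) \<odot>\<^bsub>V\<^esub> fst p))"
  proof (rule V.finsum_cong')
    show "((c * u p) * f (snd p)) \<odot>\<^bsub>V\<^esub> fst p = c \<odot>\<^bsub>V\<^esub> ((u p * f (snd p)) \<odot>\<^bsub>V\<^esub> fst p)"
      if "p \<in> ?A" for p
      using V.smult_assoc1[of c "u p * f (snd p)" "fst p"] A that by (auto simp: mult.assoc)
  qed (use A in auto)
  also have "\<dots> = c \<odot>\<^bsub>V\<^esub> contract f u"
    unfolding contract_def by (rule V.finsum_smult_ldistr[symmetric]) (use A in auto)
  finally show "contract f (c \<odot>\<^bsub>P\<^esub> u) = c \<odot>\<^bsub>V\<^esub> contract f u" .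
qed (auto intro: contract_closed V.module_axioms P.module_axioms)

lemma contract_gen:
  assumes "x \<in> carrier V" "y \<in> carrier W"
  shows "contract f (gen x y) = f y \<odot>\<^bsub>V\<^esub> x"
proof -
  have "contract f (gen x y) = (\<Oplus>\<^bsub>V\<^esub>p\<in>{(x, y)}. (gen x y p * f (snd p)) \<odot>\<^bsub>V\<^esub> fst p)"
    by (rule contract_eq_finsum) (use assms in \<open>auto simp: free_gen_def split: if_splits\<close>)
  also have "\<dots> = f y \<odot>\<^bsub>V\<^esub> x" using assms by (simp add: free_gen_def)
  finally show ?thesis .
qed

text \<open>
  The kernel of the contraction is a submodule, so it suffices to look at the relations of bilinearity.
\<close>

lemma contract_null:
  assumes f: "f \<in> dual_space W" and u: "u \<in> tensor_null V W"
  shows "contract f u = \<zero>\<^bsub>V\<^esub>"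
proof -
  interpret c: linear_map P V "contract f" by (rule linear_map_contract)
  interpret f: linear_map W CC f
    by (rule linear_mapI_linear_maps) (use f in \<open>auto simp: dual_space_def W.module_axioms module_CC\<close>)
  have 1: "contract f (gen (x \<oplus>\<^bsub>V\<^esub> x') y \<ominus>\<^bsub>P\<^esub> (gen x y \<oplus>\<^bsub>P\<^esub> gen x' y)) = \<zero>\<^bsub>V\<^esub>"
    if "x \<in> carrier V" "x' \<in> carrier V" "y \<in> carrier W" for x x' y
    using that by (simp add: c.minus c.add contract_gen V.smult_r_distr) (simp add: a_minus_def V.r_neg)
  have 2: "contract f (gen x (y \<oplus>\<^bsub>W\<^esub> y') \<ominus>\<^bsub>P\<^esub> (gen x y \<oplus>\<^bsub>P\<^esub> gen x y')) = \<zero>\<^bsub>V\<^esub>"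
    if "x \<in> carrier V" "y \<in> carrier W" "y' \<in> carrier W" for x y y'
    using that V.smult_l_distr[of "f y" "f y'" x]
    by (simp add: c.minus c.add contract_gen f.add) (simp add: a_minus_def V.r_neg)
  have 3: "contract f (gen (a \<odot>\<^bsub>V\<^esub> x) y \<ominus>\<^bsub>P\<^esub> a \<odot>\<^bsub>P\<^esub> gen x y) = \<zero>\<^bsub>V\<^esub>"
    if "x \<in> carrier V" "y \<in> carrier W" for a x y
    using that V.smult_assoc1[of "f y" a x] V.smult_assoc1[of a "f y" x]
    by (simp add: c.minus c.smult contract_gen) (simp add: a_minus_def V.r_neg mult.commute)
  have 4: "contract f (gen x (a \<odot>\<^bsub>W\<^esub> y) \<ominus>\<^bsub>P\<^esub> a \<odot>\<^bsub>P\<^esub> gen x y) = \<zero>\<^bsub>V\<^esub>"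
    if "x \<in> carrier V" "y \<in> carrier W" for a x y
    using that V.smult_assoc1[of a "f y" x]
    by (simp add: c.minus c.smult contract_gen f.smult) (simp add: a_minus_def V.r_neg)
  have "contract f u = \<zero>\<^bsub>V\<^esub>" if "u \<in> tensor_relations V W" for u
    using that unfolding tensor_relations_def Let_def
    by (elim UnE CollectE exE conjE) (simp_all only: 1 2 3 4)
  then have "tensor_relations V W \<subseteq> {u \<in> carrier P. contract f u = \<zero>\<^bsub>V\<^esub>}"
    using tensor_relations_closed by blast
  moreover have "submodule {u \<in> carrier P. contract f u = \<zero>\<^bsub>V\<^esub>} CC P"
    by (rule P.submoduleI') (auto simp: c.add c.smult)
  ultimately show ?thesis
    using P.submodule_generated_least u unfolding tensor_null_def by blast
qed

lemma tensor_to_map_coset: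
  assumes "f \<in> dual_space W" "u \<in> carrier P"
  shows "tensor_to_map V W (tensor_null V W +>\<^bsub>P\<^esub> u) f = contract f u"
proof -
  interpret c: linear_map P V "contract f" by (rule linear_map_contract)
  have "contract f ` (tensor_null V W +>\<^bsub>P\<^esub> u) = {contract f u}"
    by (rule Q.value_constant_on_coset[where A = V])
      (use assms in \<open>auto simp: c.add contract_null V.abelian_group_axioms\<close>)
  moreover have "tensor_to_map V W t f = the_elem (contract f ` t)" for t
    unfolding tensor_to_map_def contract_def ..
  ultimately show ?thesis by simp
qed

lemma linear_map_tensor_to_map:
  assumes "f \<in> dual_space W"
  shows "linear_map T V (\<lambda>t. tensor_to_map V W t f)"
proof -
  interpret c: linear_map P V "contract f" by (rule linear_map_contract)
  show ?thesis
  proof (rule linear_mapI)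
    show "tensor_to_map V W t f \<in> carrier V" if "t \<in> carrier T" for t
      using that assms by (auto simp: tensor_product_def Q.quotient_carrier tensor_to_map_coset)
    show "tensor_to_map V W (s \<oplus>\<^bsub>T\<^esub> t) f = tensor_to_map V W s f \<oplus>\<^bsub>V\<^esub> tensor_to_map V W t f"
      if "s \<in> carrier T" "t \<in> carrier T" for s t
      using that assms
      by (auto simp: tensor_product_def Q.quotient_carrier tensor_to_map_coset Q.quotient_add c.add)
    show "tensor_to_map V W (a \<odot>\<^bsub>T\<^esub> t) f = a \<odot>\<^bsub>V\<^esub> tensor_to_map V W t f"
      if "t \<in> carrier T" for a t
      using that assms
      by (auto simp: tensor_product_def Q.quotient_carrier tensor_to_map_coset Q.quotient_smult c.smult)
  qed (auto simp: V.module_axioms T.module_axioms)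
qed

lemma tensor_to_map_tens:
  assumes "f \<in> dual_space W" "x \<in> carrier V" "y \<in> carrier W"
  shows "tensor_to_map V W (tens x y) f = f y \<odot>\<^bsub>V\<^esub> x"
  unfolding pure_tensor_def using assms by (simp add: tensor_to_map_coset contract_gen)

end

text \<open>
  Two biorthogonal spanning families. By \<open>expand_left\<close> and \<open>expand_right\<close> they are bases, and the
  coordinates with respect to one are the values of the pairing on the other.
\<close>

locale dual_bases = two_spaces V W
  for V :: "(complex, 'a) module" and W :: "(complex, 'b) module" +
  fixes \<chi> :: "'a \<Rightarrow> 'b \<Rightarrow> complex" and B :: "'i set" and e :: "'i \<Rightarrow> 'a" and w :: "'i \<Rightarrow> 'b"
  assumes fin: "finite B"
    and linear_right: "x \<in> carrier V \<Longrightarrow> linear_map W CC (\<chi> x)"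
    and linear_left: "y \<in> carrier W \<Longrightarrow> linear_map V CC (\<lambda>x. \<chi> x y)"
    and e_closed: "b \<in> B \<Longrightarrow> e b \<in> carrier V"
    and w_closed: "b \<in> B \<Longrightarrow> w b \<in> carrier W"
    and e_span: "carrier V \<subseteq> submodule_generated CC V (e ` B)"
    and w_span: "carrier W \<subseteq> submodule_generated CC W (w ` B)"
    and biorthogonal: "b \<in> B \<Longrightarrow> b' \<in> B \<Longrightarrow> \<chi> (e b) (w b') = (if b = b' then 1 else 0)"
begin

lemma expand_left:
  assumes "x \<in> carrier V"
  shows "x = (\<Oplus>\<^bsub>V\<^esub>b\<in>B. \<chi> x (w b) \<odot>\<^bsub>V\<^esub> e b)" (is "_ = ?g x")
proof (rule linear_map_eq_on_span[OF linear_map_id _ _ e_span _ assms])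
  show "module CC V" by (rule V.module_axioms)
  show "linear_map V V ?g"
    by (intro linear_map_finsum V.module_axioms
        linear_map_comp[OF linear_left linear_map_smult_left[OF V.module_axioms]] e_closed w_closed)
  show "e ` B \<subseteq> carrier V" using e_closed by blast
  fix x assume "x \<in> e ` B"
  then obtain b where b: "b \<in> B" "x = e b" by blast
  have "?g x = (\<Oplus>\<^bsub>V\<^esub>c\<in>{b}. \<chi> x (w c) \<odot>\<^bsub>V\<^esub> e c)"
    by (rule V.add.finprod_mono_neutral_cong_right)
      (use b fin e_closed V.smult_l_null in \<open>auto simp: biorthogonal\<close>)
  also have "\<dots> = x" using b e_closed V.smult_one by (simp add: biorthogonal)
  finally show "x = ?g x" ..
qed

lemma expand_right:
  assumes "y \<in> carrier W"
  shows "y = (\<Oplus>\<^bsub>W\<^esub>b\<in>B. \<chi> (e b) y \<odot>\<^bsub>W\<^esub> w b)" (is "_ = ?g y")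
proof (rule linear_map_eq_on_span[OF linear_map_id _ _ w_span _ assms])
  show "module CC W" by (rule W.module_axioms)
  show "linear_map W W ?g"
    by (intro linear_map_finsum W.module_axioms
        linear_map_comp[OF linear_right linear_map_smult_left[OF W.module_axioms]] e_closed w_closed)
  show "w ` B \<subseteq> carrier W" using w_closed by blast
  fix y assume "y \<in> w ` B"
  then obtain b where b: "b \<in> B" "y = w b" by blast
  have "?g y = (\<Oplus>\<^bsub>W\<^esub>c\<in>{b}. \<chi> (e c) y \<odot>\<^bsub>W\<^esub> w c)"
    by (rule W.add.finprod_mono_neutral_cong_right)
      (use b fin w_closed W.smult_l_null in \<open>auto simp: biorthogonal\<close>)
  also have "\<dots> = y" using b w_closed W.smult_one by (simp add: biorthogonal)
  finally show "y = ?g y" ..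
qed

abbreviation inverse_map :: "('b \<Rightarrow> complex) \<Rightarrow> 'a" where
  "inverse_map f \<equiv> \<Oplus>\<^bsub>V\<^esub>b\<in>B. f (w b) \<odot>\<^bsub>V\<^esub> e b"

lemma pairing_map_in_dual: "x \<in> carrier V \<Longrightarrow> pairing_map W \<chi> x \<in> dual_space W"
  unfolding pairing_map_def dual_space_def by (rule linear_map.in_linear_maps linear_right)+

lemma inverse_map_closed: "inverse_map f \<in> carrier V"
  using e_closed by (intro V.finsum_closed) auto

lemma inverse_map_pairing_map:
  assumes "x \<in> carrier V"
  shows "inverse_map (pairing_map W \<chi> x) = x"
proof -
  have "inverse_map (pairing_map W \<chi> x) = inverse_map (\<chi> x)"
    using w_closed e_closed by (intro V.finsum_cong') (auto simp: pairing_map_def)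
  then show ?thesis using expand_left[OF assms] by simp
qed

lemma pairing_map_inverse_map:
  assumes "f \<in> dual_space W"
  shows "pairing_map W \<chi> (inverse_map f) = f"
proof
  interpret f: linear_map W CC f
    by (rule linear_mapI_linear_maps)
      (use assms in \<open>auto simp: dual_space_def W.module_axioms module_CC\<close>)
  fix y
  show "pairing_map W \<chi> (inverse_map f) y = f y"
  proof (cases "y \<in> carrier W")
    case True
    interpret l: linear_map V CC "\<lambda>x. \<chi> x y" by (rule linear_left[OF True])
    have "\<chi> (inverse_map f) y = (\<Sum>b\<in>B. f (w b) * \<chi> (e b) y)"
      using e_closed by (subst l.finsum) (auto simp: l.smult intro!: sum.cong)
    also have "\<dots> = f (\<Oplus>\<^bsub>W\<^esub>b\<in>B. \<chi> (e b) y \<odot>\<^bsub>W\<^esub> w b)"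
      using w_closed by (subst f.finsum) (auto simp: f.smult mult.commute intro!: sum.cong)
    also have "\<dots> = f y" using expand_right[OF True] by simp
    finally show ?thesis using True by (simp add: pairing_map_def)
  next
    case False
    then show ?thesis using assms
      by (auto simp: pairing_map_def dual_space_def linear_maps_def PiE_def extensional_def)
  qed
qed

lemma nondegenerate: "nondegenerate_pairing V W \<chi>"
  unfolding nondegenerate_pairing_def
  by (rule bij_betw_byWitness[where f' = inverse_map])
    (auto simp: inverse_map_pairing_map pairing_map_inverse_map pairing_map_in_dual inverse_map_closed)

lemma inv_into_pairing_map:
  assumes "f \<in> dual_space W"
  shows "inv_into (carrier V) (pairing_map W \<chi>) f = inverse_map f"
proof (rule inv_into_f_eq)
  show "inj_on (pairing_map W \<chi>) (carrier V)"
    using nondegenerate by (auto simp: nondegenerate_pairing_def bij_betw_def)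
qed (use assms in \<open>simp_all add: pairing_map_inverse_map inverse_map_closed\<close>)

text \<open>
  For a pure tensor \<open>x \<otimes> y\<close> this is the expansion of \<open>y\<close> in the family \<open>w\<close>, with the
  coefficients moved to the left factor. Hence a tensor is determined by its map on the dual
  space, which gives the uniqueness in the definition of \<open>pairing_inverse\<close>.
\<close>

lemma tensor_expansion:
  assumes "t \<in> carrier T"
  shows "t = (\<Oplus>\<^bsub>T\<^esub>b\<in>B. tens (tensor_to_map V W t (pairing_map W \<chi> (e b))) (w b))"
    (is "_ = ?g t")
proof (rule linear_map_eq_on_span[OF linear_map_id _ _ tensor_product_spanned _ assms])
  show "module CC T" by (rule T.module_axioms)
  show "linear_map T T ?g"
    by (intro linear_map_finsum T.module_axioms
        linear_map_comp[OF linear_map_tensor_to_map linear_map_tens_left]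
        pairing_map_in_dual e_closed w_closed)
  show "(\<lambda>(x, y). tens x y) ` (carrier V \<times> carrier W) \<subseteq> carrier T" by auto
  fix s assume "s \<in> (\<lambda>(x, y). tens x y) ` (carrier V \<times> carrier W)"
  then obtain x y where xy: "x \<in> carrier V" "y \<in> carrier W" "s = tens x y" by auto
  interpret l: linear_map W T "tens x" by (rule linear_map_tens_right) fact
  have "?g s = (\<Oplus>\<^bsub>T\<^esub>b\<in>B. \<chi> (e b) y \<odot>\<^bsub>T\<^esub> tens x (w b))"
  proof (rule T.finsum_cong')
    fix b assume b: "b \<in> B"
    interpret r: linear_map V T "\<lambda>x. tens x (w b)" by (rule linear_map_tens_left w_closed b)+
    show "tens (tensor_to_map V W s (pairing_map W \<chi> (e b))) (w b) = \<chi> (e b) y \<odot>\<^bsub>T\<^esub> tens x (w b)"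
      using xy e_closed[OF b]
      by (simp add: tensor_to_map_tens pairing_map_in_dual r.smult) (simp add: pairing_map_def)
  qed (use xy w_closed in auto)
  also have "\<dots> = tens x (\<Oplus>\<^bsub>W\<^esub>b\<in>B. \<chi> (e b) y \<odot>\<^bsub>W\<^esub> w b)"
    using w_closed xy by (subst l.finsum, force, intro T.finsum_cong'[OF refl]) (auto simp: l.smult)
  also have "\<dots> = s" using expand_right[OF xy(2)] xy(3) by simp
  finally show "s = ?g s" ..
qed

theorem pairing_inverse_eq: "pairing_inverse V W \<chi> = (\<Oplus>\<^bsub>T\<^esub>b\<in>B. tens (e b) (w b))" (is "_ = ?t")
  unfolding pairing_inverse_def
proof (rule the_equality)
  have t: "?t \<in> carrier T" using e_closed w_closed by (intro T.finsum_closed) auto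
  have map_t: "tensor_to_map V W ?t f = inverse_map f" if f: "f \<in> dual_space W" for f
  proof -
    interpret m: linear_map T V "\<lambda>t. tensor_to_map V W t f" by (rule linear_map_tensor_to_map[OF f])
    show ?thesis
      using e_closed w_closed f
      by (subst m.finsum) (auto simp: tensor_to_map_tens intro!: V.finsum_cong')
  qed
  show "?t \<in> carrier T \<and> (\<forall>f\<in>dual_space W.
      tensor_to_map V W ?t f = inv_into (carrier V) (pairing_map W \<chi>) f)"
    using t map_t inv_into_pairing_map by simp
  fix s assume s: "s \<in> carrier T \<and> (\<forall>f\<in>dual_space W.
      tensor_to_map V W s f = inv_into (carrier V) (pairing_map W \<chi>) f)"
  have "tensor_to_map V W s (pairing_map W \<chi> (e b)) = tensor_to_map V W ?t (pairing_map W \<chi> (e b))"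
    if "b \<in> B" for b
    using s map_t inv_into_pairing_map pairing_map_in_dual e_closed that by simp
  then have "(\<Oplus>\<^bsub>T\<^esub>b\<in>B. tens (tensor_to_map V W s (pairing_map W \<chi> (e b))) (w b)) =
      (\<Oplus>\<^bsub>T\<^esub>b\<in>B. tens (tensor_to_map V W ?t (pairing_map W \<chi> (e b))) (w b))"
    using inverse_map_closed w_closed map_t pairing_map_in_dual e_closed
    by (intro T.finsum_cong') auto
  then show "s = ?t"
    using tensor_expansion[OF t] tensor_expansion[of s] s by simp
qed

end

section \<open>The untwisted sector \<open>H\<^sub>0\<close>\<close>

text \<open>
  The indices of the rays of a simplicial subdivision of the cone over \<open>v\<^sub>0\<close> and \<open>v\<^sub>n\<close>.
\<close>

locale fan =
  fixes S :: "nat set" and n :: nat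
  assumes fan_finite: "finite S" and zero_in: "0 \<in> S" and n_in: "n \<in> S"
    and fan_le: "i \<in> S \<Longrightarrow> i \<le> n" and n_pos: "0 < n"

lemma poly_mapping_add_induct [case_names zero single add]:
  assumes "P 0" "\<And>k v. k \<in> Poly_Mapping.keys f \<Longrightarrow> P (Poly_Mapping.single k v)"
    and "\<And>f g. P f \<Longrightarrow> P g \<Longrightarrow> P (f + g)"
  shows "P (f :: 'a \<Rightarrow>\<^sub>0 'b::comm_monoid_add)"
  using assms(2)
proof (induction f rule: update_induct)
  case const
  show ?case by (rule assms(1))
next
  case (update f a b)
  have "Poly_Mapping.update a b f = f + Poly_Mapping.single a b"
    using update.hyps
    by (intro poly_mapping_eqI)
      (auto simp: lookup_update lookup_add lookup_single when_def in_keys_iff)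
  moreover have "P f" using update by (auto simp: keys_update)
  moreover have "P (Poly_Mapping.single a b)" using update by (auto simp: keys_update)
  ultimately show ?case using assms(3) by simp
qed

abbreviation const_coeff :: "cpoly \<Rightarrow> complex" where
  "const_coeff p \<equiv> Poly_Mapping.lookup p 0"

definition lin_coeff :: "cpoly \<Rightarrow> nat \<Rightarrow> complex" where
  "lin_coeff p i = Poly_Mapping.lookup p (Poly_Mapping.single i 1)"

lemma lin_coeff_add: "lin_coeff (p + q) i = lin_coeff p i + lin_coeff q i"
  by (simp add: lin_coeff_def lookup_add)

lemma monomial_sum_eq_zero:
  fixes m m' :: "(nat, nat) poly_mapping"
  shows "m + m' = 0 \<longleftrightarrow> m = 0 \<and> m' = 0"
  by (auto simp: poly_mapping_eq_iff lookup_add fun_eq_iff)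

lemma monomial_sum_eq_var:
  fixes m m' :: "(nat, nat) poly_mapping"
  shows "m + m' = Poly_Mapping.single i 1 \<longleftrightarrow>
    m = 0 \<and> m' = Poly_Mapping.single i 1 \<or> m = Poly_Mapping.single i 1 \<and> m' = 0"
proof
  assume "m + m' = Poly_Mapping.single i 1"
  then have *: "Poly_Mapping.lookup m j + Poly_Mapping.lookup m' j = (1 when i = j)" for j
    by (metis lookup_add lookup_single)
  have zero_at_i: "Poly_Mapping.lookup m i = 0 \<or> Poly_Mapping.lookup m' i = 0"
    using *[of i] by auto
  have other: "Poly_Mapping.lookup m j = 0" "Poly_Mapping.lookup m' j = 0" if "i \<noteq> j" for j
    using *[of j] that by auto
  have "m = 0" if "Poly_Mapping.lookup m i = 0"
    using that other by (intro poly_mapping_eqI) (metis lookup_zero)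
  moreover have "m' = 0" if "Poly_Mapping.lookup m' i = 0"
    using that other by (intro poly_mapping_eqI) (metis lookup_zero)
  ultimately show "m = 0 \<and> m' = Poly_Mapping.single i 1 \<or> m = Poly_Mapping.single i 1 \<and> m' = 0"
    using zero_at_i \<open>m + m' = Poly_Mapping.single i 1\<close> by auto
qed auto

text \<open>
  The constant and linear coefficients of a polynomial describe it modulo all products of two
  variables. They are multiplied as in the ring of dual numbers, because \<open>1\<close> and a
  variable factor only trivially into monomials.
\<close>

lemma const_coeff_mult: "const_coeff (p * q) = const_coeff p * const_coeff q"
proof (induction p rule: poly_mapping_add_induct)
  case (single k v)
  show ?case
  proof (induction q rule: poly_mapping_add_induct)
    case (single k' v')
    show ?case using monomial_sum_eq_zero[of k k']
      by (auto simp: mult_single lookup_single when_def)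
  qed (auto simp: distrib_left lookup_add)
qed (auto simp: distrib_right lookup_add)

lemma lin_coeff_mult:
  "lin_coeff (p * q) i = const_coeff p * lin_coeff q i + lin_coeff p i * const_coeff q"
proof (induction p rule: poly_mapping_add_induct)
  case (single k v)
  show ?case
  proof (induction q rule: poly_mapping_add_induct)
    case (single k' v')
    have "Poly_Mapping.single i 1 \<noteq> (0 :: (nat, nat) poly_mapping)"
      by (metis lookup_single_eq lookup_zero zero_neq_one)
    then show ?case using monomial_sum_eq_var[of k k' i]
      by (auto simp: lin_coeff_def mult_single lookup_single when_def)
  qed (auto simp: distrib_left lookup_add lin_coeff_def)
qed (auto simp: distrib_right lookup_add lin_coeff_def)

lemma const_coeff_var [simp]: "const_coeff (poly_var i) = 0"
  unfolding poly_var_def lookup_single when_def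
  by (metis lookup_single_eq lookup_zero zero_neq_one)

lemma lin_coeff_var [simp]: "lin_coeff (poly_var i) j = (if i = j then 1 else 0)"
proof -
  have "Poly_Mapping.single i 1 = Poly_Mapping.single j (1::nat) \<longleftrightarrow> i = j"
    by (metis lookup_single_eq lookup_single_not_eq zero_neq_one)
  then show ?thesis by (simp add: lin_coeff_def poly_var_def lookup_single when_def)
qed

lemma const_coeff_const [simp]: "const_coeff (poly_const c) = c"
  by (simp add: poly_const_def)

lemma lin_coeff_const [simp]: "lin_coeff (poly_const c) i = 0"
  unfolding lin_coeff_def poly_const_def lookup_single when_def
  by (metis lookup_single_eq lookup_zero zero_neq_one)

lemma poly_const_simps:
  "poly_const (a + b) = poly_const a + poly_const b"
  "poly_const (a * b) = poly_const a * poly_const b"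
  "poly_const 1 = 1" "poly_const 0 = 0"
  by (simp_all add: poly_const_def single_add mult_single)

lemma poly_ring_simps:
  "carrier (poly_ring S) = {p. \<forall>m\<in>Poly_Mapping.keys p. Poly_Mapping.keys m \<subseteq> S}"
  "mult (poly_ring S) = (*)" "one (poly_ring S) = 1" "zero (poly_ring S) = 0"
  "add (poly_ring S) = (+)"
  by (simp_all add: poly_ring_def)

lemma poly_ring_mult_closed:
  assumes "p \<in> carrier (poly_ring S)" "q \<in> carrier (poly_ring S)"
  shows "p * q \<in> carrier (poly_ring S)"
proof -
  have "Poly_Mapping.keys m \<subseteq> S" if m: "m \<in> Poly_Mapping.keys (p * q)" for m
  proof -
    obtain a b where ab: "m = a + b" "a \<in> Poly_Mapping.keys p" "b \<in> Poly_Mapping.keys q"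
      using m keys_mult[of p q] by auto
    then have "Poly_Mapping.keys a \<subseteq> S" "Poly_Mapping.keys b \<subseteq> S"
      using assms by (auto simp: poly_ring_simps)
    then show ?thesis unfolding ab(1) using Poly_Mapping.keys_add[of a b] by blast
  qed
  then show ?thesis by (auto simp: poly_ring_simps)
qed

lemma poly_ring_add_closed:
  assumes "p \<in> carrier (poly_ring S)" "q \<in> carrier (poly_ring S)"
  shows "p + q \<in> carrier (poly_ring S)"
  using assms Poly_Mapping.keys_add[of p q] by (auto simp: poly_ring_simps)

lemma poly_const_closed [simp, intro]: "poly_const c \<in> carrier (poly_ring S)"
  by (auto simp: poly_ring_simps poly_const_def)

lemma poly_var_closed [simp, intro]: "i \<in> S \<Longrightarrow> poly_var i \<in> carrier (poly_ring S)"
  by (auto simp: poly_ring_simps poly_var_def)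

lemma poly_one_closed [simp, intro]: "1 \<in> carrier (poly_ring S)"
  using poly_const_closed[of 1] by (simp add: poly_const_simps)

lemma poly_zero_closed [simp, intro]: "0 \<in> carrier (poly_ring S)"
  by (simp add: poly_ring_simps)

lemma poly_sum_closed: "(\<And>i. i \<in> A \<Longrightarrow> f i \<in> carrier (poly_ring S)) \<Longrightarrow> sum f A \<in> carrier (poly_ring S)"
  by (induction A rule: infinite_finite_induct) (auto intro: poly_ring_add_closed)

lemma poly_uminus_closed: "p \<in> carrier (poly_ring S) \<Longrightarrow> - p \<in> carrier (poly_ring S)"
  by (auto simp: poly_ring_simps in_keys_iff)

lemma cring_poly_ring: "cring (poly_ring S)"
proof (intro cringI abelian_groupI comm_monoidI)
  show "\<exists>q\<in>carrier (poly_ring S). q \<oplus>\<^bsub>poly_ring S\<^esub> p = \<zero>\<^bsub>poly_ring S\<^esub>"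
    if "p \<in> carrier (poly_ring S)" for p
    by (rule bexI[of _ "- p"]) (use that in \<open>auto simp: poly_ring_simps(2-) intro: poly_uminus_closed\<close>)
qed (auto simp: poly_ring_simps(2-) algebra_simps intro: poly_ring_add_closed poly_ring_mult_closed)

definition H0_relators :: "nat set \<Rightarrow> cpoly set" where
  "H0_relators S = {poly_var i * poly_var j | i j. i \<in> S \<and> j \<in> S} \<union>
      {\<Sum>i\<in>S. poly_var i, \<Sum>i\<in>S. poly_const (of_nat i) * poly_var i}"

lemma H0_relators_closed: "H0_relators S \<subseteq> carrier (poly_ring S)"
  by (auto simp: H0_relators_def intro!: poly_sum_closed poly_ring_mult_closed)

lemma ideal_H0: "ideal (H0_ideal S) (poly_ring S)"
  unfolding H0_ideal_def
  by (rule ring.genideal_ideal[OF cring.axioms(1)[OF cring_poly_ring]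
        H0_relators_closed[unfolded H0_relators_def]])

lemma H0_relators_in_ideal: "H0_relators S \<subseteq> H0_ideal S"
  unfolding H0_ideal_def H0_relators_def
  by (rule ring.genideal_self[OF cring.axioms(1)[OF cring_poly_ring]
        H0_relators_closed[unfolded H0_relators_def]])

lemma cring_transfer:
  fixes R :: "('a, 'm) ring_scheme" and R' :: "('a, 'k) ring_scheme"
  assumes "cring R" "carrier R' = carrier R" "mult R' = mult R" "one R' = one R"
    "zero R' = zero R" "add R' = add R"
  shows "cring R'"
proof -
  interpret cring R by fact
  show ?thesis
    by (intro cringI abelian_groupI comm_monoidI)
      (auto simp: assms(2-) a_ac m_assoc l_distr intro!: bexI[of _ "\<ominus>\<^bsub>R\<^esub> _"] l_neg intro: m_comm)
qed

lemma H0_simps: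
  "carrier (H0 S) = carrier (poly_ring S Quot H0_ideal S)"
  "mult (H0 S) = mult (poly_ring S Quot H0_ideal S)"
  "one (H0 S) = one (poly_ring S Quot H0_ideal S)"
  "zero (H0 S) = zero (poly_ring S Quot H0_ideal S)"
  "add (H0 S) = add (poly_ring S Quot H0_ideal S)"
  "smult (H0 S) = (\<lambda>c x. H0_class S (poly_const c) \<otimes>\<^bsub>H0 S\<^esub> x)"
  by (simp_all add: H0_def Let_def)

lemma cring_H0: "cring (H0 S)"
  by (rule cring_transfer[OF ideal.quotient_is_cring[OF ideal_H0 cring_poly_ring]])
    (simp_all add: H0_simps)

lemma H0_class_hom: "H0_class S \<in> ring_hom (poly_ring S) (H0 S)"
proof -
  have "H0_class S = a_r_coset (poly_ring S) (H0_ideal S)"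
    by (simp add: H0_class_def fun_eq_iff)
  then show ?thesis
    using ideal.rcos_ring_hom[OF ideal_H0[of S]] by (simp add: ring_hom_def H0_simps)
qed

lemma H0_class_closed [simp, intro]: "p \<in> carrier (poly_ring S) \<Longrightarrow> H0_class S p \<in> carrier (H0 S)"
  by (rule ring_hom_closed[OF H0_class_hom])

lemma H0_class_mult:
  "p \<in> carrier (poly_ring S) \<Longrightarrow> q \<in> carrier (poly_ring S) \<Longrightarrow>
    H0_class S p \<otimes>\<^bsub>H0 S\<^esub> H0_class S q = H0_class S (p * q)"
  using ring_hom_mult[OF H0_class_hom, of p S q] by (simp add: poly_ring_simps(2))

lemma H0_class_add:
  "p \<in> carrier (poly_ring S) \<Longrightarrow> q \<in> carrier (poly_ring S) \<Longrightarrow>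
    H0_class S p \<oplus>\<^bsub>H0 S\<^esub> H0_class S q = H0_class S (p + q)"
  using ring_hom_add[OF H0_class_hom, of p S q] by (simp add: poly_ring_simps(5))

lemma H0_class_one: "\<one>\<^bsub>H0 S\<^esub> = H0_class S 1"
  using ring_hom_one[OF H0_class_hom, of S] by (simp add: poly_ring_simps(3))

lemma H0_class_null: "p \<in> H0_ideal S \<Longrightarrow> H0_class S p = \<zero>\<^bsub>H0 S\<^esub>"
proof -
  assume p: "p \<in> H0_ideal S"
  interpret ideal "H0_ideal S" "poly_ring S" by (rule ideal_H0)
  show ?thesis using a_rcos_const[OF p] by (simp add: H0_class_def H0_simps FactRing_def)
qed

lemma H0_class_zero: "H0_class S 0 = \<zero>\<^bsub>H0 S\<^esub>"
proof (rule H0_class_null)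
  show "0 \<in> H0_ideal S"
    using additive_subgroup.zero_closed[OF ideal.axioms(1)[OF ideal_H0[of S]]]
    by (simp add: poly_ring_simps)
qed

lemma H0_carrier: "carrier (H0 S) = H0_class S ` carrier (poly_ring S)"
  by (auto simp: H0_simps FactRing_def A_RCOSETS_def' H0_class_def)

lemma H0_class_sum:
  assumes "\<And>i. i \<in> A \<Longrightarrow> f i \<in> carrier (poly_ring S)"
  shows "H0_class S (sum f A) = (\<Oplus>\<^bsub>H0 S\<^esub>i\<in>A. H0_class S (f i))"
proof -
  interpret H: cring "H0 S" by (rule cring_H0)
  show ?thesis using assms
    by (induction A rule: infinite_finite_induct)
      (auto simp: H0_class_zero H0_class_add[symmetric] poly_sum_closed)
qed

lemma H0_smult_class:
  "p \<in> carrier (poly_ring S) \<Longrightarrow> c \<odot>\<^bsub>H0 S\<^esub> H0_class S p = H0_class S (poly_const c * p)"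
  by (simp add: H0_simps(6) H0_class_mult)

text \<open>
  Both complex vector spaces of the untwisted sector arise in this way: \<open>H\<^sub>0\<close> from the ring
  acting on itself, and its compactly supported version from the action of \<open>H\<^sub>0\<close>.
\<close>

lemma module_restrict_scalars:
  fixes A :: "('a, 'm) ring_scheme" and M :: "('a, 'b, 'k) module_scheme" and M' :: "(complex, 'b) module"
  assumes "module A M" "h \<in> ring_hom CC A"
    and M': "carrier M' = carrier M" "zero M' = zero M" "add M' = add M"
    "\<And>c x. c \<odot>\<^bsub>M'\<^esub> x = h c \<odot>\<^bsub>M\<^esub> x"
  shows "module CC M'"
proof -
  interpret module A M by fact
  note h = ring_hom_closed[OF assms(2), simplified] ring_hom_mult[OF assms(2), simplified]
    ring_hom_add[OF assms(2), simplified] ring_hom_one[OF assms(2), simplified]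
  show ?thesis
  proof (rule moduleI)
    show "abelian_group M'"
      by (rule abelian_groupI) (auto simp: M' M.a_ac intro!: bexI[of _ "\<ominus>\<^bsub>M\<^esub> _"] M.l_neg)
  qed (auto simp: M' h cring_CC smult_l_distr smult_r_distr smult_assoc1)
qed

lemma H0_const_hom: "(\<lambda>c. H0_class S (poly_const c)) \<in> ring_hom CC (H0 S)"
  by (rule ring_hom_memI)
    (auto simp: H0_class_mult H0_class_add poly_const_simps H0_class_one)

lemma module_H0: "module CC (H0 S)"
proof -
  let ?M = "\<lparr>carrier = carrier (H0 S), mult = mult (H0 S), one = one (H0 S), zero = zero (H0 S),
    add = add (H0 S), smult = mult (H0 S)\<rparr> :: (cpoly set, cpoly set) module"
  interpret H: cring "H0 S" by (rule cring_H0)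
  have "module (H0 S) ?M"
  proof (rule moduleI)
    show "abelian_group ?M"
      by (rule abelian_groupI)
        (auto simp: H.a_ac intro!: bexI[of _ "\<ominus>\<^bsub>H0 S\<^esub> _"] H.l_neg)
  qed (auto simp: cring_H0 H.l_distr H.r_distr H.m_assoc)
  then show ?thesis
    by (rule module_restrict_scalars[OF _ H0_const_hom]) (simp_all add: H0_simps(6))
qed

lemma D0_closed [simp, intro]: "i \<in> S \<Longrightarrow> D0 S i \<in> carrier (H0 S)"
  by (simp add: D0_def)

lemma D0_mult:
  assumes "i \<in> S" "j \<in> S"
  shows "D0 S i \<otimes>\<^bsub>H0 S\<^esub> D0 S j = \<zero>\<^bsub>H0 S\<^esub>"
  unfolding D0_def using assms H0_relators_in_ideal[of S]
  by (subst H0_class_mult) (auto intro!: H0_class_null simp: H0_relators_def)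

lemma D0_sum: "(\<Oplus>\<^bsub>H0 S\<^esub>i\<in>S. D0 S i) = \<zero>\<^bsub>H0 S\<^esub>"
  unfolding D0_def using H0_relators_in_ideal[of S]
  by (subst H0_class_sum[symmetric]) (auto intro!: H0_class_null simp: H0_relators_def)

lemma D0_weighted_sum: "(\<Oplus>\<^bsub>H0 S\<^esub>i\<in>S. of_nat i \<odot>\<^bsub>H0 S\<^esub> D0 S i) = \<zero>\<^bsub>H0 S\<^esub>"
proof -
  interpret H: module CC "H0 S" by (rule module_H0)
  have "(\<Oplus>\<^bsub>H0 S\<^esub>i\<in>S. of_nat i \<odot>\<^bsub>H0 S\<^esub> D0 S i) =
      (\<Oplus>\<^bsub>H0 S\<^esub>i\<in>S. H0_class S (poly_const (of_nat i) * poly_var i))"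
    by (rule H.finsum_cong') (auto simp: D0_def H0_smult_class intro: poly_ring_mult_closed)
  also have "\<dots> = H0_class S (\<Sum>i\<in>S. poly_const (of_nat i) * poly_var i)"
    by (rule H0_class_sum[symmetric]) (auto intro: poly_ring_mult_closed)
  also have "\<dots> = \<zero>\<^bsub>H0 S\<^esub>"
    using H0_relators_in_ideal[of S] by (intro H0_class_null) (auto simp: H0_relators_def)
  finally show ?thesis .
qed

text \<open>
  A monomial is constant, a variable, or divisible by a product of two possibly equal
  variables, and the products of two variables belong to the ideal.
\<close>

lemma monomial_class_in_span:
  assumes m: "Poly_Mapping.keys m \<subseteq> S"
    and N: "submodule N CC (H0 S)" "insert \<one>\<^bsub>H0 S\<^esub> (D0 S ` S) \<subseteq> N"
  shows "H0_class S (Poly_Mapping.single m c) \<in> N"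
proof -
  interpret H: module CC "H0 S" by (rule module_H0)
  have smult: "H0_class S (poly_const c * p) \<in> N"
    if "p \<in> carrier (poly_ring S)" "H0_class S p \<in> N" for p
    using H.submoduleE(4)[OF N(1), of c] that by (simp flip: H0_smult_class)
  show ?thesis
  proof (cases "m = 0")
    case True
    then show ?thesis using smult[of 1] N(2) by (simp add: H0_class_one poly_const_def)
  next
    case False
    then obtain i where i: "i \<in> Poly_Mapping.keys m"
      by (metis lookup_zero poly_mapping_eqI in_keys_iff)
    define m1 where "m1 = m - Poly_Mapping.single i 1"
    have m1: "m = m1 + Poly_Mapping.single i 1"
      using i by (intro poly_mapping_eqI)
        (auto simp: m1_def lookup_add lookup_minus lookup_single when_def in_keys_iff)
    show ?thesis
    proof (cases "m1 = 0")
      case True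
      have "Poly_Mapping.single m c = poly_const c * poly_var i"
        by (simp add: m1 True poly_const_def poly_var_def mult_single)
      then show ?thesis using smult[of "poly_var i"] N(2) i m by (auto simp: D0_def)
    next
      case False
      then obtain j where j: "j \<in> Poly_Mapping.keys m1"
        by (metis lookup_zero poly_mapping_eqI in_keys_iff)
      define m2 where "m2 = m1 - Poly_Mapping.single j 1"
      have m2: "m1 = m2 + Poly_Mapping.single j 1"
        using j by (intro poly_mapping_eqI)
          (auto simp: m2_def lookup_add lookup_minus lookup_single when_def in_keys_iff)
      have keys: "Poly_Mapping.keys m2 \<subseteq> S" "i \<in> S" "j \<in> S"
        using m i j unfolding m1 m2 by (auto simp: in_keys_iff lookup_add subset_iff)
      have "Poly_Mapping.single m c = Poly_Mapping.single m2 c * (poly_var j * poly_var i)"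
        by (simp add: m1 m2 poly_var_def mult_single add.assoc)
      moreover have "Poly_Mapping.single m2 c \<in> carrier (poly_ring S)"
        using keys by (auto simp: poly_ring_simps split: if_splits)
      moreover have "poly_var j * poly_var i \<in> H0_ideal S"
        using H0_relators_in_ideal[of S] keys by (auto simp: H0_relators_def)
      ultimately have "Poly_Mapping.single m c \<in> H0_ideal S"
        using ideal.I_l_closed[OF ideal_H0] by (simp add: poly_ring_simps(2))
      then show ?thesis using H.submodule_zero[OF N(1)] by (simp add: H0_class_null)
    qed
  qed
qed

lemma H0_spanned:
  assumes N: "submodule N CC (H0 S)" "insert \<one>\<^bsub>H0 S\<^esub> (D0 S ` S) \<subseteq> N"
  shows "carrier (H0 S) \<subseteq> N"
proof -
  interpret H: module CC "H0 S" by (rule module_H0)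
  have "p \<in> carrier (poly_ring S) \<and> H0_class S p \<in> N" if "p \<in> carrier (poly_ring S)" for p
  proof (induction p rule: poly_mapping_add_induct)
    case (single k v)
    then have "Poly_Mapping.keys k \<subseteq> S" using that by (auto simp: poly_ring_simps)
    then show ?case using monomial_class_in_span[OF _ N]
      by (auto simp: poly_ring_simps split: if_splits)
  next
    case (add f g)
    then show ?case using H.submoduleE(5)[OF N(1)]
      by (auto simp flip: H0_class_add intro: poly_ring_add_closed)
  qed (auto simp: H0_class_zero H.submodule_zero[OF N(1)])
  then show ?thesis by (auto simp: H0_carrier)
qed

context fan
begin

abbreviation interior :: "nat set" where "interior \<equiv> S - {0, n}"

lemma Min_S: "Min S = 0" and Max_S: "Max S = n"
  using fan_finite zero_in n_in fan_le by (auto intro!: Min_eqI Max_eqI)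

lemma interior_rays_eq: "interior_rays S = interior"
  by (simp add: interior_rays_def Min_S Max_S)

text \<open>
  In \<open>\<Sum>\<^sub>i i D\<^sub>i = 0\<close> the coefficient of \<open>D\<^sub>0\<close> is zero, so this relation expresses \<open>D\<^sub>n\<close> by the
  interior \<open>D\<^sub>i\<close>. Then \<open>\<Sum>\<^sub>i D\<^sub>i = 0\<close> does the same for \<open>D\<^sub>0\<close>.
\<close>

lemma H0_spanned_interior:
  assumes N: "submodule N CC (H0 S)" "insert \<one>\<^bsub>H0 S\<^esub> (D0 S ` interior) \<subseteq> N"
  shows "carrier (H0 S) \<subseteq> N"
proof -
  interpret H: module CC "H0 S" by (rule module_H0)
  note NE = H.submoduleE[OF N(1)]
  have S: "S = insert n (S - {n})" "S = insert 0 (S - {0})" using zero_in n_in by auto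
  have "(\<Oplus>\<^bsub>H0 S\<^esub>i\<in>insert n (S - {n}). of_nat i \<odot>\<^bsub>H0 S\<^esub> D0 S i) = of_nat n \<odot>\<^bsub>H0 S\<^esub> D0 S n \<oplus>\<^bsub>H0 S\<^esub>
      (\<Oplus>\<^bsub>H0 S\<^esub>i\<in>S - {n}. of_nat i \<odot>\<^bsub>H0 S\<^esub> D0 S i)"
    using fan_finite n_in by (intro H.finsum_insert) auto
  then have *: "of_nat n \<odot>\<^bsub>H0 S\<^esub> D0 S n \<oplus>\<^bsub>H0 S\<^esub> (\<Oplus>\<^bsub>H0 S\<^esub>i\<in>S - {n}. of_nat i \<odot>\<^bsub>H0 S\<^esub> D0 S i) = \<zero>\<^bsub>H0 S\<^esub>"
    (is "_ \<oplus>\<^bsub>H0 S\<^esub> ?s = _") using D0_weighted_sum[of S] S(1) by simp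
  have "of_nat i \<odot>\<^bsub>H0 S\<^esub> D0 S i \<in> N" if "i \<in> S - {n}" for i
  proof (cases "i = 0")
    case True
    then show ?thesis using H.submodule_zero[OF N(1)] H.smult_l_null[of "D0 S 0"] zero_in by auto
  next
    case False
    then have "D0 S i \<in> N" using N(2) that by blast
    then show ?thesis by (intro NE(4)) simp
  qed
  then have s: "?s \<in> N" by (intro H.submodule_finsum[OF N(1)]) auto
  have "of_nat n \<odot>\<^bsub>H0 S\<^esub> D0 S n = \<ominus>\<^bsub>H0 S\<^esub> ?s"
    using * n_in NE(1) s H.minus_equality by auto
  then have "(1 / of_nat n) \<odot>\<^bsub>H0 S\<^esub> (of_nat n \<odot>\<^bsub>H0 S\<^esub> D0 S n) \<in> N"
    using s NE(3,4) by simp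
  moreover have "(1 / of_nat n) \<odot>\<^bsub>H0 S\<^esub> (of_nat n \<odot>\<^bsub>H0 S\<^esub> D0 S n) = D0 S n"
    using H.smult_assoc1[of "1 / of_nat n" "of_nat n" "D0 S n"] H.smult_one[of "D0 S n"] n_pos n_in
    by simp
  ultimately have Dn: "D0 S n \<in> N" by simp
  have "(\<Oplus>\<^bsub>H0 S\<^esub>i\<in>insert 0 (S - {0}). D0 S i) = D0 S 0 \<oplus>\<^bsub>H0 S\<^esub> (\<Oplus>\<^bsub>H0 S\<^esub>i\<in>S - {0}. D0 S i)"
    using fan_finite zero_in by (intro H.finsum_insert) auto
  then have *: "D0 S 0 \<oplus>\<^bsub>H0 S\<^esub> (\<Oplus>\<^bsub>H0 S\<^esub>i\<in>S - {0}. D0 S i) = \<zero>\<^bsub>H0 S\<^esub>"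
    (is "_ \<oplus>\<^bsub>H0 S\<^esub> ?s = _") using D0_sum[of S] S(2) by simp
  have s: "?s \<in> N" using Dn N(2) by (intro H.submodule_finsum[OF N(1)]) auto
  then have "D0 S 0 = \<ominus>\<^bsub>H0 S\<^esub> ?s"
    using * zero_in NE(1) H.minus_equality by auto
  then have "D0 S 0 \<in> N" using s NE(3) by simp
  with Dn N show ?thesis by (intro H0_spanned) auto
qed

end

section \<open>Linear functionals on \<open>H\<^sub>0\<close>\<close>

definition descend :: "(cpoly \<Rightarrow> complex) \<Rightarrow> cpoly set \<Rightarrow> complex" where
  "descend \<Phi> X = the_elem (\<Phi> ` X)"

text \<open>
  Linear functionals on polynomials that induce functionals on \<open>H\<^sub>0\<close>. For this to hold, multiples of the
  relators by arbitrary polynomials have to be killed.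
\<close>

locale descending =
  fixes S :: "nat set" and \<Phi> :: "cpoly \<Rightarrow> complex"
  assumes additive: "\<Phi> (p + q) = \<Phi> p + \<Phi> q"
    and const_mult: "\<Phi> (poly_const c * p) = c * \<Phi> p"
    and relators: "g \<in> H0_relators S \<Longrightarrow> \<Phi> (q * g) = 0"
begin

text \<open>
  The polynomials all of whose multiples are killed by \<open>\<Phi>\<close> form an ideal, which contains the
  relators and hence the ideal that they generate.
\<close>

lemma ideal_null: "p \<in> H0_ideal S \<Longrightarrow> \<Phi> p = 0"
proof -
  assume p: "p \<in> H0_ideal S"
  interpret R: cring "poly_ring S" by (rule cring_poly_ring)
  let ?J = "{p \<in> carrier (poly_ring S). \<forall>q. \<Phi> (q * p) = 0}"
  have zero: "\<Phi> 0 = 0" using const_mult[of 0 0] by (simp add: poly_const_simps)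
  have uminus: "\<Phi> (- q) = 0" if "\<Phi> q = 0" for q
    using additive[of q "- q"] that zero by simp
  have inv: "\<ominus>\<^bsub>poly_ring S\<^esub> q = - q" if "q \<in> carrier (poly_ring S)" for q
    by (rule R.minus_equality) (use that in \<open>auto simp: poly_ring_simps(2-) intro: poly_uminus_closed\<close>)
  have "ideal ?J (poly_ring S)"
  proof (rule idealI)
    show "ring (poly_ring S)" by (rule R.ring_axioms)
    show "subgroup ?J (add_monoid (poly_ring S))"
      by (rule R.add.subgroupI)
        (auto simp: poly_ring_simps(2-) inv zero distrib_left additive uminus
          intro: poly_uminus_closed poly_ring_add_closed exI[of _ 0])
  qed (auto simp: poly_ring_simps(2-) mult.assoc[symmetric] intro: poly_ring_mult_closed,
      simp add: mult.assoc mult.left_commute mult.commute)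
  moreover have "H0_relators S \<subseteq> ?J" using relators H0_relators_closed by blast
  ultimately have "H0_ideal S \<subseteq> ?J"
    unfolding H0_ideal_def H0_relators_def by (rule R.genideal_minimal)
  then have "\<Phi> (1 * p) = 0" using p by blast
  then show ?thesis by simp
qed

lemma descend_class [simp]:
  assumes "p \<in> carrier (poly_ring S)"
  shows "descend \<Phi> (H0_class S p) = \<Phi> p"
proof -
  interpret ideal "H0_ideal S" "poly_ring S" by (rule ideal_H0)
  have "\<Phi> q = \<Phi> p" if q: "q \<in> H0_class S p" for q
  proof -
    obtain m where "m \<in> H0_ideal S" "q = m + p"
      using q by (auto simp: H0_class_def a_r_coset_def' poly_ring_simps)
    then show ?thesis by (simp add: additive ideal_null)
  qed
  moreover have "p \<in> H0_class S p"
    unfolding H0_class_def by (rule a_rcos_self) fact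
  ultimately have "\<Phi> ` H0_class S p = {\<Phi> p}" by blast
  then show ?thesis by (simp add: descend_def)
qed

lemma linear_map_descend: "linear_map (H0 S) CC (descend \<Phi>)"
  by (rule linear_mapI)
    (auto simp: module_H0 module_CC H0_carrier H0_class_add H0_smult_class additive const_mult
      poly_ring_add_closed poly_ring_mult_closed)

end

abbreviation augmentation :: "cpoly set \<Rightarrow> complex" where
  "augmentation \<equiv> descend const_coeff"

lemma descending_const_coeff: "descending S const_coeff"
  by unfold_locales
    (auto simp: H0_relators_def lookup_add const_coeff_mult lookup_sum)

text \<open>
  The functional with \<open>1 \<mapsto> 0\<close> and \<open>X\<^sub>i \<mapsto> c\<^sub>i\<close> that ignores terms of higher degree, a derivation
  over the augmentation.
\<close>

definition linear_part :: "nat set \<Rightarrow> (nat \<Rightarrow> complex) \<Rightarrow> cpoly \<Rightarrow> complex" where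
  "linear_part S c p = (\<Sum>i\<in>S. c i * lin_coeff p i)"

abbreviation derivation :: "nat set \<Rightarrow> (nat \<Rightarrow> complex) \<Rightarrow> cpoly set \<Rightarrow> complex" where
  "derivation S c \<equiv> descend (linear_part S c)"

lemma linear_part_mult:
  "linear_part S c (p * q) = const_coeff p * linear_part S c q + linear_part S c p * const_coeff q"
  by (simp add: linear_part_def lin_coeff_mult sum_distrib_left sum_distrib_right
      sum.distrib distrib_left mult_ac)

lemma linear_part_add: "linear_part S c (p + q) = linear_part S c p + linear_part S c q"
  by (simp add: linear_part_def lin_coeff_add distrib_left sum.distrib)

lemma linear_part_const [simp]: "linear_part S c (poly_const a) = 0"
  by (simp add: linear_part_def)

lemma linear_part_var: "finite S \<Longrightarrow> i \<in> S \<Longrightarrow> linear_part S c (poly_var i) = c i"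
  by (simp add: linear_part_def if_distrib cong: if_cong)

lemma linear_part_sum: "linear_part S c (sum f A) = (\<Sum>a\<in>A. linear_part S c (f a))"
  by (induction A rule: infinite_finite_induct)
    (simp_all add: linear_part_add, simp_all add: linear_part_def lin_coeff_def)

text \<open>
  The two conditions on \<open>c\<close> say that the linear relators are mapped to zero. The
  value at a multiple \<open>q g\<close> of a relator \<open>g\<close> is the one at \<open>g\<close> times the constant term of \<open>q\<close> by the
  product rule, as \<open>g\<close> has no constant term.
\<close>

lemma descending_linear_part:
  assumes "finite S" "(\<Sum>i\<in>S. c i) = 0" "(\<Sum>i\<in>S. of_nat i * c i) = 0"
  shows "descending S (linear_part S c)"
proof
  show "linear_part S c (q * g) = 0" if g: "g \<in> H0_relators S" for q g
  proof -
    have "const_coeff g = 0" using g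
      by (auto simp: H0_relators_def const_coeff_mult lookup_sum)
    moreover have "linear_part S c g = 0" using g assms
      by (auto simp: H0_relators_def linear_part_mult linear_part_sum linear_part_var)
    ultimately show ?thesis by (simp add: linear_part_mult)
  qed
qed (simp_all add: linear_part_add linear_part_mult)

lemma H0_functional_mult:
  assumes "X \<in> carrier (H0 S)" "Y \<in> carrier (H0 S)"
  shows "augmentation (X \<otimes>\<^bsub>H0 S\<^esub> Y) = augmentation X * augmentation Y"
    and "descending S (linear_part S c) \<Longrightarrow>
      derivation S c (X \<otimes>\<^bsub>H0 S\<^esub> Y) = augmentation X * derivation S c Y + derivation S c X * augmentation Y"
proof -
  interpret descending S const_coeff by (rule descending_const_coeff)
  obtain p q where pq: "p \<in> carrier (poly_ring S)" "X = H0_class S p"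
    "q \<in> carrier (poly_ring S)" "Y = H0_class S q"
    using assms by (auto simp: H0_carrier)
  then show "augmentation (X \<otimes>\<^bsub>H0 S\<^esub> Y) = augmentation X * augmentation Y"
    by (simp add: H0_class_mult poly_ring_mult_closed const_coeff_mult)
  assume "descending S (linear_part S c)"
  then interpret l: descending S "linear_part S c" .
  show "derivation S c (X \<otimes>\<^bsub>H0 S\<^esub> Y) = augmentation X * derivation S c Y + derivation S c X * augmentation Y"
    using pq by (simp add: H0_class_mult poly_ring_mult_closed linear_part_mult)
qed

lemma augmentation_simps [simp]:
  "augmentation \<one>\<^bsub>H0 S\<^esub> = 1" "i \<in> S \<Longrightarrow> augmentation (D0 S i) = 0"
proof -
  interpret descending S const_coeff by (rule descending_const_coeff)
  show "augmentation \<one>\<^bsub>H0 S\<^esub> = 1" "i \<in> S \<Longrightarrow> augmentation (D0 S i) = 0"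
    by (simp_all add: H0_class_one D0_def)
qed

lemma derivation_simps:
  assumes "descending S (linear_part S c)" "finite S"
  shows "derivation S c \<one>\<^bsub>H0 S\<^esub> = 0" "i \<in> S \<Longrightarrow> derivation S c (D0 S i) = c i"
proof -
  interpret descending S "linear_part S c" by fact
  show "derivation S c \<one>\<^bsub>H0 S\<^esub> = 0" "i \<in> S \<Longrightarrow> derivation S c (D0 S i) = c i"
    using linear_part_const[of S c 1] assms(2)
    by (simp_all add: H0_class_one D0_def linear_part_var poly_const_simps)
qed

section \<open>Neighbouring rays\<close>

lemma adjacentD:
  "adjacent S i j \<Longrightarrow> i \<in> S" "adjacent S i j \<Longrightarrow> j \<in> S" "adjacent S i j \<Longrightarrow> i \<noteq> j"
  by (auto simp: adjacent_def consecutive_def)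

lemma adjacent_sym: "adjacent S i j \<longleftrightarrow> adjacent S j i"
  by (auto simp: adjacent_def)

lemma consecutive_unique:
  "consecutive S i j \<Longrightarrow> consecutive S i j' \<Longrightarrow> j = j'"
  "consecutive S i j \<Longrightarrow> consecutive S i' j \<Longrightarrow> i = i'"
  by (metis consecutive_def linorder_neqE_nat)+

text \<open>
  This will turn out to be \<open>\<integral> D\<^sub>i F\<^sub>k\<close>. Up to sign it is the Laplacian of the path with vertex set
  \<open>S\<close> and edge weights \<open>1 / \<bar>j - i\<bar>\<close>.
\<close>

definition weight :: "nat set \<Rightarrow> nat \<Rightarrow> nat \<Rightarrow> complex" where
  "weight S k i = (if adjacent S k i then 1 / of_real \<bar>real i - real k\<bar> else 0) -
     (if i = k then \<Sum>j | adjacent S k j. 1 / of_real \<bar>real j - real k\<bar> else 0)"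

context fan
begin

lemma successor_exists:
  assumes "k \<in> S" "k \<noteq> n"
  obtains s where "consecutive S k s"
proof -
  have "finite {i \<in> S. k < i}" using fan_finite by simp
  moreover have "n \<in> {i \<in> S. k < i}" using n_in fan_le[OF assms(1)] assms(2) by simp
  ultimately have "Min {i \<in> S. k < i} \<in> {i \<in> S. k < i}" "\<forall>i\<in>{i \<in> S. k < i}. Min {i \<in> S. k < i} \<le> i"
    using Min_in Min_le by (blast, blast)
  then have "consecutive S k (Min {i \<in> S. k < i})"
    using assms by (auto simp: consecutive_def not_less)
  then show ?thesis by (rule that)
qed

lemma predecessor_exists:
  assumes "k \<in> S" "k \<noteq> 0"
  obtains p where "consecutive S p k"
proof -
  have "finite {i \<in> S. i < k}" using fan_finite by simp
  moreover have "0 \<in> {i \<in> S. i < k}" using zero_in assms(2) by simp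
  ultimately have "Max {i \<in> S. i < k} \<in> {i \<in> S. i < k}" "\<forall>i\<in>{i \<in> S. i < k}. i \<le> Max {i \<in> S. i < k}"
    using Max_in Max_ge by (blast, blast)
  then have "consecutive S (Max {i \<in> S. i < k}) k"
    using assms by (auto simp: consecutive_def not_less)
  then show ?thesis by (rule that)
qed

lemma interior_neighbours:
  assumes "k \<in> interior"
  obtains p s where "consecutive S p k" "consecutive S k s" "{j. adjacent S k j} = {p, s}" "p < k" "k < s"
proof -
  obtain p where p: "consecutive S p k" using assms predecessor_exists by blast
  obtain s where s: "consecutive S k s" using assms successor_exists by blast
  have "{j. adjacent S k j} = {p, s}"
    using p s consecutive_unique by (auto simp: adjacent_def)
  then show ?thesis using that p s by (auto simp: consecutive_def)
qed

text \<open>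
  This is the slope of \<open>h\<close> to the right of \<open>k\<close> minus the slope to the left.
\<close>

lemma sum_weight:
  fixes h :: "nat \<Rightarrow> complex"
  assumes k: "k \<in> interior" and p: "consecutive S p k" and s: "consecutive S k s"
  shows "(\<Sum>i\<in>S. weight S k i * h i) =
    (h p - h k) / of_real (real k - real p) + (h s - h k) / of_real (real s - real k)"
proof -
  have adj: "{j. adjacent S k j} = {p, s}"
    using p s consecutive_unique by (auto simp: adjacent_def)
  have ps: "p \<in> S" "s \<in> S" "k \<in> S" "p < k" "k < s" using p s by (auto simp: consecutive_def)
  have "(\<Sum>i\<in>S. weight S k i * h i) =
      (\<Sum>i\<in>S. if i \<in> {p, s} then h i / of_real \<bar>real i - real k\<bar> else 0) -
      (\<Sum>i\<in>S. if i = k then h k * (\<Sum>j\<in>{p, s}. 1 / of_real \<bar>real j - real k\<bar>) else 0)"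
    unfolding sum_subtractf[symmetric] weight_def adj
    by (rule sum.cong) (use adj in \<open>auto simp: left_diff_distrib\<close>)
  also have "(\<Sum>i\<in>S. if i \<in> {p, s} then h i / of_real \<bar>real i - real k\<bar> else 0) =
      (\<Sum>i\<in>{p, s}. h i / of_real \<bar>real i - real k\<bar>)"
    using ps fan_finite by (subst sum.inter_restrict[symmetric]) (auto intro: sum.cong)
  also have "(\<Sum>i\<in>S. if i = k then h k * (\<Sum>j\<in>{p, s}. 1 / of_real \<bar>real j - real k\<bar>) else 0) =
      h k * (\<Sum>j\<in>{p, s}. 1 / of_real \<bar>real j - real k\<bar>)"
    using ps fan_finite by simp
  also have "\<bar>real p - real k\<bar> = real k - real p" "\<bar>real s - real k\<bar> = real s - real k" "p \<noteq> s"
    using ps by auto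
  then have "(\<Sum>i\<in>{p, s}. h i / of_real \<bar>real i - real k\<bar>) -
      h k * (\<Sum>j\<in>{p, s}. 1 / of_real \<bar>real j - real k\<bar>) =
    (h p - h k) / of_real (real k - real p) + (h s - h k) / of_real (real s - real k)"
    by (simp add: diff_divide_distrib distrib_left)
  finally show ?thesis .
qed

text \<open>
  The functions \<open>1\<close> and \<open>i\<close> have constant slope, so the Laplacian kills them; these are the
  coefficients of the two linear relations of \<open>H\<^sub>0\<close>.
\<close>

lemma descending_weight:
  assumes k: "k \<in> interior"
  shows "descending S (linear_part S (weight S k))"
proof -
  obtain p s where ps: "consecutive S p k" "consecutive S k s" "p < k" "k < s"
    using interior_neighbours[OF k] by metis
  have "complex_of_real (real k - real p) \<noteq> 0" "complex_of_real (real s - real k) \<noteq> 0"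
    using ps(3,4) by (auto simp flip: of_real_diff)
  then have "(\<Sum>i\<in>S. of_nat i * weight S k i) = 0"
    using sum_weight[OF k ps(1,2), of of_nat] by (simp add: mult.commute divide_simps)
  moreover have "(\<Sum>i\<in>S. weight S k i) = 0"
    using sum_weight[OF k ps(1,2), of "\<lambda>_. 1"] by simp
  ultimately show ?thesis using fan_finite by (intro descending_linear_part)
qed

section \<open>The untwisted sector with compact support\<close>

text \<open>
  \<open>M\<close> is the free module on the generators, \<open>K\<close> its quotient as an \<open>H\<^sub>0\<close>-module and \<open>KC\<close> the same
  quotient as a complex vector space.
\<close>

abbreviation "A \<equiv> H0 S"
abbreviation "M \<equiv> H0c_free S"
abbreviation "K \<equiv> H0c S"
abbreviation "KC \<equiv> H0c_CC S"
abbreviation "G \<equiv> free_gen (H0 S)"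
abbreviation "D \<equiv> D0 S"
abbreviation "FJ \<equiv> F0_gen S"
abbreviation act (infixl \<open>\<star>\<close> 70) where "X \<star> y \<equiv> X \<odot>\<^bsub>K\<^esub> y"

lemma gens_single: "k \<in> interior \<Longrightarrow> {k} \<in> H0c_gens S"
  and gens_pair: "adjacent S i j \<Longrightarrow> {i, j} \<in> H0c_gens S"
  by (auto simp: H0c_gens_def interior_rays_eq)

lemma module_free: "module A M"
  unfolding H0c_free_def by (rule cring.module_free_module cring_H0)+

sublocale A: cring A by (rule cring_H0)
sublocale AC: module CC A by (rule module_H0)
sublocale M: plain_module A M by (rule plain_module.intro module_free)+

lemma G_closed [simp, intro]: "J \<in> H0c_gens S \<Longrightarrow> G J \<in> carrier M"
  unfolding H0c_free_def by (rule cring.free_gen_closed[OF cring_H0])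

definition H0c_relators :: "(nat set \<Rightarrow> cpoly set) set" where
  "H0c_relators =
     {D i \<odot>\<^bsub>M\<^esub> G {j} \<ominus>\<^bsub>M\<^esub> G {i, j} | i j. adjacent S i j \<and> j \<in> interior} \<union>
     {D i \<odot>\<^bsub>M\<^esub> G {j} | i j. i \<in> S \<and> j \<in> interior \<and> i \<noteq> j \<and> \<not> adjacent S i j} \<union>
     {D k \<odot>\<^bsub>M\<^esub> G {i, j} | k i j. k \<in> S \<and> adjacent S i j}"

lemma H0c_null_eq: "H0c_null S = submodule_generated A M H0c_relators"
  by (simp add: H0c_null_def H0c_relators_def Let_def interior_rays_eq)

lemma H0c_relators_closed: "H0c_relators \<subseteq> carrier M"
  unfolding H0c_relators_def
  by (auto intro!: M.minus_closed M.smult_closed G_closed gens_single gens_pair D0_closed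
      dest: adjacentD simp del: M.smult_closed)

sublocale K: quotient_of_module A M "H0c_null S"
  unfolding quotient_of_module_def quotient_of_module_axioms_def H0c_null_eq
  using M.plain_module_axioms M.submodule_generated_submodule H0c_relators_closed by blast

lemma module_K: "module A K"
  unfolding H0c_def by (rule K.module_quotient)

sublocale Kmod: plain_module A K by (rule plain_module.intro module_K)+

lemma KC_simps: "carrier KC = carrier K" "zero KC = zero K" "add KC = add K"
  "smult KC = (\<lambda>c x. H0_class S (poly_const c) \<star> x)"
  by (simp_all add: H0c_CC_def)

lemma module_KC: "module CC KC"
  by (rule module_restrict_scalars[OF module_K H0_const_hom]) (simp_all add: KC_simps)

sublocale KC: module CC KC by (rule module_KC)

lemma FJ_closed [simp, intro]: "J \<in> H0c_gens S \<Longrightarrow> FJ J \<in> carrier K"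
  unfolding F0_gen_def H0c_def by (intro K.coset_closed G_closed)

lemma smult_FJ:
  "X \<in> carrier A \<Longrightarrow> J \<in> H0c_gens S \<Longrightarrow>
    X \<star> FJ J = H0c_null S +>\<^bsub>M\<^esub> (X \<odot>\<^bsub>M\<^esub> G J)"
  unfolding F0_gen_def H0c_def by (rule K.quotient_smult) auto

lemma relator_null: "u \<in> H0c_relators \<Longrightarrow> u \<in> H0c_null S"
  unfolding H0c_null_eq using M.submodule_generated_incl by blast

lemma coset_null: "u \<in> H0c_null S \<Longrightarrow> H0c_null S +>\<^bsub>M\<^esub> u = \<zero>\<^bsub>K\<^esub>"
  using K.N.a_rcos_const[of u] by (simp add: H0c_def quotient_module_def)

lemma D_FJ_adjacent:
  assumes "adjacent S i j" "j \<in> interior"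
  shows "D i \<star> FJ {j} = FJ {i, j}"
proof -
  have "D i \<odot>\<^bsub>M\<^esub> G {j} \<ominus>\<^bsub>M\<^esub> G {i, j} \<in> H0c_relators"
    using assms unfolding H0c_relators_def by blast
  from relator_null[OF this] show ?thesis
    using assms adjacentD[OF assms(1)] gens_single gens_pair
    by (simp add: smult_FJ D0_closed) (simp add: F0_gen_def K.coset_eq_iff D0_closed)
qed

lemma D_FJ_nonadjacent:
  assumes "i \<in> S" "j \<in> interior" "i \<noteq> j" "\<not> adjacent S i j"
  shows "D i \<star> FJ {j} = \<zero>\<^bsub>K\<^esub>"
proof -
  have "D i \<odot>\<^bsub>M\<^esub> G {j} \<in> H0c_relators"
    using assms unfolding H0c_relators_def by blast
  then show ?thesis using assms gens_single by (simp add: smult_FJ D0_closed coset_null relator_null)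
qed

lemma D_FJ_pair:
  assumes "k \<in> S" "adjacent S i j"
  shows "D k \<star> FJ {i, j} = \<zero>\<^bsub>K\<^esub>"
proof -
  have "D k \<odot>\<^bsub>M\<^esub> G {i, j} \<in> H0c_relators"
    using assms unfolding H0c_relators_def by blast
  then show ?thesis using assms gens_pair by (simp add: smult_FJ D0_closed coset_null relator_null)
qed

lemma linear_map_action_left:
  assumes y: "y \<in> carrier K"
  shows "linear_map A KC (\<lambda>X. X \<star> y)"
proof (rule linear_mapI)
  show "(c \<odot>\<^bsub>A\<^esub> X) \<star> y = c \<odot>\<^bsub>KC\<^esub> (X \<star> y)" if "X \<in> carrier A" for c X
    using that y by (simp add: H0_simps(6) KC_simps Kmod.smult_assoc1)
qed (use y in \<open>auto simp: module_H0 module_KC KC_simps Kmod.smult_l_distr\<close>)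

lemma linear_map_action_right:
  assumes X: "X \<in> carrier A"
  shows "linear_map KC KC (\<lambda>y. X \<star> y)"
proof (rule linear_mapI)
  show "X \<star> (c \<odot>\<^bsub>KC\<^esub> y) = c \<odot>\<^bsub>KC\<^esub> (X \<star> y)" if "y \<in> carrier KC" for c y
    using that X by (simp add: KC_simps Kmod.smult_assoc1[symmetric] A.m_comm)
qed (use X in \<open>auto simp: module_KC KC_simps Kmod.smult_r_distr\<close>)

lemma D_affine_sum: "(\<Oplus>\<^bsub>A\<^esub>i\<in>S. (of_nat i - c) \<odot>\<^bsub>A\<^esub> D i) = \<zero>\<^bsub>A\<^esub>"
proof -
  have "(\<Oplus>\<^bsub>A\<^esub>i\<in>S. (of_nat i - c) \<odot>\<^bsub>A\<^esub> D i) = (\<Oplus>\<^bsub>A\<^esub>i\<in>S. of_nat i \<odot>\<^bsub>A\<^esub> D i \<oplus>\<^bsub>A\<^esub> (- c) \<odot>\<^bsub>A\<^esub> D i)"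
    by (rule A.finsum_cong') (auto simp: AC.smult_l_distr[of _ "- c", simplified])
  also have "\<dots> = (\<Oplus>\<^bsub>A\<^esub>i\<in>S. of_nat i \<odot>\<^bsub>A\<^esub> D i) \<oplus>\<^bsub>A\<^esub> (\<Oplus>\<^bsub>A\<^esub>i\<in>S. (- c) \<odot>\<^bsub>A\<^esub> D i)"
    by (rule A.finsum_addf) auto
  also have "(\<Oplus>\<^bsub>A\<^esub>i\<in>S. (- c) \<odot>\<^bsub>A\<^esub> D i) = (- c) \<odot>\<^bsub>A\<^esub> (\<Oplus>\<^bsub>A\<^esub>i\<in>S. D i)"
    by (rule AC.finsum_smult_ldistr[symmetric]) (auto simp: fan_finite)
  finally show ?thesis by (simp add: D0_weighted_sum D0_sum AC.smult_r_null)
qed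

text \<open>
  A linear relation among the \<open>D\<^sub>i\<close> applied to \<open>F\<^sub>k\<close>: only \<open>k\<close> and its neighbours contribute.
\<close>

lemma FJ_linear_relation:
  assumes h: "(\<Oplus>\<^bsub>A\<^esub>i\<in>S. h i \<odot>\<^bsub>A\<^esub> D i) = \<zero>\<^bsub>A\<^esub>"
    and k: "k \<in> interior" and p: "consecutive S p k" and s: "consecutive S k s"
  shows "h k \<odot>\<^bsub>KC\<^esub> (D k \<star> FJ {k}) \<oplus>\<^bsub>KC\<^esub>
    (h p \<odot>\<^bsub>KC\<^esub> FJ {p, k} \<oplus>\<^bsub>KC\<^esub> h s \<odot>\<^bsub>KC\<^esub> FJ {s, k}) = \<zero>\<^bsub>KC\<^esub>"
proof -
  interpret l: linear_map A KC "\<lambda>X. X \<star> FJ {k}"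
    by (intro linear_map_action_left FJ_closed gens_single k)
  have ps: "p \<in> S" "s \<in> S" "k \<in> S" "p < k" "k < s" using p s by (auto simp: consecutive_def)
  have adj: "adjacent S p k" "adjacent S s k" using p s by (auto simp: adjacent_def)
  have nonadj: "\<not> adjacent S i k" if "i \<noteq> p" "i \<noteq> s" for i
    using that p s consecutive_unique by (auto simp: adjacent_def)
  have closed: "D i \<star> FJ {k} \<in> carrier KC" if "i \<in> S" for i
    using that by auto
  have "\<zero>\<^bsub>KC\<^esub> = (\<Oplus>\<^bsub>A\<^esub>i\<in>S. h i \<odot>\<^bsub>A\<^esub> D i) \<star> FJ {k}"
    unfolding h using l.zero by simp
  also have "\<dots> = (\<Oplus>\<^bsub>KC\<^esub>i\<in>S. h i \<odot>\<^bsub>KC\<^esub> (D i \<star> FJ {k}))"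
    by (subst l.finsum, force, intro KC.finsum_cong'[OF refl]) (auto simp: l.smult)
  also have "\<dots> = (\<Oplus>\<^bsub>KC\<^esub>i\<in>{k, p, s}. h i \<odot>\<^bsub>KC\<^esub> (D i \<star> FJ {k}))"
  proof (rule KC.add.finprod_mono_neutral_cong_right)
    show "h i \<odot>\<^bsub>KC\<^esub> (D i \<star> FJ {k}) = \<zero>\<^bsub>KC\<^esub>" if "i \<in> S - {k, p, s}" for i
      using that nonadj k KC.smult_r_null by (auto simp: D_FJ_nonadjacent KC_simps(2)[symmetric])
  qed (use ps closed fan_finite in auto)
  also have "\<dots> = h k \<odot>\<^bsub>KC\<^esub> (D k \<star> FJ {k}) \<oplus>\<^bsub>KC\<^esub>
      (h p \<odot>\<^bsub>KC\<^esub> (D p \<star> FJ {k}) \<oplus>\<^bsub>KC\<^esub> h s \<odot>\<^bsub>KC\<^esub> (D s \<star> FJ {k}))"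
    using ps closed by simp
  finally show ?thesis using adj k by (simp add: D_FJ_adjacent)
qed

text \<open>
  In the relation \<open>\<Sum>\<^sub>i (i - k) D\<^sub>i = 0\<close> the term for \<open>i = k\<close> has coefficient zero.
\<close>

lemma FJ_pair_relation:
  assumes k: "k \<in> interior" and p: "consecutive S p k" and s: "consecutive S k s"
  shows "of_real (real s - real k) \<odot>\<^bsub>KC\<^esub> FJ {k, s} = of_real (real k - real p) \<odot>\<^bsub>KC\<^esub> FJ {p, k}"
proof -
  have adj: "adjacent S p k" "adjacent S s k" using p s by (auto simp: adjacent_def)
  then have closed: "FJ {p, k} \<in> carrier KC" "FJ {s, k} \<in> carrier KC" "D k \<star> FJ {k} \<in> carrier KC"
    using gens_pair gens_single[OF k] k by (auto simp: KC_simps(1))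
  have "(of_nat s - of_nat k) \<odot>\<^bsub>KC\<^esub> FJ {s, k} = \<ominus>\<^bsub>KC\<^esub> ((of_nat p - of_nat k) \<odot>\<^bsub>KC\<^esub> FJ {p, k})"
    using FJ_linear_relation[OF D_affine_sum[of "of_nat k"] k p s] closed KC.smult_l_null
      KC.minus_equality[of "(of_nat s - of_nat k) \<odot>\<^bsub>KC\<^esub> FJ {s, k}" "(of_nat p - of_nat k) \<odot>\<^bsub>KC\<^esub> FJ {p, k}"]
    by (simp add: KC.a_comm)
  also have "\<dots> = (of_nat k - of_nat p) \<odot>\<^bsub>KC\<^esub> FJ {p, k}"
    using KC.smult_l_minus[of "of_nat p - of_nat k" "FJ {p, k}"] closed by simp
  finally show ?thesis by (simp add: insert_commute)
qed

text \<open>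
  By \<open>FJ_pair_relation\<close> this is the same for all adjacent pairs, namely the element \<open>F\<close>.
\<close>

definition F_scaled :: "nat \<Rightarrow> nat \<Rightarrow> (nat set \<Rightarrow> cpoly set) set" where
  "F_scaled i j = of_real \<bar>real j - real i\<bar> \<odot>\<^bsub>KC\<^esub> FJ {i, j}"

lemma F_scaled_sym: "F_scaled i j = F_scaled j i"
  by (simp add: F_scaled_def insert_commute abs_minus_commute)

lemma F_scaled_consecutive:
  assumes "consecutive S i j" "consecutive S 0 s"
  shows "F_scaled i j = F_scaled 0 s"
  using assms(1)
proof (induction i arbitrary: j rule: less_induct)
  case (less i)
  show ?case
  proof (cases "i = 0")
    case True
    then show ?thesis using less.prems assms(2) consecutive_unique by blast
  next
    case False
    have i: "i \<in> interior" using less.prems False fan_le by (fastforce simp: consecutive_def)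
    obtain p where p: "consecutive S p i" using i predecessor_exists by blast
    have "F_scaled p i = F_scaled 0 s" using less.IH[OF _ p] p by (simp add: consecutive_def)
    moreover have "p < i" "i < j" using p less.prems by (auto simp: consecutive_def)
    ultimately show ?thesis
      using FJ_pair_relation[OF i p less.prems] by (simp add: F_scaled_def)
  qed
qed

lemma F0_properties:
  shows F0_closed: "F0 S \<in> carrier K"
    and F0_pair: "adjacent S i j \<Longrightarrow> FJ {i, j} = of_real (1 / \<bar>real j - real i\<bar>) \<odot>\<^bsub>KC\<^esub> F0 S"
proof -
  obtain s where s: "consecutive S 0 s" using successor_exists[OF zero_in] n_pos by blast
  have adj0: "adjacent S 0 s" using s by (simp add: adjacent_def)
  have cancel: "of_real (1 / \<bar>real j - real i\<bar>) \<odot>\<^bsub>KC\<^esub> (of_real \<bar>real j - real i\<bar> \<odot>\<^bsub>KC\<^esub> x) = x"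
    "of_real \<bar>real j - real i\<bar> \<odot>\<^bsub>KC\<^esub> (of_real (1 / \<bar>real j - real i\<bar>) \<odot>\<^bsub>KC\<^esub> x) = x"
    if "adjacent S i j" "x \<in> carrier K" for i j x
    using adjacentD(3)[OF that(1)] that(2) KC.smult_one[of x]
      KC.smult_assoc1[of "of_real (1 / \<bar>real j - real i\<bar>)" "of_real \<bar>real j - real i\<bar>" x, symmetric]
      KC.smult_assoc1[of "of_real \<bar>real j - real i\<bar>" "of_real (1 / \<bar>real j - real i\<bar>)" x, symmetric]
    by (auto simp: KC_simps(1) simp flip: of_real_mult)
  let ?P = "\<lambda>x. x \<in> carrier K \<and> (\<forall>i j. adjacent S i j \<longrightarrow>
        FJ {i, j} = complex_of_real (1 / \<bar>real j - real i\<bar>) \<odot>\<^bsub>KC\<^esub> x)"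
  have eq: "F_scaled i j = F_scaled 0 s" if "adjacent S i j" for i j
    using that F_scaled_consecutive s F_scaled_sym unfolding adjacent_def by metis
  have cl: "FJ {i, j} \<in> carrier KC" if "adjacent S i j" for i j
    using that gens_pair by (simp add: KC_simps)
  have "?P (F_scaled 0 s)"
  proof (intro conjI allI impI)
    show "F_scaled 0 s \<in> carrier K"
      using KC.smult_closed[OF _ cl[OF adj0]] by (simp add: F_scaled_def KC_simps(1))
    show "FJ {i, j} = of_real (1 / \<bar>real j - real i\<bar>) \<odot>\<^bsub>KC\<^esub> F_scaled 0 s" if "adjacent S i j" for i j
      by (rule cancel(1)[OF that cl[OF that, unfolded KC_simps(1)], folded F_scaled_def,
            unfolded eq[OF that], symmetric])
  qed
  moreover have "x = F_scaled 0 s" if "?P x" for x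
    using that cancel(2)[OF adj0, of x] adj0 by (simp add: F_scaled_def)
  ultimately have "?P (F0 S)" unfolding F0_def by (rule theI)
  then show "F0 S \<in> carrier K"
    and "adjacent S i j \<Longrightarrow> FJ {i, j} = of_real (1 / \<bar>real j - real i\<bar>) \<odot>\<^bsub>KC\<^esub> F0 S"
    by blast+
qed

lemma D_FJ_diagonal:
  assumes k: "k \<in> interior" and p: "consecutive S p k" and s: "consecutive S k s"
  shows "D k \<star> FJ {k} = \<ominus>\<^bsub>KC\<^esub> (FJ {p, k} \<oplus>\<^bsub>KC\<^esub> FJ {s, k})"
proof -
  have adj: "adjacent S p k" "adjacent S s k" using p s by (auto simp: adjacent_def)
  then have closed: "FJ {p, k} \<in> carrier KC" "FJ {s, k} \<in> carrier KC" "D k \<star> FJ {k} \<in> carrier KC"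
    using gens_pair gens_single[OF k] k by (auto simp: KC_simps(1))
  have "(\<Oplus>\<^bsub>A\<^esub>i\<in>S. 1 \<odot>\<^bsub>A\<^esub> D i) = (\<Oplus>\<^bsub>A\<^esub>i\<in>S. D i)"
    using AC.smult_one by (intro A.finsum_cong'[OF refl]) auto
  then have "(\<Oplus>\<^bsub>A\<^esub>i\<in>S. 1 \<odot>\<^bsub>A\<^esub> D i) = \<zero>\<^bsub>A\<^esub>" by (simp add: D0_sum)
  from FJ_linear_relation[OF this k p s] show ?thesis
    using closed KC.smult_one KC.minus_equality[of "D k \<star> FJ {k}" "FJ {p, k} \<oplus>\<^bsub>KC\<^esub> FJ {s, k}"]
    by simp
qed

text \<open>
  The module is generated over \<open>H\<^sub>0\<close> by the \<open>F\<^sub>J\<close>, so the complex span of \<open>F\<close> and the \<open>F\<^sub>k\<close> is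
  everything as soon as it is stable under the \<open>D\<^sub>i\<close>; on each generator \<open>D\<^sub>i\<close> gives
  zero or a combination of the \<open>F\<close> of adjacent pairs.
\<close>

lemma H0c_spanned:
  assumes N: "submodule N CC KC" "insert (F0 S) ((\<lambda>k. FJ {k}) ` interior) \<subseteq> N"
  shows "carrier KC \<subseteq> N"
proof -
  note NE = KC.submoduleE[OF N(1)]
  have pair: "FJ {i, j} \<in> N" if "adjacent S i j" for i j
    unfolding F0_pair[OF that] using N(2) by (intro NE(4)) auto
  have single: "FJ {k} \<in> N" if "k \<in> interior" for k using that N(2) by blast
  have D_single: "D i \<star> FJ {k} \<in> N" if i: "i \<in> S" and k: "k \<in> interior" for i k
  proof (cases "i = k")
    case True
    obtain p s where ps: "consecutive S p k" "consecutive S k s" using interior_neighbours[OF k] by metis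
    then have "adjacent S p k" "adjacent S s k" by (auto simp: adjacent_def)
    then show ?thesis using True D_FJ_diagonal[OF k ps] pair NE(3,5) by simp
  next
    case False
    show ?thesis
    proof (cases "adjacent S i k")
      case True
      then show ?thesis using k pair by (simp add: D_FJ_adjacent)
    next
      case f: False
      then show ?thesis using False i k KC.submodule_zero[OF N(1)]
        by (simp add: D_FJ_nonadjacent KC_simps(2))
    qed
  qed
  have action: "X \<star> FJ J \<in> N" if J: "J \<in> H0c_gens S" and X: "X \<in> carrier A" for X J
  proof -
    interpret l: linear_map A KC "\<lambda>X. X \<star> FJ J"
      by (intro linear_map_action_left FJ_closed J)
    note l.submodule_vimage[OF N(1)]
    moreover have "insert \<one>\<^bsub>A\<^esub> (D ` S) \<subseteq> {X \<in> carrier A. X \<star> FJ J \<in> N}"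
      using J pair single D_single KC.submodule_zero[OF N(1)]
      by (auto simp: H0c_gens_def interior_rays_eq D_FJ_pair KC_simps(2) gens_single gens_pair)
    ultimately show ?thesis using H0_spanned X by blast
  qed
  let ?J = "{x \<in> carrier K. \<forall>X\<in>carrier A. X \<star> x \<in> N}"
  have "submodule ?J A K"
  proof (rule Kmod.submoduleI')
    show "a \<star> x \<in> ?J"
      if "a \<in> carrier A" "x \<in> ?J" for a x
      using that by (auto simp: Kmod.smult_assoc1[symmetric])
  qed (use KC.submodule_zero[OF N(1)] NE(5) in
      \<open>auto simp: KC_simps(2,3) Kmod.smult_r_distr\<close>)
  moreover have "FJ ` H0c_gens S \<subseteq> ?J"
    using action by auto
  ultimately have "submodule_generated A K (FJ ` H0c_gens S) \<subseteq> ?J"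
    by (rule Kmod.submodule_generated_least)
  moreover have "carrier K \<subseteq> submodule_generated A K (FJ ` H0c_gens S)"
    using K.quotient_spanned[OF _ cring.free_module_spanned[OF cring_H0, of S "H0c_gens S", folded H0c_free_def]]
    unfolding H0c_def F0_gen_def image_image by auto
  ultimately have "\<one>\<^bsub>A\<^esub> \<star> x \<in> N" if "x \<in> carrier K" for x using that by blast
  then show ?thesis by (auto simp: KC_simps(1))
qed

section \<open>The integral on the untwisted sector\<close>

text \<open>
  The integral on the free module. The value at \<open>X F\<^sub>k\<close> has to be \<open>X \<mapsto> \<integral> X F\<^sub>k\<close>, which is the derivation
  with values \<open>weight S k i\<close> at \<open>D\<^sub>i\<close>, and the value at \<open>X F\<close> for an adjacent pair only sees the constant
  term of \<open>X\<close>, as all \<open>D\<^sub>i\<close> act on it by zero.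
\<close>

definition pre_integral :: "(nat set \<Rightarrow> cpoly set) \<Rightarrow> complex" where
  "pre_integral f = (\<Sum>k\<in>interior. derivation S (weight S k) (f {k})) +
     (\<Sum>(i, j)\<in>{(i, j). consecutive S i j}. augmentation (f {i, j}) / of_real (real j - real i))"

lemma finite_consecutive: "finite {(i, j). consecutive S i j}"
  by (rule finite_subset[of _ "S \<times> S"]) (auto simp: consecutive_def fan_finite)

lemma M_apply_closed: "f \<in> carrier M \<Longrightarrow> f J \<in> carrier A"
  unfolding H0c_free_def by (rule cring.free_module_apply_closed[OF cring_H0])

lemma M_simps:
  "\<zero>\<^bsub>M\<^esub> = (\<lambda>_. \<zero>\<^bsub>A\<^esub>)" "f \<oplus>\<^bsub>M\<^esub> h = (\<lambda>J. f J \<oplus>\<^bsub>A\<^esub> h J)" "X \<odot>\<^bsub>M\<^esub> f = (\<lambda>J. X \<otimes>\<^bsub>A\<^esub> f J)"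
  by (simp_all add: H0c_free_def free_module_simps)

lemma linear_map_augmentation: "linear_map A CC augmentation"
  by (rule descending.linear_map_descend[OF descending_const_coeff])

lemma linear_map_derivation: "k \<in> interior \<Longrightarrow> linear_map A CC (derivation S (weight S k))"
  by (rule descending.linear_map_descend[OF descending_weight])

lemma pre_integral_add:
  assumes "f \<in> carrier M" "h \<in> carrier M"
  shows "pre_integral (f \<oplus>\<^bsub>M\<^esub> h) = pre_integral f + pre_integral h"
proof -
  have "derivation S (weight S k) (f J \<oplus>\<^bsub>A\<^esub> h J) =
      derivation S (weight S k) (f J) + derivation S (weight S k) (h J)" if "k \<in> interior" for k J
    using linear_map.add[OF linear_map_derivation[OF that]] assms M_apply_closed by simp
  moreover have "augmentation (f J \<oplus>\<^bsub>A\<^esub> h J) = augmentation (f J) + augmentation (h J)" for J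
    using linear_map.add[OF linear_map_augmentation] assms M_apply_closed by simp
  ultimately show ?thesis
    by (simp add: pre_integral_def M_simps sum.distrib add_divide_distrib split_def)
qed

lemma pre_integral_single:
  assumes "k \<in> interior" "X \<in> carrier A"
  shows "pre_integral (X \<odot>\<^bsub>M\<^esub> G {k}) = derivation S (weight S k) X"
proof -
  have 1: "(\<Sum>k'\<in>interior. derivation S (weight S k') ((X \<odot>\<^bsub>M\<^esub> G {k}) {k'})) =
      (\<Sum>k'\<in>interior. if k' = k then derivation S (weight S k) X else 0)"
    by (rule sum.cong)
      (use assms linear_map.zero[OF linear_map_derivation] in \<open>auto simp: M_simps free_gen_def\<close>)
  have 2: "(\<Sum>(i, j)\<in>{(i, j). consecutive S i j}.
      augmentation ((X \<odot>\<^bsub>M\<^esub> G {k}) {i, j}) / of_real (real j - real i)) = 0"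
    by (rule sum.neutral)
      (use assms linear_map.zero[OF linear_map_augmentation] in
        \<open>auto simp: M_simps free_gen_def consecutive_def\<close>)
  show ?thesis unfolding pre_integral_def 1 2 using assms fan_finite by simp
qed

lemma pre_integral_pair:
  assumes "adjacent S i j" "X \<in> carrier A"
  shows "pre_integral (X \<odot>\<^bsub>M\<^esub> G {i, j}) = augmentation X / of_real \<bar>real j - real i\<bar>"
proof -
  have main: "pre_integral (X \<odot>\<^bsub>M\<^esub> G {i, j}) = augmentation X / of_real (real j - real i)"
    if ij: "consecutive S i j" for i j
  proof -
    have 1: "(\<Sum>k\<in>interior. derivation S (weight S k) ((X \<odot>\<^bsub>M\<^esub> G {i, j}) {k})) = 0"
      by (rule sum.neutral)
        (use assms ij linear_map.zero[OF linear_map_derivation] in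
          \<open>auto simp: M_simps free_gen_def consecutive_def\<close>)
    have pair: "{a, b} = {i, j} \<longleftrightarrow> a = i \<and> b = j" if "consecutive S a b" for a b
      using that ij by (auto simp: consecutive_def doubleton_eq_iff)
    have 2: "(\<Sum>(i', j')\<in>{(i, j). consecutive S i j}.
        augmentation ((X \<odot>\<^bsub>M\<^esub> G {i, j}) {i', j'}) / of_real (real j' - real i')) =
      (\<Sum>q\<in>{(i, j). consecutive S i j}. if q = (i, j) then augmentation X / of_real (real j - real i) else 0)"
      by (rule sum.cong)
        (use assms ij linear_map.zero[OF linear_map_augmentation] in
          \<open>auto simp: M_simps free_gen_def pair split: if_split_asm\<close>)
    show ?thesis unfolding pre_integral_def 1 2 using ij finite_consecutive by simp
  qed
  from assms(1) show ?thesis unfolding adjacent_def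
  proof
    assume "consecutive S i j"
    then show ?thesis using main[of i j] by (simp add: consecutive_def)
  next
    assume "consecutive S j i"
    then show ?thesis using main[of j i]
      by (simp add: consecutive_def insert_commute abs_minus_commute)
  qed
qed

text \<open>
  The elements all of whose \<open>H\<^sub>0\<close>-multiples have integral zero form an \<open>H\<^sub>0\<close>-submodule, so the relators
  suffice. On \<open>D\<^sub>i F\<^sub>j - F\<^bsub>{i,j}\<^esub>\<close> the two contributions cancel by the choice of the weights.
\<close>

lemma pre_integral_null:
  assumes "u \<in> H0c_null S"
  shows "pre_integral u = 0"
proof -
  let ?J = "{u \<in> carrier M. \<forall>X\<in>carrier A. pre_integral (X \<odot>\<^bsub>M\<^esub> u) = 0}"
  have zero: "pre_integral \<zero>\<^bsub>M\<^esub> = 0"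
    using pre_integral_add[of "\<zero>\<^bsub>M\<^esub>" "\<zero>\<^bsub>M\<^esub>"] by simp
  have "submodule ?J A M"
  proof (rule M.submoduleI')
    show "a \<odot>\<^bsub>M\<^esub> x \<in> ?J" if "a \<in> carrier A" "x \<in> ?J" for a x
      using that by (auto simp: M.smult_assoc1[symmetric])
  qed (auto simp: zero M.smult_r_distr pre_integral_add M.smult_r_null)
  moreover have "H0c_relators \<subseteq> ?J"
  proof
    fix u assume u: "u \<in> H0c_relators"
    have uminus: "pre_integral (\<ominus>\<^bsub>M\<^esub> v) = - pre_integral v" if "v \<in> carrier M" for v
      using pre_integral_add[of "\<ominus>\<^bsub>M\<^esub> v" v] that zero
      by (simp add: M.l_neg add_eq_0_iff)
    have product: "derivation S (weight S j) (X \<otimes>\<^bsub>A\<^esub> D i) = augmentation X * weight S j i"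
      if "X \<in> carrier A" "i \<in> S" "j \<in> interior" for X i j
      using that descending_weight fan_finite
      by (simp add: H0_functional_mult derivation_simps D0_closed)
    have weight: "weight S j i = (if adjacent S i j then 1 / of_real \<bar>real j - real i\<bar> else 0)"
      if "i \<noteq> j" for i j
      using that by (auto simp: weight_def adjacent_sym abs_minus_commute)
    have "pre_integral (X \<odot>\<^bsub>M\<^esub> (D i \<odot>\<^bsub>M\<^esub> G {j} \<ominus>\<^bsub>M\<^esub> G {i, j})) = 0"
      if "X \<in> carrier A" "adjacent S i j" "j \<in> interior" for X i j
    proof -
      note cl = that adjacentD[OF that(2)] gens_single[OF that(3)] gens_pair[OF that(2)]
      have "X \<odot>\<^bsub>M\<^esub> (D i \<odot>\<^bsub>M\<^esub> G {j} \<ominus>\<^bsub>M\<^esub> G {i, j}) =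
          (X \<otimes>\<^bsub>A\<^esub> D i) \<odot>\<^bsub>M\<^esub> G {j} \<oplus>\<^bsub>M\<^esub> \<ominus>\<^bsub>M\<^esub> (X \<odot>\<^bsub>M\<^esub> G {i, j})"
        using cl by (simp add: a_minus_def M.smult_r_distr M.smult_r_minus M.smult_assoc1 D0_closed)
      then show ?thesis using cl
        by (simp add: pre_integral_add uminus pre_integral_single pre_integral_pair product weight
            D0_closed)
    qed
    moreover have "pre_integral (X \<odot>\<^bsub>M\<^esub> (D i \<odot>\<^bsub>M\<^esub> G {j})) = 0"
      if "X \<in> carrier A" "i \<in> S" "j \<in> interior" "i \<noteq> j" "\<not> adjacent S i j" for X i j
      using that gens_single[OF that(3)]
      by (simp add: M.smult_assoc1[symmetric] pre_integral_single product weight D0_closed)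
    moreover have "pre_integral (X \<odot>\<^bsub>M\<^esub> (D k \<odot>\<^bsub>M\<^esub> G {i, j})) = 0"
      if "X \<in> carrier A" "k \<in> S" "adjacent S i j" for X k i j
      using that gens_pair[OF that(3)]
      by (simp add: M.smult_assoc1[symmetric] pre_integral_pair H0_functional_mult D0_closed)
    moreover have "u \<in> carrier M" using u H0c_relators_closed by blast
    ultimately show "u \<in> ?J" using u unfolding H0c_relators_def by auto
  qed
  ultimately have "H0c_null S \<subseteq> ?J"
    unfolding H0c_null_eq by (rule M.submodule_generated_least)
  then have "u \<in> carrier M" "pre_integral (\<one>\<^bsub>A\<^esub> \<odot>\<^bsub>M\<^esub> u) = 0" using assms by blast+
  then show ?thesis by simp
qed

definition integral_map :: "(nat set \<Rightarrow> cpoly set) set \<Rightarrow> complex" where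
  "integral_map x = the_elem (pre_integral ` x)"

lemma integral_map_coset: "u \<in> carrier M \<Longrightarrow> integral_map (H0c_null S +>\<^bsub>M\<^esub> u) = pre_integral u"
  unfolding integral_map_def
  by (subst K.value_constant_on_coset[where A = CC])
    (auto simp: pre_integral_add pre_integral_null cring_CC cring.axioms ring.is_abelian_group)

lemma integral_map_single:
  "X \<in> carrier A \<Longrightarrow> k \<in> interior \<Longrightarrow> integral_map (X \<star> FJ {k}) = derivation S (weight S k) X"
  using gens_single[of k] by (simp add: smult_FJ integral_map_coset pre_integral_single)

lemma pre_integral_smult:
  assumes "f \<in> carrier M"
  shows "pre_integral (H0_class S (poly_const c) \<odot>\<^bsub>M\<^esub> f) = c * pre_integral f"
proof -
  have "derivation S (weight S k) (H0_class S (poly_const c) \<otimes>\<^bsub>A\<^esub> f J) = c * derivation S (weight S k) (f J)"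
    if "k \<in> interior" for k J
    using linear_map.smult[OF linear_map_derivation[OF that], of "f J" c] assms M_apply_closed
    by (simp add: H0_simps(6))
  moreover have "augmentation (H0_class S (poly_const c) \<otimes>\<^bsub>A\<^esub> f J) = c * augmentation (f J)" for J
    using linear_map.smult[OF linear_map_augmentation, of "f J" c] assms M_apply_closed
    by (simp add: H0_simps(6))
  ultimately show ?thesis
    by (simp add: pre_integral_def M_simps sum_distrib_left distrib_left split_def)
qed

lemma linear_map_integral_map: "linear_map KC CC integral_map"
proof (rule linear_mapI)
  show "integral_map (x \<oplus>\<^bsub>KC\<^esub> y) = integral_map x \<oplus>\<^bsub>CC\<^esub> integral_map y"
    if "x \<in> carrier KC" "y \<in> carrier KC" for x y
    using that
    by (auto simp: KC_simps H0c_def K.quotient_carrier K.quotient_add integral_map_coset pre_integral_add)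
  show "integral_map (c \<odot>\<^bsub>KC\<^esub> x) = c \<odot>\<^bsub>CC\<^esub> integral_map x" if "x \<in> carrier KC" for c x
    using that
    by (auto simp: KC_simps H0c_def K.quotient_carrier K.quotient_smult integral_map_coset pre_integral_smult)
qed (auto simp: module_KC module_CC)

lemma integral_map_F0:
  assumes X: "X \<in> carrier A"
  shows "integral_map (X \<star> F0 S) = augmentation X"
proof -
  interpret I: linear_map KC CC integral_map by (rule linear_map_integral_map)
  interpret r: linear_map KC KC "\<lambda>y. X \<star> y" by (rule linear_map_action_right[OF X])
  obtain s where s: "consecutive S 0 s" using successor_exists[OF zero_in] n_pos by blast
  then have adj: "adjacent S 0 s" "s \<noteq> 0" by (auto simp: adjacent_def consecutive_def)
  have "integral_map (X \<star> FJ {0, s}) = augmentation X / of_nat s"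
    using adj gens_pair[OF adj(1)] X by (simp add: smult_FJ integral_map_coset pre_integral_pair)
  moreover have "X \<star> FJ {0, s} = of_real (1 / real s) \<odot>\<^bsub>KC\<^esub> (X \<star> F0 S)"
    using F0_pair[OF adj(1)] F0_closed by (simp add: r.smult KC_simps(1))
  moreover have "X \<star> F0 S \<in> carrier KC" using r.closed F0_closed by (simp add: KC_simps(1))
  ultimately show ?thesis using adj(2) by (simp add: I.smult)
qed

text \<open>
  The two prescriptions defining the integral determine it since \<open>F\<close> and the \<open>F\<^sub>k\<close> span.
\<close>

lemma integral0_eq: "integral0 S = restrict integral_map (carrier KC)" (is "_ = ?I")
  unfolding integral0_def
proof (rule the_equality)
  interpret I: linear_map KC CC integral_map by (rule linear_map_integral_map)
  have gens: "insert (F0 S) ((\<lambda>k. FJ {k}) ` interior) \<subseteq> carrier KC"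
    using F0_closed gens_single by (auto simp: KC_simps(1))
  have one: "X = \<one>\<^bsub>A\<^esub> \<star> X" if "X \<in> carrier KC" for X using that by (simp add: KC_simps(1))
  have F: "integral_map (F0 S) = 1"
    using integral_map_F0[of "\<one>\<^bsub>A\<^esub>"] gens one[of "F0 S"] by simp
  have Fk: "integral_map (FJ {k}) = 0" if "k \<in> interior" for k
    using integral_map_single[of "\<one>\<^bsub>A\<^esub>" k] gens one[of "FJ {k}"] that
      derivation_simps(1)[OF descending_weight[OF that] fan_finite] by auto
  show "?I \<in> dual_space KC \<and> ?I (F0 S) = 1 \<and>
      (\<forall>k\<in>interior_rays S. ?I (FJ {k}) = 0)"
    using gens F Fk I.in_linear_maps by (auto simp: dual_space_def interior_rays_eq)
  fix f assume f: "f \<in> dual_space KC \<and> f (F0 S) = 1 \<and> (\<forall>k\<in>interior_rays S. f (FJ {k}) = 0)"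
  have "linear_map KC CC f"
    by (rule linear_mapI_linear_maps) (use f in \<open>auto simp: dual_space_def module_KC module_CC\<close>)
  moreover have "carrier KC \<subseteq> submodule_generated CC KC (insert (F0 S) ((\<lambda>k. FJ {k}) ` interior))"
    using plain_module.submodule_generated_submodule[OF plain_module.intro[OF module_KC] gens]
      plain_module.submodule_generated_incl[OF plain_module.intro[OF module_KC]]
    by (rule H0c_spanned)
  ultimately have "f x = integral_map x" if "x \<in> carrier KC" for x
  proof (rule linear_map_eq_on_span[OF _ linear_map_integral_map gens _ _ that])
    show "f y = integral_map y" if "y \<in> insert (F0 S) ((\<lambda>k. FJ {k}) ` interior)" for y
      using that
    proof (elim insertE imageE)
      show "f y = integral_map y" if "y = FJ {k}" "k \<in> interior" for k
        using f Fk[OF that(2)] that by (simp add: interior_rays_eq)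
    qed (use f F in simp)
  qed
  then show "f = ?I"
    using f by (intro ext) (auto simp: dual_space_def linear_maps_def PiE_def extensional_def)
qed

lemma linear_map_integral0: "linear_map KC CC (integral0 S)"
  using linear_map_integral_map unfolding integral0_eq
  by (auto simp: linear_map_def linear_map_axioms_def module.smult_closed module_KC)

lemma integral0_action:
  assumes "X \<in> carrier A"
  shows "integral0 S (X \<star> F0 S) = augmentation X"
    and "k \<in> interior \<Longrightarrow> integral0 S (X \<star> FJ {k}) = derivation S (weight S k) X"
proof -
  have "X \<star> x \<in> carrier KC" if "x \<in> carrier K" for x
    using that assms by (simp add: KC_simps(1))
  then show "integral0 S (X \<star> F0 S) = augmentation X"
    and "k \<in> interior \<Longrightarrow> integral0 S (X \<star> FJ {k}) = derivation S (weight S k) X"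
    using F0_closed gens_single assms
    by (simp_all add: integral0_eq integral_map_F0 integral_map_single)
qed

end

section \<open>Twisted sectors\<close>

lemma lattice_NI: "x \<in> \<int> \<Longrightarrow> y \<in> \<int> \<Longrightarrow> (x, y) \<in> lattice_N"
  and lattice_ND: "\<gamma> \<in> lattice_N \<Longrightarrow> fst \<gamma> \<in> \<int>" "\<gamma> \<in> lattice_N \<Longrightarrow> snd \<gamma> \<in> \<int>"
  by (auto simp: lattice_N_def)

lemma Ints_between_0_2: "x \<in> \<int> \<Longrightarrow> 0 < x \<Longrightarrow> x < 2 \<Longrightarrow> x = (1::real)"
proof -
  assume "x \<in> \<int>" "0 < x" "x < 2"
  moreover from this obtain k where "x = of_int k" by (auto elim: Ints_cases)
  ultimately show "x = 1" by simp
qed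

text \<open>
  The second coordinate of \<open>\<gamma>\<close> is \<open>a + b\<close>, an integer strictly between \<open>0\<close> and \<open>2\<close>. The first coordinate
  then lies strictly between the indices of two consecutive rays, so that it determines them.
\<close>

lemma interior_combination_coords:
  assumes "\<gamma> \<in> lattice_N" "interior_combination S \<gamma> i j a b"
  shows "a + b = 1" "fst \<gamma> = real i + b * (real j - real i)" "snd \<gamma> = 1"
    "real i < fst \<gamma>" "fst \<gamma> < real j"
proof -
  have ij: "i < j" and ab: "0 < a" "a < 1" "0 < b" "b < 1" and \<gamma>: "\<gamma> = a *\<^sub>R ray i + b *\<^sub>R ray j"
    using assms(2) by (auto simp: interior_combination_def consecutive_def)
  have "snd \<gamma> = a + b" by (simp add: \<gamma> ray_def)
  then show sum: "a + b = 1" using lattice_ND(2)[OF assms(1)] ab Ints_between_0_2[of "a + b"] by simp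
  then show snd: "snd \<gamma> = 1" using \<open>snd \<gamma> = a + b\<close> by simp
  have a: "a = 1 - b" using sum by simp
  show fst: "fst \<gamma> = real i + b * (real j - real i)"
    by (simp add: \<gamma> ray_def a algebra_simps)
  have "0 < b * (real j - real i)" "b * (real j - real i) < 1 * (real j - real i)"
    using ij ab by (auto intro: mult_strict_right_mono)
  then show "real i < fst \<gamma>" "fst \<gamma> < real j" unfolding fst by auto
qed

lemma consecutive_between_unique:
  assumes "consecutive S i j" "consecutive S i' j'"
    and "real i < x" "x < real j" "real i' < x" "x < real j'"
  shows "i = i'" "j = j'"
proof -
  have "i < j'" "i' < j" using assms(3-6) by (simp_all add: less_trans flip: of_nat_less_iff)
  then have "\<not> i < i'" "\<not> i' < i" "\<not> j < j'" "\<not> j' < j"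
    using assms(1,2) by (auto simp: consecutive_def)
  then show "i = i'" "j = j'" by simp_all
qed

lemma interior_combination_unique:
  assumes "\<gamma> \<in> lattice_N" "interior_combination S \<gamma> i j a b" "interior_combination S \<gamma> i' j' a' b'"
  shows "i = i' \<and> j = j' \<and> a = a' \<and> b = b'"
proof -
  note c = interior_combination_coords[OF assms(1,2)] and c' = interior_combination_coords[OF assms(1,3)]
  have cons: "consecutive S i j" "consecutive S i' j'"
    using assms(2,3) by (auto simp: interior_combination_def)
  have ij: "i = i'" "j = j'"
    using consecutive_between_unique[OF cons c(4,5) c'(4,5)] by auto
  moreover have "b = b'" using c(2) c'(2) cons ij by (simp add: consecutive_def)
  ultimately show ?thesis using c(1) c'(1) by simp
qed

lemma coords_eq:
  assumes "\<gamma> \<in> lattice_N" "interior_combination S \<gamma> i j a b"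
  shows "coords S \<gamma> = (i, j, a, b)"
  unfolding coords_def
proof (rule the_equality)
  show "x = (i, j, a, b)" if "case x of (i, j, a, b) \<Rightarrow> interior_combination S \<gamma> i j a b" for x
    using that interior_combination_unique[OF assms] by (cases x) blast
qed (use assms(2) in simp)

lemma twisted_coords:
  assumes "\<gamma> \<in> twisted S"
  obtains i j a where "interior_combination S \<gamma> i j a (1 - a)" "coords S \<gamma> = (i, j, a, 1 - a)"
    "0 < a" "a < 1" "i < j" "consecutive S i j"
proof -
  obtain i j a b where \<gamma>: "\<gamma> \<in> lattice_N" "interior_combination S \<gamma> i j a b"
    using assms by (auto simp: twisted_def)
  have b: "b = 1 - a" using interior_combination_coords(1)[OF \<gamma>] by simp
  show ?thesis
    by (rule that[of i j a])
      (use \<gamma>(2) coords_eq[OF \<gamma>] b in \<open>simp_all add: interior_combination_def consecutive_def\<close>)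
qed

lemma twisted_nonzero: "0 \<notin> twisted S"
proof
  assume "(0 :: real \<times> real) \<in> twisted S"
  then have "snd (0 :: real \<times> real) = 1"
    using interior_combination_coords(3) unfolding twisted_def by blast
  then show False by simp
qed

lemma box_star_zero [simp]: "box_star S 0 = 0"
  by (simp add: box_star_def)

text \<open>
  The involution is \<open>\<gamma> \<mapsto> v\<^sub>i + v\<^sub>j - \<gamma>\<close>, which preserves the lattice and exchanges the two coordinates of \<open>\<gamma>\<close>,
  as these add up to \<open>1\<close>.
\<close>

lemma box_star_twisted:
  assumes "\<gamma> \<in> twisted S" "coords S \<gamma> = (i, j, a, b)"
  shows "box_star S \<gamma> \<in> twisted S" "coords S (box_star S \<gamma>) = (i, j, b, a)"
    "box_star S (box_star S \<gamma>) = \<gamma>"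
proof -
  obtain i' j' a' where "interior_combination S \<gamma> i' j' a' (1 - a')" "coords S \<gamma> = (i', j', a', 1 - a')"
    using twisted_coords[OF assms(1)] by metis
  with assms(2) have ic: "interior_combination S \<gamma> i j a (1 - a)" "b = 1 - a" by auto
  have eq: "box_star S \<gamma> = (1 - a) *\<^sub>R ray i + a *\<^sub>R ray j"
    using assms twisted_nonzero[of S] ic(2) by (auto simp: box_star_def)
  then have ic': "interior_combination S (box_star S \<gamma>) i j (1 - a) a"
    using ic by (auto simp: interior_combination_def)
  have \<gamma>: "\<gamma> = a *\<^sub>R ray i + (1 - a) *\<^sub>R ray j"
    using ic(1) by (simp add: interior_combination_def)
  have "box_star S \<gamma> = ray i + ray j - \<gamma>"
    unfolding eq by (subst \<gamma>) (simp add: scaleR_left_diff_distrib)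
  moreover have "\<gamma> \<in> lattice_N" using assms(1) by (simp add: twisted_def)
  ultimately have lat: "box_star S \<gamma> \<in> lattice_N"
    by (cases \<gamma>) (auto simp: lattice_N_def ray_def)
  then show tw: "box_star S \<gamma> \<in> twisted S" using ic' by (auto simp: twisted_def)
  show co: "coords S (box_star S \<gamma>) = (i, j, b, a)" using coords_eq[OF lat ic'] ic(2) by simp
  have "box_star S \<gamma> \<noteq> 0" using tw twisted_nonzero[of S] by auto
  then have "box_star S (box_star S \<gamma>) = a *\<^sub>R ray i + (1 - a) *\<^sub>R ray j"
    using co ic(2) by (simp add: box_star_def[of S "box_star S \<gamma>"])
  then show "box_star S (box_star S \<gamma>) = \<gamma>" using \<gamma> by (rule trans[OF _ sym])
qed

lemma box_star_in_twisted: "\<gamma> \<in> twisted S \<Longrightarrow> box_star S \<gamma> \<in> twisted S"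
  and box_star_involutive: "\<gamma> \<in> twisted S \<Longrightarrow> box_star S (box_star S \<gamma>) = \<gamma>"
  by (metis box_star_twisted(1) prod_cases4, metis box_star_twisted(3) prod_cases4)

lemma (in fan) finite_twisted: "finite (twisted S)"
proof (rule finite_subset)
  show "twisted S \<subseteq> (\<lambda>m. (real m, 1)) ` {..n}"
  proof
    fix \<gamma> assume \<gamma>: "\<gamma> \<in> twisted S"
    then obtain i j a b where ic: "\<gamma> \<in> lattice_N" "interior_combination S \<gamma> i j a b"
      by (auto simp: twisted_def)
    note c = interior_combination_coords[OF ic]
    have "j \<le> n" using ic(2) fan_le by (auto simp: interior_combination_def consecutive_def)
    moreover obtain k where k: "fst \<gamma> = of_int k" using lattice_ND(1)[OF ic(1)] by (auto elim: Ints_cases)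
    ultimately have "fst \<gamma> = real (nat k)" "nat k \<le> n" using c(4,5) by auto
    then show "\<gamma> \<in> (\<lambda>m. (real m, 1)) ` {..n}" using c(3) by (cases \<gamma>) auto
  qed
qed simp

lemma card_box_cone_empty: "card (box_cone {}) = 1"
proof -
  have "(0 :: real \<times> real) \<in> lattice_N" by (simp add: lattice_N_def mem_Times_iff)
  then have "box_cone {} = {0}" by (auto simp: box_cone_def)
  then show ?thesis by simp
qed

text \<open>
  For nonzero elements the coefficients again add up to \<open>1\<close>, hence these are the lattice points
  \<open>(m, 1)\<close> strictly between the two generators.
\<close>

lemma box_cone_pair:
  assumes "i < j"
  shows "box_cone {i, j} = insert 0 (ray ` {i<..<j})"
proof (intro equalityI subsetI)
  fix \<gamma> assume "\<gamma> \<in> box_cone {i, j}"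
  then obtain c where lat: "\<gamma> \<in> lattice_N" and c: "0 \<le> c i" "c i < 1" "0 \<le> c j" "c j < 1"
    and \<gamma>: "\<gamma> = c i *\<^sub>R ray i + c j *\<^sub>R ray j"
    using assms by (auto simp: box_cone_def)
  show "\<gamma> \<in> insert 0 (ray ` {i<..<j})"
  proof (cases "c i + c j = 0")
    case True
    then have "c i = 0" "c j = 0" using c by auto
    then show ?thesis using \<gamma> by simp
  next
    case False
    have "snd \<gamma> = c i + c j" by (simp add: \<gamma> ray_def)
    then have sum: "c i + c j = 1"
      using lattice_ND(2)[OF lat] c False Ints_between_0_2[of "c i + c j"] by simp
    then have pos: "0 < c i" "0 < c j" using c by auto
    have "interior_combination {i, j} \<gamma> i j (c i) (c j)"
      using assms c pos \<gamma> by (auto simp: interior_combination_def consecutive_def)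
    note co = interior_combination_coords[OF lat this]
    obtain k where k: "fst \<gamma> = of_int k" using lattice_ND(1)[OF lat] by (auto elim: Ints_cases)
    have "\<gamma> = ray (nat k)" using co k by (cases \<gamma>) (auto simp: ray_def)
    moreover have "nat k \<in> {i<..<j}" using co(4,5) k by auto
    ultimately show ?thesis by blast
  qed
next
  fix \<gamma> assume "\<gamma> \<in> insert 0 (ray ` {i<..<j})"
  then consider "\<gamma> = 0" | m where "i < m" "m < j" "\<gamma> = ray m" by auto
  then show "\<gamma> \<in> box_cone {i, j}"
  proof cases
    case 1
    have "(0 :: real \<times> real) \<in> lattice_N" by (simp add: lattice_N_def mem_Times_iff)
    moreover have "(0 :: real \<times> real) = (\<Sum>k\<in>{i, j}. 0 *\<^sub>R ray k)" by simp
    ultimately show ?thesis unfolding box_cone_def 1 by (intro CollectI conjI exI[of _ "\<lambda>_. 0"]) auto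
  next
    case 2
    let ?c = "\<lambda>k. if k = i then (real j - real m) / (real j - real i) else (real m - real i) / (real j - real i)"
    have ij: "real j - real i \<noteq> 0" "i \<noteq> j" using assms by auto
    have "(real j - real m) * real i + (real m - real i) * real j = real m * (real j - real i)"
      by (simp add: algebra_simps)
    then have "real m = (real j - real m) / (real j - real i) * real i +
        (real m - real i) / (real j - real i) * real j"
      using ij(1) by (simp add: add_divide_distrib[symmetric])
    moreover have "(real j - real m) / (real j - real i) + (real m - real i) / (real j - real i) = 1"
      using ij(1) by (simp add: add_divide_distrib[symmetric])
    ultimately have "\<gamma> = (\<Sum>k\<in>{i, j}. ?c k *\<^sub>R ray k)"
      using 2 ij(2) by (simp add: ray_def)
    moreover have "\<forall>k\<in>{i, j}. 0 \<le> ?c k \<and> ?c k < 1" using 2 by auto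
    moreover have "\<gamma> \<in> lattice_N" using 2 by (simp add: ray_def lattice_N_def)
    ultimately show ?thesis
      unfolding box_cone_def by (intro CollectI conjI exI[of _ ?c]) assumption+
  qed
qed

lemma card_box_cone_pair:
  assumes "i < j"
  shows "card (box_cone {i, j}) = j - i"
proof -
  have "inj_on ray {i<..<j}" by (auto simp: inj_on_def ray_def)
  moreover have "0 \<notin> ray ` {i<..<j}" by (auto simp: ray_def prod_eq_iff)
  ultimately show ?thesis using assms by (simp add: box_cone_pair card_image)
qed

text \<open>
  The coefficient of the sector \<open>\<gamma>\<close> in the inverse; its reciprocal is the factor of the sector in the pairing.
\<close>

definition sector_weight :: "nat set \<Rightarrow> real \<times> real \<Rightarrow> complex" where
  "sector_weight S \<gamma> = (case coords S \<gamma> of (i, j, a, b) \<Rightarrow>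
     complex_of_real (4 * (real j - real i) * (sin (pi * a))\<^sup>2))"

text \<open>
  The two factors are \<open>1 - z\<close> and its complex conjugate for \<open>z = exp (- 2 \<pi> \<i> a)\<close>, and \<open>\<bar>1 - z\<bar>\<^sup>2 = 2 - 2 cos (2 \<pi> a)\<close>.
\<close>

lemma todd_denominator:
  "(1 - exp (- 2 * of_real pi * \<i> * of_real a)) * (1 - exp (- 2 * of_real pi * \<i> * of_real (1 - a))) =
    complex_of_real (4 * (sin (pi * a))\<^sup>2)"
proof -
  have "- 2 * of_real pi * \<i> * of_real (1 - a) = \<i> * of_real (2 * pi * a) - 2 * of_real pi * \<i>"
    by (simp add: algebra_simps)
  then have 1: "exp (- 2 * of_real pi * \<i> * of_real (1 - a)) = cis (2 * pi * a)"
    by (simp add: exp_diff cis_conv_exp)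
  have 2: "exp (- 2 * of_real pi * \<i> * of_real a) = cis (- (2 * pi * a))"
    by (simp add: cis_conv_exp mult_ac)
  have "(1 - cis (- t)) * (1 - cis t) = of_real (2 - 2 * cos t)" for t :: real
    using sin_cos_squared_add[of t] by (simp add: complex_eq_iff power2_eq_square algebra_simps)
  moreover have "2 - 2 * cos (2 * pi * a) = 4 * (sin (pi * a))\<^sup>2"
    using cos_double_sin[of "pi * a"] by (simp add: mult.assoc)
  ultimately show ?thesis unfolding 1 2 by (simp only:)
qed

lemma sector_weight_star: "\<gamma> \<in> twisted S \<Longrightarrow> sector_weight S (box_star S \<gamma>) = sector_weight S \<gamma>"
proof -
  assume \<gamma>: "\<gamma> \<in> twisted S"
  then obtain i j a where c: "coords S \<gamma> = (i, j, a, 1 - a)" by (rule twisted_coords)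
  have "sin (pi * (1 - a)) = sin (pi * a)" using sin_pi_minus[of "pi * a"] by (simp add: algebra_simps)
  then show ?thesis using box_star_twisted(2)[OF \<gamma> c] c by (simp add: sector_weight_def)
qed

lemma sector_weight_nonzero: "\<gamma> \<in> twisted S \<Longrightarrow> sector_weight S \<gamma> \<noteq> 0"
proof -
  assume \<gamma>: "\<gamma> \<in> twisted S"
  then obtain i j a where c: "coords S \<gamma> = (i, j, a, 1 - a)" "0 < a" "a < 1" "i < j"
    by (rule twisted_coords)
  then have "0 < sin (pi * a)" by (intro sin_gt_zero) auto
  then show ?thesis using c by (simp add: sector_weight_def)
qed

lemma twisted_todd_weight:
  assumes \<gamma>: "\<gamma> \<in> twisted S"
  shows "1 / of_nat (card (box_cone (sector_cone S \<gamma>))) * Td_twisted S \<gamma> = 1 / sector_weight S \<gamma>"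
proof -
  obtain i j a where c: "coords S \<gamma> = (i, j, a, 1 - a)" "i < j" using twisted_coords[OF \<gamma>] by metis
  have "\<gamma> \<noteq> 0" using \<gamma> twisted_nonzero[of S] by auto
  then have "sector_cone S \<gamma> = {i, j}" using c by (simp add: sector_cone_def)
  moreover have "complex_of_nat (j - i) = of_real (real j - real i)" using c by (simp add: of_nat_diff)
  moreover have "Td_twisted S \<gamma> = 1 / complex_of_real (4 * (sin (pi * a))\<^sup>2)"
    using c(1) by (simp add: Td_twisted_def todd_denominator[of a, simplified])
  ultimately show ?thesis using c by (simp add: card_box_cone_pair sector_weight_def)
qed

section \<open>The spaces \<open>H\<close> and \<open>H\<^sup>c\<close>\<close>

lemma sector_sum_simps:
  "carrier (sector_sum V B) = carrier V \<times> {f. \<forall>\<gamma>. \<gamma> \<notin> B \<longrightarrow> f \<gamma> = 0}"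
  "zero (sector_sum V B) = (\<zero>\<^bsub>V\<^esub>, \<lambda>_. 0)"
  "add (sector_sum V B) = (\<lambda>x y. (fst x \<oplus>\<^bsub>V\<^esub> fst y, \<lambda>\<gamma>. snd x \<gamma> + snd y \<gamma>))"
  "smult (sector_sum V B) = (\<lambda>c x. (c \<odot>\<^bsub>V\<^esub> fst x, \<lambda>\<gamma>. c * snd x \<gamma>))"
  by (simp_all add: sector_sum_def)

lemma module_sector_sum:
  assumes "module CC V"
  shows "module CC (sector_sum V B)"
proof -
  interpret V: module CC V by fact
  show ?thesis
  proof (rule moduleI)
    show "abelian_group (sector_sum V B)"
    proof (rule abelian_groupI)
      show "\<exists>y\<in>carrier (sector_sum V B). y \<oplus>\<^bsub>sector_sum V B\<^esub> x = \<zero>\<^bsub>sector_sum V B\<^esub>"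
        if "x \<in> carrier (sector_sum V B)" for x
        by (rule bexI[of _ "(\<ominus>\<^bsub>V\<^esub> fst x, \<lambda>\<gamma>. - snd x \<gamma>)"])
          (use that in \<open>auto simp: sector_sum_simps V.l_neg\<close>)
    qed (auto simp: sector_sum_simps V.a_ac)
  qed (auto simp: sector_sum_simps cring_CC V.smult_l_distr[simplified] V.smult_r_distr
      V.smult_assoc1[simplified] V.smult_one[simplified] algebra_simps)
qed

text \<open>
  An element is its untwisted part plus a finite combination of the units of the sectors, which is
  built up one sector at a time.
\<close>

lemma sector_sum_spanned:
  assumes V: "module CC V" and B: "finite B"
    and span: "\<And>N. submodule N CC V \<Longrightarrow> X \<subseteq> N \<Longrightarrow> carrier V \<subseteq> N"
    and N: "submodule N CC (sector_sum V B)" "untwisted_elt ` X \<subseteq> N" "twisted_elt V ` B \<subseteq> N"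
    and X: "X \<subseteq> carrier V"
  shows "carrier (sector_sum V B) \<subseteq> N"
proof
  let ?U = "sector_sum V B"
  interpret V: module CC V by fact
  interpret U: module CC "sector_sum V B" by (rule module_sector_sum) fact
  note NE = U.submoduleE[OF N(1)] and N0 = U.submodule_zero[OF N(1)]
  interpret u: linear_map V "sector_sum V B" untwisted_elt
    by (rule linear_mapI)
      (auto simp: V.module_axioms U.module_axioms untwisted_elt_def sector_sum_simps)
  have untwisted: "untwisted_elt x \<in> N" if "x \<in> carrier V" for x
    using span[OF u.submodule_vimage[OF N(1)]] N(2) X that by blast
  fix x assume x: "x \<in> carrier (sector_sum V B)"
  have "(\<zero>\<^bsub>V\<^esub>, \<lambda>\<gamma>. if \<gamma> \<in> C then snd x \<gamma> else 0) \<in> N" if "C \<subseteq> B" for C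
    using finite_subset[OF that B] that
  proof (induction C rule: finite_induct)
    case empty
    then show ?case using N0 by (simp add: sector_sum_simps)
  next
    case (insert c C)
    let ?v = "(\<zero>\<^bsub>V\<^esub>, \<lambda>\<gamma>. if \<gamma> \<in> C then snd x \<gamma> else 0)"
    have "?v \<oplus>\<^bsub>?U\<^esub> snd x c \<odot>\<^bsub>?U\<^esub> twisted_elt V c \<in> N"
      using insert N(3) by (intro NE(4,5)) auto
    moreover have "?v \<oplus>\<^bsub>?U\<^esub> snd x c \<odot>\<^bsub>?U\<^esub> twisted_elt V c =
        (\<zero>\<^bsub>V\<^esub>, \<lambda>\<gamma>. if \<gamma> \<in> insert c C then snd x \<gamma> else 0)"
      using insert.hyps V.smult_r_null[of "snd x c"]
      by (auto simp: sector_sum_simps twisted_elt_def fun_eq_iff)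
    ultimately show ?case by simp
  qed
  from this[of B] have "untwisted_elt (fst x) \<oplus>\<^bsub>?U\<^esub> (\<zero>\<^bsub>V\<^esub>, \<lambda>\<gamma>. if \<gamma> \<in> B then snd x \<gamma> else 0) \<in> N"
    using x untwisted by (intro NE(5)) (auto simp: sector_sum_simps)
  moreover have "untwisted_elt (fst x) \<oplus>\<^bsub>?U\<^esub> (\<zero>\<^bsub>V\<^esub>, \<lambda>\<gamma>. if \<gamma> \<in> B then snd x \<gamma> else 0) = x"
    using x by (cases x) (auto simp: sector_sum_simps untwisted_elt_def fun_eq_iff)
  ultimately show "x \<in> N" by simp
qed

lemma linear_map_fst_sector_sum:
  assumes "module CC V"
  shows "linear_map (sector_sum V B) V fst"
  by (rule linear_mapI) (use assms in \<open>auto simp: module_sector_sum sector_sum_simps\<close>)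

lemma linear_map_snd_sector_sum:
  assumes "module CC V"
  shows "linear_map (sector_sum V B) CC (\<lambda>x. snd x \<gamma>)"
  by (rule linear_mapI) (use assms in \<open>auto simp: module_sector_sum module_CC sector_sum_simps\<close>)

lemma sector_sum_uminus:
  assumes "module CC V" "x \<in> carrier V"
  shows "\<ominus>\<^bsub>sector_sum V B\<^esub> untwisted_elt x = untwisted_elt (\<ominus>\<^bsub>V\<^esub> x)"
proof -
  interpret V: module CC V by fact
  interpret U: module CC "sector_sum V B" by (rule module_sector_sum) fact
  show ?thesis
    by (rule U.minus_equality) (use assms in \<open>auto simp: untwisted_elt_def sector_sum_simps V.l_neg\<close>)
qed

context fan
begin

abbreviation "H \<equiv> H_space S"
abbreviation "Hc \<equiv> Hc_space S"

lemma module_H: "module CC H" and module_Hc: "module CC Hc"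
  unfolding H_space_def Hc_space_def by (intro module_sector_sum module_H0 module_KC)+

sublocale two_spaces H Hc
  by (intro two_spaces.intro module_H module_Hc)

lemma H_closed [simp, intro]:
  "\<gamma> \<in> insert 0 (twisted S) \<Longrightarrow> unit_sector S \<gamma> \<in> carrier H" "i \<in> S \<Longrightarrow> D_elt S i \<in> carrier H"
  by (auto simp: H_space_def unit_sector_def D_elt_def untwisted_elt_def twisted_elt_def sector_sum_simps)

lemma Hc_closed [simp, intro]:
  "\<gamma> \<in> twisted S \<Longrightarrow> F_twisted S \<gamma> \<in> carrier Hc" "F_elt S \<in> carrier Hc"
  "k \<in> interior \<Longrightarrow> F_ray S k \<in> carrier Hc"
  using F0_closed gens_single KC.submodule_zero[OF KC.carrier_is_submodule]
  by (auto simp: Hc_space_def F_elt_def F_ray_def F_twisted_def untwisted_elt_def twisted_elt_def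
      sector_sum_simps KC_simps(1))

lemma H_spanned:
  assumes N: "submodule N CC H" "unit_sector S ` insert 0 (twisted S) \<subseteq> N" "D_elt S ` interior \<subseteq> N"
  shows "carrier H \<subseteq> N"
  unfolding H_space_def
proof (rule sector_sum_spanned[OF module_H0 finite_twisted H0_spanned_interior])
  show "untwisted_elt ` insert \<one>\<^bsub>H0 S\<^esub> (D0 S ` interior) \<subseteq> N"
    using N(2,3) by (auto simp: unit_sector_def D_elt_def image_subset_iff)
  show "twisted_elt (H0 S) ` twisted S \<subseteq> N"
  proof
    fix x assume "x \<in> twisted_elt (H0 S) ` twisted S"
    then obtain \<gamma> where \<gamma>: "\<gamma> \<in> twisted S" "x = twisted_elt (H0 S) \<gamma>" by blast
    moreover have "\<gamma> \<noteq> 0" using \<gamma> twisted_nonzero[of S] by auto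
    ultimately have "x = unit_sector S \<gamma>" by (simp add: unit_sector_def)
    then show "x \<in> N" using N(2) \<gamma> by auto
  qed
qed (use N(1) in \<open>auto simp: H_space_def\<close>)

lemma Hc_spanned:
  assumes N: "submodule N CC Hc" "F_elt S \<in> N" "F_ray S ` interior \<subseteq> N" "F_twisted S ` twisted S \<subseteq> N"
  shows "carrier Hc \<subseteq> N"
  unfolding Hc_space_def
proof (rule sector_sum_spanned[OF module_KC finite_twisted H0c_spanned])
  show "untwisted_elt ` insert (F0 S) ((\<lambda>k. FJ {k}) ` interior) \<subseteq> N"
    using N(2,3) by (auto simp: F_elt_def F_ray_def image_subset_iff)
  show "twisted_elt KC ` twisted S \<subseteq> N" using N(4) by (auto simp: F_twisted_def image_subset_iff)
  show "insert (F0 S) ((\<lambda>k. FJ {k}) ` interior) \<subseteq> carrier KC"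
    using F0_closed gens_single by (auto simp: KC_simps(1))
qed (use N(1) in \<open>auto simp: Hc_space_def\<close>)

section \<open>The Todd class and the involution\<close>

text \<open>
  The division of power series is exact here, since numerator and denominator have subdegree \<open>1\<close>. Comparing
  coefficients in \<open>todd_series * (1 - exp (- X)) = X\<close> gives the constant term.
\<close>

lemma todd_series_nth_0: "fps_nth todd_series 0 = 1"
proof -
  let ?f = "1 - fps_exp (-1) :: complex fps"
  have sub: "subdegree ?f = 1" by (rule subdegreeI) auto
  then have "?f dvd fps_X" using fps_dvd_iff[of ?f fps_X] by force
  then have "todd_series * ?f = fps_X"
    unfolding todd_series_def by (rule dvd_div_mult_self)
  then have "fps_nth (todd_series * ?f) 1 = 1" by simp
  then show ?thesis by (simp add: fps_mult_nth_1)
qed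

abbreviation todd_scalar :: "cpoly set" where
  "todd_scalar \<equiv> H0_class S (poly_const (fps_nth todd_series 1))"

text \<open>
  As \<open>D\<^sub>i\<^sup>2 = 0\<close>, only the first two terms of the series contribute. The sum in \<open>fps_at_nilpotent\<close> omits
  powers that vanish, among them \<open>D\<^sub>i\<close> itself when \<open>D\<^sub>i = 0\<close>; adding them changes nothing.
\<close>

lemma todd_D:
  assumes i: "i \<in> S"
  shows "fps_at_nilpotent A todd_series (D i) = \<one>\<^bsub>A\<^esub> \<oplus>\<^bsub>A\<^esub> todd_scalar \<otimes>\<^bsub>A\<^esub> D i"
proof -
  have pow1: "D i [^]\<^bsub>A\<^esub> (1::nat) = D i" using i by (simp add: D0_closed)
  have pow: "D i [^]\<^bsub>A\<^esub> k = \<zero>\<^bsub>A\<^esub>" if "k \<ge> 2" for k :: nat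
  proof -
    have "k = 2 + (k - 2)" using that by simp
    then have "D i [^]\<^bsub>A\<^esub> k = D i [^]\<^bsub>A\<^esub> (2::nat) \<otimes>\<^bsub>A\<^esub> D i [^]\<^bsub>A\<^esub> (k - 2)"
      using i A.nat_pow_mult[of "D i" 2 "k - 2"] by (simp add: D0_closed)
    also have "D i [^]\<^bsub>A\<^esub> (2::nat) = \<zero>\<^bsub>A\<^esub>" using i by (simp add: numeral_2_eq_2 D0_closed D0_mult)
    finally show ?thesis using i by (simp add: D0_closed)
  qed
  have "fps_at_nilpotent A todd_series (D i) =
      (\<Oplus>\<^bsub>A\<^esub>k\<in>{0, 1}. fps_nth todd_series k \<odot>\<^bsub>A\<^esub> (D i [^]\<^bsub>A\<^esub> (k::nat)))"
    unfolding fps_at_nilpotent_def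
  proof (rule A.add.finprod_mono_neutral_cong_left)
    show "{k. D i [^]\<^bsub>A\<^esub> k \<noteq> \<zero>\<^bsub>A\<^esub>} \<subseteq> {0, 1::nat}"
    proof
      fix k :: nat assume "k \<in> {k. D i [^]\<^bsub>A\<^esub> k \<noteq> \<zero>\<^bsub>A\<^esub>}"
      then have "\<not> k \<ge> 2" using pow by auto
      then show "k \<in> {0, 1}" by auto
    qed
  qed (use i in \<open>auto simp: D0_closed H0_simps(6)\<close>)
  also have "\<dots> = fps_nth todd_series 0 \<odot>\<^bsub>A\<^esub> \<one>\<^bsub>A\<^esub> \<oplus>\<^bsub>A\<^esub> fps_nth todd_series 1 \<odot>\<^bsub>A\<^esub> D i"
    using i AC.smult_closed by (simp add: D0_closed)
  finally show ?thesis
    using todd_series_nth_0 AC.smult_one[of "\<one>\<^bsub>A\<^esub>"] by (simp add: H0_simps(6))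
qed

lemma todd_product:
  assumes "finite B" "B \<subseteq> S"
  shows "(\<Otimes>\<^bsub>A\<^esub>i\<in>B. fps_at_nilpotent A todd_series (D i)) = \<one>\<^bsub>A\<^esub> \<oplus>\<^bsub>A\<^esub> todd_scalar \<otimes>\<^bsub>A\<^esub> (\<Oplus>\<^bsub>A\<^esub>i\<in>B. D i)"
  using assms
proof (induction B rule: finite_induct)
  case empty
  then show ?case by simp
next
  case (insert a B)
  let ?s = "\<Oplus>\<^bsub>A\<^esub>i\<in>B. D i"
  have t: "todd_scalar \<in> carrier A" by simp
  have a: "D a \<in> carrier A" and s: "?s \<in> carrier A"
    using insert.prems by (auto intro!: A.finsum_closed)
  have "D a \<otimes>\<^bsub>A\<^esub> ?s = (\<Oplus>\<^bsub>A\<^esub>i\<in>B. D a \<otimes>\<^bsub>A\<^esub> D i)"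
    using insert by (intro A.finsum_rdistr) auto
  also have "\<dots> = \<zero>\<^bsub>A\<^esub>"
    using insert.prems by (intro A.add.finprod_one_eqI) (auto simp: D0_mult)
  finally have "todd_scalar \<otimes>\<^bsub>A\<^esub> D a \<otimes>\<^bsub>A\<^esub> (todd_scalar \<otimes>\<^bsub>A\<^esub> ?s) = \<zero>\<^bsub>A\<^esub>"
    using t a s by (simp add: A.m_assoc A.m_lcomm)
  moreover have "(\<one>\<^bsub>A\<^esub> \<oplus>\<^bsub>A\<^esub> x) \<otimes>\<^bsub>A\<^esub> (\<one>\<^bsub>A\<^esub> \<oplus>\<^bsub>A\<^esub> y) = \<one>\<^bsub>A\<^esub> \<oplus>\<^bsub>A\<^esub> (x \<oplus>\<^bsub>A\<^esub> y) \<oplus>\<^bsub>A\<^esub> x \<otimes>\<^bsub>A\<^esub> y"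
    if "x \<in> carrier A" "y \<in> carrier A" for x y
    using that by (simp add: A.l_distr A.r_distr A.a_ac)
  moreover have "(\<Oplus>\<^bsub>A\<^esub>i\<in>insert a B. D i) = D a \<oplus>\<^bsub>A\<^esub> ?s"
    using insert by (intro A.finsum_insert) auto
  moreover have "(\<Otimes>\<^bsub>A\<^esub>i\<in>insert a B. fps_at_nilpotent A todd_series (D i)) =
      (\<one>\<^bsub>A\<^esub> \<oplus>\<^bsub>A\<^esub> todd_scalar \<otimes>\<^bsub>A\<^esub> D a) \<otimes>\<^bsub>A\<^esub> (\<one>\<^bsub>A\<^esub> \<oplus>\<^bsub>A\<^esub> todd_scalar \<otimes>\<^bsub>A\<^esub> ?s)"
    using insert t a s by (subst A.finprod_insert) (auto simp: todd_D)
  ultimately show ?case using t a s by (simp add: A.r_distr)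
qed

lemma Td0_eq_one: "Td0 S = \<one>\<^bsub>A\<^esub>"
  unfolding Td0_def using todd_product[OF fan_finite] by (simp add: D0_sum)

text \<open>
  The linear map with \<open>1 \<mapsto> 1\<close> and \<open>D\<^sub>i \<mapsto> - D\<^sub>i\<close>: it is \<open>X \<mapsto> \<epsilon>(X) - (X - \<epsilon>(X))\<close> with the augmentation \<open>\<epsilon>\<close>.
\<close>

definition involution0 :: "cpoly set \<Rightarrow> cpoly set" where
  "involution0 X = (2 * augmentation X) \<odot>\<^bsub>A\<^esub> \<one>\<^bsub>A\<^esub> \<ominus>\<^bsub>A\<^esub> X"

lemma linear_map_involution0: "linear_map A A involution0"
proof -
  interpret a: linear_map A CC augmentation by (rule linear_map_augmentation)
  show ?thesis
  proof (rule linear_mapI)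
    show "involution0 (X \<oplus>\<^bsub>A\<^esub> Y) = involution0 X \<oplus>\<^bsub>A\<^esub> involution0 Y"
      if "X \<in> carrier A" "Y \<in> carrier A" for X Y
      using that AC.smult_l_distr[of "2 * augmentation X" "2 * augmentation Y" "\<one>\<^bsub>A\<^esub>"]
        AC.smult_closed[of "2 * augmentation X" "\<one>\<^bsub>A\<^esub>"] AC.smult_closed[of "2 * augmentation Y" "\<one>\<^bsub>A\<^esub>"]
      by (simp add: involution0_def a.add distrib_left a_minus_def A.minus_add A.a_ac)
    show "involution0 (c \<odot>\<^bsub>A\<^esub> X) = c \<odot>\<^bsub>A\<^esub> involution0 X" if "X \<in> carrier A" for c X
      using that AC.smult_assoc1[of c "2 * augmentation X" "\<one>\<^bsub>A\<^esub>"]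
        AC.smult_closed[of "2 * augmentation X" "\<one>\<^bsub>A\<^esub>"]
        AC.smult_r_distr[of c "(2 * augmentation X) \<odot>\<^bsub>A\<^esub> \<one>\<^bsub>A\<^esub>" "\<ominus>\<^bsub>A\<^esub> X"] AC.smult_r_minus[of c X]
      by (simp add: involution0_def a.smult a_minus_def mult.left_commute)
  qed (auto simp: module_H0 involution0_def AC.smult_closed intro!: A.minus_closed)
qed

lemma involution0_one: "involution0 \<one>\<^bsub>A\<^esub> = \<one>\<^bsub>A\<^esub>"
proof -
  have "2 \<odot>\<^bsub>A\<^esub> \<one>\<^bsub>A\<^esub> = \<one>\<^bsub>A\<^esub> \<oplus>\<^bsub>A\<^esub> \<one>\<^bsub>A\<^esub>"
    using AC.smult_l_distr[of 1 1 "\<one>\<^bsub>A\<^esub>"] AC.smult_one[of "\<one>\<^bsub>A\<^esub>"] by simp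
  then show ?thesis by (simp add: involution0_def a_minus_def A.a_assoc A.r_neg)
qed

lemma involution0_D: "i \<in> S \<Longrightarrow> involution0 (D i) = \<ominus>\<^bsub>A\<^esub> D i"
  using AC.smult_l_null[of "\<one>\<^bsub>A\<^esub>"] by (simp add: involution0_def a_minus_def D0_closed)

definition involution_map :: "H_elt \<Rightarrow> H_elt" where
  "involution_map x = (involution0 (fst x), \<lambda>\<gamma>. if \<gamma> \<in> twisted S then snd x (box_star S \<gamma>) else 0)"

lemma linear_map_involution_map: "linear_map H H involution_map"
proof -
  interpret i: linear_map A A involution0 by (rule linear_map_involution0)
  show ?thesis
    by (rule linear_mapI[OF module_H module_H])
      (auto simp: involution_map_def H_space_def sector_sum_simps i.add i.smult)
qed

lemma involution_map_unit:
  assumes "\<gamma> \<in> insert 0 (twisted S)"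
  shows "involution_map (unit_sector S \<gamma>) = unit_sector S (box_star S \<gamma>)"
proof (cases "\<gamma> = 0")
  case True
  then show ?thesis
    by (auto simp: involution_map_def unit_sector_def untwisted_elt_def involution0_one fun_eq_iff)
next
  case False
  then have \<gamma>: "\<gamma> \<in> twisted S" using assms by simp
  then have "box_star S \<gamma> \<noteq> 0" using box_star_in_twisted twisted_nonzero by metis
  have "(if \<delta> \<in> twisted S then if box_star S \<delta> = \<gamma> then 1 else 0 else 0) =
      (if \<delta> = box_star S \<gamma> then 1 else 0 :: complex)" for \<delta>
  proof -
    have "(\<delta> \<in> twisted S \<and> box_star S \<delta> = \<gamma>) = (\<delta> = box_star S \<gamma>)"
      using \<gamma> box_star_in_twisted box_star_involutive by metis
    then show ?thesis by presburger
  qed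
  then show ?thesis
    using linear_map.zero[OF linear_map_involution0]
    unfolding involution_map_def unit_sector_def twisted_elt_def
      if_not_P[OF False] if_not_P[OF \<open>box_star S \<gamma> \<noteq> 0\<close>] fst_conv snd_conv
    by simp
qed

lemma involution_map_D:
  assumes "i \<in> S"
  shows "involution_map (D_elt S i) = \<ominus>\<^bsub>H\<^esub> D_elt S i"
proof -
  have "\<ominus>\<^bsub>H\<^esub> D_elt S i = untwisted_elt (\<ominus>\<^bsub>A\<^esub> D i)"
    unfolding H_space_def D_elt_def by (rule sector_sum_uminus) (use assms in \<open>auto simp: module_H0\<close>)
  then show ?thesis using assms
    by (auto simp: involution_map_def D_elt_def untwisted_elt_def involution0_D fun_eq_iff)
qed

lemma involution_eq:
  assumes "x \<in> carrier H"
  shows "involution S x = involution_map x"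
proof -
  let ?R = "restrict involution_map (carrier H)"
  let ?X = "unit_sector S ` insert 0 (twisted S) \<union> D_elt S ` interior"
  have X: "?X \<subseteq> carrier H" by auto
  have span: "carrier H \<subseteq> submodule_generated CC H ?X"
    using plain_module.submodule_generated_submodule[OF plain_module.intro[OF module_H] X]
      plain_module.submodule_generated_incl[OF plain_module.intro[OF module_H], of ?X]
    by (intro H_spanned) auto
  interpret i: linear_map H H involution_map by (rule linear_map_involution_map)
  have "involution S = ?R"
    unfolding involution_def
  proof (rule the_equality)
    show "?R \<in> linear_maps H H \<and>
        (\<forall>\<gamma>\<in>insert 0 (twisted S). ?R (unit_sector S \<gamma>) = unit_sector S (box_star S \<gamma>)) \<and>
        (\<forall>i\<in>S. ?R (D_elt S i) = \<ominus>\<^bsub>H\<^esub> D_elt S i)"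
      using i.in_linear_maps involution_map_unit involution_map_D by auto
    fix f assume f: "f \<in> linear_maps H H \<and>
        (\<forall>\<gamma>\<in>insert 0 (twisted S). f (unit_sector S \<gamma>) = unit_sector S (box_star S \<gamma>)) \<and>
        (\<forall>i\<in>S. f (D_elt S i) = \<ominus>\<^bsub>H\<^esub> D_elt S i)"
    have lf: "linear_map H H f"
      by (rule linear_mapI_linear_maps) (use f in \<open>auto simp: module_H\<close>)
    have "f y = involution_map y" if "y \<in> carrier H" for y
    proof (rule linear_map_eq_on_span[OF lf linear_map_involution_map X span _ that])
      show "f z = involution_map z" if "z \<in> ?X" for z
        using that
      proof (elim UnE imageE)
        show "f z = involution_map z" if "z = unit_sector S \<gamma>" "\<gamma> \<in> insert 0 (twisted S)" for \<gamma>
          using f that involution_map_unit[OF that(2)] by metis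
        show "f z = involution_map z" if "z = D_elt S i" "i \<in> interior" for i
          using f that involution_map_D[of i] by simp
      qed
    qed
    then show "f = ?R"
      using f by (intro ext) (auto simp: linear_maps_def PiE_def extensional_def)
  qed
  then show ?thesis using assms by simp
qed

end

section \<open>The Euler characteristic pairing on bases\<close>

text \<open>
  The Green's function of minus the second derivative on the interval from \<open>0\<close> to \<open>n\<close>, with zero boundary values.
\<close>

definition green :: "nat \<Rightarrow> nat \<Rightarrow> nat \<Rightarrow> real" where
  "green n k l = real (min k l) * (real n - real (max k l)) / real n"

lemma green_sym: "green n k l = green n l k"
  by (simp add: green_def min.commute max.commute)

lemma weight_sym: "weight S k i = weight S i k"
  by (cases "i = k") (auto simp: weight_def adjacent_sym abs_minus_commute)

lemma (in abelian_monoid) finsum_Times: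
  assumes "finite A" "finite B" "\<And>a b. a \<in> A \<Longrightarrow> b \<in> B \<Longrightarrow> f (a, b) \<in> carrier G"
  shows "(\<Oplus>p\<in>A \<times> B. f p) = (\<Oplus>a\<in>A. \<Oplus>b\<in>B. f (a, b))"
  using assms(1,3)
proof (induction A rule: finite_induct)
  case (insert a A)
  have eq: "insert a A \<times> B = Pair a ` B \<union> A \<times> B" by auto
  have "(\<Oplus>p\<in>Pair a ` B \<union> A \<times> B. f p) = (\<Oplus>p\<in>Pair a ` B. f p) \<oplus> (\<Oplus>p\<in>A \<times> B. f p)"
    by (rule finsum_Un_disjoint) (use insert assms(2) in auto)
  also have "(\<Oplus>p\<in>Pair a ` B. f p) = (\<Oplus>b\<in>B. f (a, b))"
    by (rule finsum_reindex) (use insert in \<open>auto simp: inj_on_def\<close>)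
  finally show ?case unfolding eq using insert by (simp add: Pi_def)
qed (simp add: finsum_empty)

lemma (in module) finsum_smult_matrix:
  assumes "finite I" "finite J" "\<And>j. j \<in> J \<Longrightarrow> v j \<in> carrier M"
    "\<And>i. i \<in> I \<Longrightarrow> c i \<in> carrier R" "\<And>i j. i \<in> I \<Longrightarrow> j \<in> J \<Longrightarrow> g i j \<in> carrier R"
  shows "(\<Oplus>\<^bsub>M\<^esub>i\<in>I. c i \<odot>\<^bsub>M\<^esub> (\<Oplus>\<^bsub>M\<^esub>j\<in>J. g i j \<odot>\<^bsub>M\<^esub> v j)) =
    (\<Oplus>\<^bsub>M\<^esub>j\<in>J. (\<Oplus>\<^bsub>R\<^esub>i\<in>I. c i \<otimes>\<^bsub>R\<^esub> g i j) \<odot>\<^bsub>M\<^esub> v j)"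
  using assms(1,4,5)
proof (induction I rule: finite_induct)
  case empty
  have "(\<Oplus>\<^bsub>M\<^esub>j\<in>J. \<zero>\<^bsub>R\<^esub> \<odot>\<^bsub>M\<^esub> v j) = \<zero>\<^bsub>M\<^esub>"
    by (rule M.add.finprod_one_eqI) (use assms(3) in auto)
  then show ?case by simp
next
  case (insert a I)
  have 1: "c a \<odot>\<^bsub>M\<^esub> (\<Oplus>\<^bsub>M\<^esub>j\<in>J. g a j \<odot>\<^bsub>M\<^esub> v j) = (\<Oplus>\<^bsub>M\<^esub>j\<in>J. (c a \<otimes>\<^bsub>R\<^esub> g a j) \<odot>\<^bsub>M\<^esub> v j)"
    using insert.prems assms(2,3)
    by (subst finsum_smult_ldistr, simp, simp, force, intro M.finsum_cong'[OF refl])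
      (auto simp: smult_assoc1)
  have closed: "(\<Oplus>\<^bsub>R\<^esub>i\<in>I. c i \<otimes>\<^bsub>R\<^esub> g i j) \<in> carrier R" if "j \<in> J" for j
    using insert.prems that by (intro R.finsum_closed) auto
  have "(\<Oplus>\<^bsub>M\<^esub>i\<in>insert a I. c i \<odot>\<^bsub>M\<^esub> (\<Oplus>\<^bsub>M\<^esub>j\<in>J. g i j \<odot>\<^bsub>M\<^esub> v j)) =
      c a \<odot>\<^bsub>M\<^esub> (\<Oplus>\<^bsub>M\<^esub>j\<in>J. g a j \<odot>\<^bsub>M\<^esub> v j) \<oplus>\<^bsub>M\<^esub>
      (\<Oplus>\<^bsub>M\<^esub>i\<in>I. c i \<odot>\<^bsub>M\<^esub> (\<Oplus>\<^bsub>M\<^esub>j\<in>J. g i j \<odot>\<^bsub>M\<^esub> v j))"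
    by (rule M.finsum_insert)
      (use insert assms(3) in \<open>auto intro!: smult_closed M.finsum_closed\<close>)
  also have "\<dots> = (\<Oplus>\<^bsub>M\<^esub>j\<in>J. (c a \<otimes>\<^bsub>R\<^esub> g a j) \<odot>\<^bsub>M\<^esub> v j) \<oplus>\<^bsub>M\<^esub>
      (\<Oplus>\<^bsub>M\<^esub>j\<in>J. (\<Oplus>\<^bsub>R\<^esub>i\<in>I. c i \<otimes>\<^bsub>R\<^esub> g i j) \<odot>\<^bsub>M\<^esub> v j)"
    using insert.IH insert.prems by (simp add: 1)
  also have "\<dots> = (\<Oplus>\<^bsub>M\<^esub>j\<in>J. (c a \<otimes>\<^bsub>R\<^esub> g a j) \<odot>\<^bsub>M\<^esub> v j \<oplus>\<^bsub>M\<^esub>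
      (\<Oplus>\<^bsub>R\<^esub>i\<in>I. c i \<otimes>\<^bsub>R\<^esub> g i j) \<odot>\<^bsub>M\<^esub> v j)"
    by (rule M.finsum_addf[symmetric]) (use insert.prems closed assms(3) in auto)
  also have "\<dots> = (\<Oplus>\<^bsub>M\<^esub>j\<in>J. (\<Oplus>\<^bsub>R\<^esub>i\<in>insert a I. c i \<otimes>\<^bsub>R\<^esub> g i j) \<odot>\<^bsub>M\<^esub> v j)"
  proof (rule M.finsum_cong'[OF refl])
    show "(c a \<otimes>\<^bsub>R\<^esub> g a j) \<odot>\<^bsub>M\<^esub> v j \<oplus>\<^bsub>M\<^esub> (\<Oplus>\<^bsub>R\<^esub>i\<in>I. c i \<otimes>\<^bsub>R\<^esub> g i j) \<odot>\<^bsub>M\<^esub> v j =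
        (\<Oplus>\<^bsub>R\<^esub>i\<in>insert a I. c i \<otimes>\<^bsub>R\<^esub> g i j) \<odot>\<^bsub>M\<^esub> v j" if "j \<in> J" for j
      using insert.hyps insert.prems closed[OF that] assms(3)[OF that] that
      by (subst R.finsum_insert) (auto simp: smult_l_distr)
  qed (use insert closed assms(3) in \<open>auto intro!: smult_closed R.finsum_closed\<close>)
  finally show ?case .
qed

context fan
begin

text \<open>
  As a function of \<open>i\<close>, the Green's function is linear on either side of \<open>m\<close>, with slopes \<open>(n - m) / n\<close> and
  \<open>- m / n\<close>. By \<open>sum_weight\<close> the sum is zero unless \<open>k = m\<close>, where the slopes differ by \<open>-1\<close>.
\<close>

lemma green_weight:
  assumes k: "k \<in> interior" and m: "m \<in> interior"
  shows "(\<Sum>i\<in>interior. weight S k i * of_real (green n m i)) = (if k = m then -1 else 0)"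
proof -
  obtain p s where ps: "consecutive S p k" "consecutive S k s" "p < k" "k < s"
    using interior_neighbours[OF k] by metis
  have n: "real n \<noteq> 0" using n_pos by simp
  have m': "m \<in> S" "m \<le> n" using m fan_le by auto
  let ?slope = "\<lambda>a b. (green n m a - green n m b) / (real b - real a)"
  have slope_left: "?slope a b = - (1 - real m / real n)" if "a < b" "b \<le> m" for a b
  proof -
    have "green n m a - green n m b = - (1 - real m / real n) * (real b - real a)"
      using that n by (simp add: green_def min_absorb2 max_absorb1 field_simps)
    then show ?thesis using that by simp
  qed
  have slope_right: "?slope a b = real m / real n" if "a < b" "m \<le> a" for a b
  proof -
    have "green n m a - green n m b = (real m / real n) * (real b - real a)"
      using that n by (simp add: green_def min_absorb1 max_absorb2 field_simps)
    then show ?thesis using that by simp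
  qed
  have "(green n m p - green n m k) / (real k - real p) + (green n m s - green n m k) / (real s - real k) =
      ?slope p k - ?slope k s"
    by (simp add: diff_divide_distrib)
  also have "\<dots> = (if k = m then -1 else 0)"
  proof (cases k m rule: linorder_cases)
    case less
    then have "s \<le> m" using ps(2) m' by (auto simp: consecutive_def not_less[symmetric])
    then show ?thesis using less slope_left[OF ps(3)] slope_left[OF ps(4)] by simp
  next
    case equal
    then show ?thesis using slope_left[OF ps(3)] slope_right[OF ps(4)] by simp
  next
    case greater
    then have "m \<le> p" using ps(1) m' by (auto simp: consecutive_def not_less[symmetric])
    then show ?thesis using greater slope_right[OF ps(3)] slope_right[OF ps(4)] by simp
  qed
  finally have "complex_of_real ((green n m p - green n m k) / (real k - real p) +
      (green n m s - green n m k) / (real s - real k)) = (if k = m then -1 else 0)"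
    by simp
  moreover have "(\<Sum>i\<in>interior. weight S k i * of_real (green n m i)) =
      (\<Sum>i\<in>S. weight S k i * of_real (green n m i))"
    by (rule sum.mono_neutral_left) (use fan_finite m' in \<open>auto simp: green_def\<close>)
  ultimately show ?thesis
    using sum_weight[OF k ps(1,2), of "\<lambda>i. of_real (green n m i)"] by simp
qed

lemma fst_closed: "x \<in> carrier H \<Longrightarrow> fst x \<in> carrier A" "y \<in> carrier Hc \<Longrightarrow> fst y \<in> carrier K"
  by (auto simp: H_space_def Hc_space_def sector_sum_simps KC_simps(1))

lemma euler_pairing_eq:
  assumes "x \<in> carrier H" "y \<in> carrier Hc"
  shows "euler_pairing S x y = integral0 S (involution0 (fst x) \<star> fst y) +
    (\<Sum>\<gamma>\<in>twisted S. snd x (box_star S \<gamma>) * snd y \<gamma> / sector_weight S \<gamma>)"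
proof -
  have "involution0 (fst x) \<in> carrier A"
    using linear_map.closed[OF linear_map_involution0] fst_closed assms by blast
  moreover have "(\<Sum>\<gamma>\<in>twisted S. 1 / of_nat (card (box_cone (sector_cone S \<gamma>))) *
        (Td_twisted S \<gamma> * snd (involution S x) \<gamma> * snd y \<gamma>)) =
      (\<Sum>\<gamma>\<in>twisted S. snd x (box_star S \<gamma>) * snd y \<gamma> / sector_weight S \<gamma>)"
  proof (rule sum.cong)
    fix \<gamma> assume \<gamma>: "\<gamma> \<in> twisted S"
    have "1 / of_nat (card (box_cone (sector_cone S \<gamma>))) *
        (Td_twisted S \<gamma> * snd (involution S x) \<gamma> * snd y \<gamma>) =
      (1 / of_nat (card (box_cone (sector_cone S \<gamma>))) * Td_twisted S \<gamma>) *
        (snd (involution S x) \<gamma> * snd y \<gamma>)" by (simp only: mult.assoc)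
    then show "1 / of_nat (card (box_cone (sector_cone S \<gamma>))) *
        (Td_twisted S \<gamma> * snd (involution S x) \<gamma> * snd y \<gamma>) =
      snd x (box_star S \<gamma>) * snd y \<gamma> / sector_weight S \<gamma>"
      using \<gamma> assms unfolding twisted_todd_weight[OF \<gamma>]
      by (simp add: involution_eq involution_map_def)
  qed simp
  ultimately show ?thesis
    using assms unfolding euler_pairing_def
    by (simp add: sector_cone_def card_box_cone_empty Td0_eq_one involution_eq involution_map_def)
qed

lemma linear_map_euler_right:
  assumes x: "x \<in> carrier H"
  shows "linear_map Hc CC (euler_pairing S x)"
proof (rule linear_map_cong)
  have inv: "involution0 (fst x) \<in> carrier A"
    using linear_map.closed[OF linear_map_involution0] fst_closed x by blast
  show "linear_map Hc CC (\<lambda>y. integral0 S (involution0 (fst x) \<star> fst y) +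
      (\<Oplus>\<^bsub>CC\<^esub>\<gamma>\<in>twisted S. snd y \<gamma> \<odot>\<^bsub>CC\<^esub> (snd x (box_star S \<gamma>) / sector_weight S \<gamma>)))"
    unfolding Hc_space_def
    by (intro linear_map_CC_add linear_map_finsum module_sector_sum module_KC module_CC
        linear_map_comp[OF linear_map_comp[OF linear_map_fst_sector_sum[OF module_KC]
          linear_map_action_right[OF inv]] linear_map_integral0]
        linear_map_comp[OF linear_map_snd_sector_sum[OF module_KC] linear_map_smult_left]) simp
qed (use x in \<open>simp add: euler_pairing_eq mult.commute\<close>)

lemma linear_map_euler_left:
  assumes y: "y \<in> carrier Hc"
  shows "linear_map H CC (\<lambda>x. euler_pairing S x y)"
proof (rule linear_map_cong)
  show "linear_map H CC (\<lambda>x. integral0 S (involution0 (fst x) \<star> fst y) +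
      (\<Oplus>\<^bsub>CC\<^esub>\<gamma>\<in>twisted S. snd x (box_star S \<gamma>) \<odot>\<^bsub>CC\<^esub> (snd y \<gamma> / sector_weight S \<gamma>)))"
    unfolding H_space_def
    by (intro linear_map_CC_add linear_map_finsum module_sector_sum module_H0 module_CC
        linear_map_comp[OF linear_map_comp[OF linear_map_comp[OF
          linear_map_fst_sector_sum[OF module_H0] linear_map_involution0]
          linear_map_action_left[OF fst_closed(2)[OF y]]] linear_map_integral0]
        linear_map_comp[OF linear_map_snd_sector_sum[OF module_H0] linear_map_smult_left]) simp
qed (use y in \<open>simp add: euler_pairing_eq\<close>)

lemma involution0_functionals:
  assumes "X \<in> carrier A"
  shows "augmentation (involution0 X) = augmentation X"
    and "k \<in> interior \<Longrightarrow> derivation S (weight S k) (involution0 X) = - derivation S (weight S k) X"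
proof -
  have one: "(2 * augmentation X) \<odot>\<^bsub>A\<^esub> \<one>\<^bsub>A\<^esub> \<in> carrier A" by (rule AC.smult_closed) auto
  interpret a: linear_map A CC augmentation by (rule linear_map_augmentation)
  show "augmentation (involution0 X) = augmentation X"
    using assms one by (simp add: involution0_def a.minus a.smult) (simp add: a_minus_def)
  assume k: "k \<in> interior"
  interpret d: linear_map A CC "derivation S (weight S k)" by (rule linear_map_derivation[OF k])
  have "derivation S (weight S k) \<one>\<^bsub>A\<^esub> = 0"
    using derivation_simps(1)[OF descending_weight[OF k] fan_finite] .
  then show "derivation S (weight S k) (involution0 X) = - derivation S (weight S k) X"
    using assms one by (simp add: involution0_def d.minus d.smult) (simp add: a_minus_def)
qed

lemma euler_pairing_F:
  assumes x: "x \<in> carrier H"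
  shows "euler_pairing S x (F_elt S) = augmentation (fst x)"
    and "k \<in> interior \<Longrightarrow> euler_pairing S x (F_ray S k) = - derivation S (weight S k) (fst x)"
    and "\<gamma> \<in> twisted S \<Longrightarrow>
      euler_pairing S x (F_twisted S \<gamma>) = snd x (box_star S \<gamma>) / sector_weight S \<gamma>"
proof -
  have inv: "involution0 (fst x) \<in> carrier A"
    using linear_map.closed[OF linear_map_involution0] fst_closed x by blast
  show "euler_pairing S x (F_elt S) = augmentation (fst x)"
    using euler_pairing_eq[OF x Hc_closed(2)] integral0_action(1)[OF inv]
      involution0_functionals(1)[OF fst_closed(1)[OF x]]
    by (simp add: F_elt_def untwisted_elt_def)
  show "euler_pairing S x (F_ray S k) = - derivation S (weight S k) (fst x)" if k: "k \<in> interior"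
    using euler_pairing_eq[OF x Hc_closed(3)[OF k]] integral0_action(2)[OF inv k]
      involution0_functionals(2)[OF fst_closed(1)[OF x] k]
    by (simp add: F_ray_def untwisted_elt_def)
  assume \<gamma>: "\<gamma> \<in> twisted S"
  have "involution0 (fst x) \<star> \<zero>\<^bsub>KC\<^esub> = \<zero>\<^bsub>KC\<^esub>"
    by (rule linear_map.zero[OF linear_map_action_right[OF inv]])
  moreover have "integral0 S \<zero>\<^bsub>KC\<^esub> = 0"
    using linear_map.zero[OF linear_map_integral0] by simp
  moreover have "(\<Sum>\<delta>\<in>twisted S. snd x (box_star S \<delta>) * (if \<delta> = \<gamma> then 1 else 0) / sector_weight S \<delta>) =
      (\<Sum>\<delta>\<in>twisted S. if \<delta> = \<gamma> then snd x (box_star S \<gamma>) / sector_weight S \<gamma> else 0)"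
    by (rule sum.cong) auto
  ultimately show "euler_pairing S x (F_twisted S \<gamma>) = snd x (box_star S \<gamma>) / sector_weight S \<gamma>"
    using euler_pairing_eq[OF x Hc_closed(1)[OF \<gamma>]] \<gamma> finite_twisted
    by (simp add: F_twisted_def twisted_elt_def)
qed

section \<open>Dual bases\<close>

definition basis_index :: "(real \<times> real + nat) set" where
  "basis_index = Inl ` insert 0 (twisted S) \<union> Inr ` interior"

definition H_basis :: "real \<times> real + nat \<Rightarrow> H_elt" where
  "H_basis b = (case b of Inl \<gamma> \<Rightarrow> unit_sector S \<gamma> | Inr k \<Rightarrow> D_elt S k)"

text \<open>
  The second tensor factors of the asserted inverse, grouped by their first factors.
\<close>

definition Hc_basis :: "real \<times> real + nat \<Rightarrow> Hc_elt" where
  "Hc_basis b = (case b of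
     Inl \<gamma> \<Rightarrow> if \<gamma> = 0 then F_elt S else sector_weight S \<gamma> \<odot>\<^bsub>Hc\<^esub> F_twisted S (box_star S \<gamma>)
   | Inr k \<Rightarrow> \<Oplus>\<^bsub>Hc\<^esub>l\<in>interior. of_real (green n k l) \<odot>\<^bsub>Hc\<^esub> F_ray S l)"

lemma H_basis_closed: "b \<in> basis_index \<Longrightarrow> H_basis b \<in> carrier H"
  by (auto simp: basis_index_def H_basis_def)

lemma Hc_basis_closed: "b \<in> basis_index \<Longrightarrow> Hc_basis b \<in> carrier Hc"
  by (auto simp: basis_index_def Hc_basis_def box_star_in_twisted
      intro!: W.finsum_closed W.smult_closed)

lemma euler_pairing_Hc_basis:
  assumes x: "x \<in> carrier H"
  shows "euler_pairing S x (Hc_basis (Inl 0)) = augmentation (fst x)"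
    and "\<gamma> \<in> twisted S \<Longrightarrow> euler_pairing S x (Hc_basis (Inl \<gamma>)) = snd x \<gamma>"
    and "k \<in> interior \<Longrightarrow> euler_pairing S x (Hc_basis (Inr k)) =
      - (\<Sum>l\<in>interior. of_real (green n k l) * derivation S (weight S l) (fst x))"
proof -
  interpret e: linear_map Hc CC "euler_pairing S x" by (rule linear_map_euler_right[OF x])
  show "euler_pairing S x (Hc_basis (Inl 0)) = augmentation (fst x)"
    by (simp add: Hc_basis_def euler_pairing_F x)
  show "euler_pairing S x (Hc_basis (Inl \<gamma>)) = snd x \<gamma>" if \<gamma>: "\<gamma> \<in> twisted S"
  proof -
    have "\<gamma> \<noteq> 0" using \<gamma> twisted_nonzero[of S] by auto
    then show ?thesis using \<gamma> x sector_weight_nonzero[OF \<gamma>]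
      by (simp add: Hc_basis_def e.smult box_star_in_twisted euler_pairing_F box_star_involutive
          sector_weight_star)
  qed
  show "euler_pairing S x (Hc_basis (Inr k)) =
      - (\<Sum>l\<in>interior. of_real (green n k l) * derivation S (weight S l) (fst x))" if "k \<in> interior"
  proof -
    have "euler_pairing S x (Hc_basis (Inr k)) =
        (\<Sum>l\<in>interior. euler_pairing S x (of_real (green n k l) \<odot>\<^bsub>Hc\<^esub> F_ray S l))"
      unfolding Hc_basis_def by (simp, subst e.finsum) auto
    also have "\<dots> = (\<Sum>l\<in>interior. - (of_real (green n k l) * derivation S (weight S l) (fst x)))"
      using x by (intro sum.cong) (simp_all add: e.smult euler_pairing_F)
    finally show ?thesis by (simp add: sum_negf)
  qed
qed

text \<open>
  Within the untwisted sector \<open>\<epsilon>\<close> separates \<open>1\<close> from the \<open>D\<^sub>k\<close>, and for the \<open>D\<^sub>k\<close> the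
  assertion is that the Green's function inverts the Laplacian.
\<close>

lemma biorthogonal_basis:
  assumes "b \<in> basis_index" "b' \<in> basis_index"
  shows "euler_pairing S (H_basis b) (Hc_basis b') = (if b = b' then 1 else 0)"
proof -
  have x: "H_basis b \<in> carrier H" using assms(1) by (rule H_basis_closed)
  have cases: "b = Inl 0 \<or> (\<exists>\<gamma>\<in>twisted S. b = Inl \<gamma> \<and> \<gamma> \<noteq> 0) \<or> (\<exists>m\<in>interior. b = Inr m)"
    if "b \<in> basis_index" for b
    using that twisted_nonzero[of S] unfolding basis_index_def by blast
  have zero: "augmentation \<zero>\<^bsub>A\<^esub> = 0" "l \<in> interior \<Longrightarrow> derivation S (weight S l) \<zero>\<^bsub>A\<^esub> = 0" for l
    using linear_map.zero[OF linear_map_augmentation] linear_map.zero[OF linear_map_derivation] by auto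
  have der: "derivation S (weight S l) \<one>\<^bsub>A\<^esub> = 0"
    "m \<in> S \<Longrightarrow> derivation S (weight S l) (D m) = weight S l m" if "l \<in> interior" for l m
    using derivation_simps[OF descending_weight[OF that] fan_finite] by auto
  have green: "- (\<Sum>l\<in>interior. of_real (green n k l) * derivation S (weight S l) (D m)) =
      (if m = k then 1 else 0)" if "k \<in> interior" "m \<in> interior" for k m
  proof -
    have "(\<Sum>l\<in>interior. of_real (green n k l) * derivation S (weight S l) (D m)) =
        (\<Sum>l\<in>interior. weight S m l * of_real (green n k l))"
    proof (rule sum.cong)
      fix l assume "l \<in> interior"
      moreover have "m \<in> S" using that by simp
      ultimately show "of_real (green n k l) * derivation S (weight S l) (D m) =
          weight S m l * of_real (green n k l)"
        by (simp add: der(2) weight_sym[of S l m])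
    qed simp
    then show ?thesis using green_weight[OF that(2,1)] by simp
  qed
  have vanish: "- (\<Sum>l\<in>interior. of_real (green n k l) * derivation S (weight S l) X) = 0"
    if X: "X = \<zero>\<^bsub>A\<^esub> \<or> X = \<one>\<^bsub>A\<^esub>" for k X
  proof -
    have "derivation S (weight S l) X = 0" if "l \<in> interior" for l
      using X zero(2)[OF that] der(1)[OF that] by auto
    then show ?thesis by simp
  qed
  from cases[OF assms(1)] show ?thesis
  proof (elim disjE bexE conjE)
    assume b: "b = Inl 0"
    have val: "H_basis b = (\<one>\<^bsub>A\<^esub>, \<lambda>_. 0)" by (simp add: b H_basis_def unit_sector_def untwisted_elt_def)
    show ?thesis using cases[OF assms(2)] euler_pairing_Hc_basis[OF x] twisted_nonzero[of S]
      unfolding val by (auto simp: b vanish)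
  next
    fix \<gamma> assume b: "\<gamma> \<in> twisted S" "b = Inl \<gamma>" "\<gamma> \<noteq> 0"
    have val: "H_basis b = (\<zero>\<^bsub>A\<^esub>, \<lambda>\<delta>. if \<delta> = \<gamma> then 1 else 0)"
      using b by (simp add: H_basis_def unit_sector_def twisted_elt_def)
    show ?thesis using cases[OF assms(2)] euler_pairing_Hc_basis[OF x]
      unfolding val using b by (auto simp: zero vanish split: if_splits)
  next
    fix m assume b: "m \<in> interior" "b = Inr m"
    have val: "H_basis b = (D m, \<lambda>_. 0)" by (simp add: b H_basis_def D_elt_def untwisted_elt_def)
    have "augmentation (D m) = 0" using b by simp
    from cases[OF assms(2)] show ?thesis
    proof (elim disjE bexE conjE)
      fix k assume k: "k \<in> interior" "b' = Inr k"
      then show ?thesis using euler_pairing_Hc_basis(3)[OF x k(1)] green[OF k(1) b(1)]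
        unfolding val using b by simp
    qed (use euler_pairing_Hc_basis[OF x] \<open>augmentation (D m) = 0\<close> in \<open>auto simp: b(2) val[unfolded b(2)]\<close>)
  qed
qed

lemma H_basis_span: "carrier H \<subseteq> submodule_generated CC H (H_basis ` basis_index)"
proof -
  have "H_basis ` basis_index \<subseteq> carrier H" using H_basis_closed by blast
  moreover have "H_basis ` basis_index = unit_sector S ` insert 0 (twisted S) \<union> D_elt S ` interior"
    by (simp add: basis_index_def image_Un image_image H_basis_def)
  ultimately show ?thesis
    using plain_module.submodule_generated_submodule[OF plain_module.intro[OF module_H]]
      plain_module.submodule_generated_incl[OF plain_module.intro[OF module_H],
        of "H_basis ` basis_index"]
    by (intro H_spanned) auto
qed

text \<open>
  Inverting the Green's function by the Laplacian expresses the \<open>F\<^sub>k\<close> by the dual basis, which shows that the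
  latter spans.
\<close>

lemma F_ray_eq_Hc_basis:
  assumes k: "k \<in> interior"
  shows "F_ray S k = (\<Oplus>\<^bsub>Hc\<^esub>i\<in>interior. (- weight S k i) \<odot>\<^bsub>Hc\<^esub> Hc_basis (Inr i))"
proof -
  have "(\<Oplus>\<^bsub>Hc\<^esub>i\<in>interior. (- weight S k i) \<odot>\<^bsub>Hc\<^esub> Hc_basis (Inr i)) =
      (\<Oplus>\<^bsub>Hc\<^esub>l\<in>interior. (\<Sum>i\<in>interior. - weight S k i * of_real (green n i l)) \<odot>\<^bsub>Hc\<^esub> F_ray S l)"
    using W.finsum_smult_matrix[of interior interior "F_ray S" "\<lambda>i. - weight S k i"
        "\<lambda>i l. of_real (green n i l)"] fan_finite
    by (simp add: Hc_basis_def)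
  also have "\<dots> = (\<Oplus>\<^bsub>Hc\<^esub>l\<in>interior. (if k = l then 1 else 0) \<odot>\<^bsub>Hc\<^esub> F_ray S l)"
  proof (rule W.finsum_cong'[OF refl])
    fix l assume l: "l \<in> interior"
    have "(\<Sum>i\<in>interior. - weight S k i * of_real (green n i l)) =
        - (\<Sum>i\<in>interior. weight S k i * of_real (green n l i))"
      by (simp add: sum_negf green_sym[of n l])
    then show "(\<Sum>i\<in>interior. - weight S k i * of_real (green n i l)) \<odot>\<^bsub>Hc\<^esub> F_ray S l =
        (if k = l then 1 else 0) \<odot>\<^bsub>Hc\<^esub> F_ray S l"
      using green_weight[OF k l] by simp
  qed auto
  also have "\<dots> = (\<Oplus>\<^bsub>Hc\<^esub>l\<in>{k}. (if k = l then 1 else 0) \<odot>\<^bsub>Hc\<^esub> F_ray S l)"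
    by (rule W.add.finprod_mono_neutral_cong_right)
      (use k fan_finite W.smult_l_null in auto)
  also have "\<dots> = F_ray S k" using k W.smult_one[of "F_ray S k"] by simp
  finally show ?thesis ..
qed

lemma Hc_basis_span: "carrier Hc \<subseteq> submodule_generated CC Hc (Hc_basis ` basis_index)" (is "_ \<subseteq> ?N")
proof -
  have N: "submodule ?N CC Hc"
    using plain_module.submodule_generated_submodule[OF plain_module.intro[OF module_Hc]]
      Hc_basis_closed by blast
  have basis: "Hc_basis b \<in> ?N" if "b \<in> basis_index" for b
    using plain_module.submodule_generated_incl[OF plain_module.intro[OF module_Hc],
        of "Hc_basis ` basis_index"] that by blast
  show ?thesis
  proof (rule Hc_spanned[OF N])
    show "F_elt S \<in> ?N" using basis[of "Inl 0"] by (simp add: basis_index_def Hc_basis_def)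
    show "F_ray S ` interior \<subseteq> ?N"
    proof
      fix x assume "x \<in> F_ray S ` interior"
      then obtain k where k: "k \<in> interior" "x = F_ray S k" by blast
      show "x \<in> ?N" unfolding k(2) F_ray_eq_Hc_basis[OF k(1)]
        using basis W.submoduleE(4)[OF N]
        by (intro W.submodule_finsum[OF N]) (auto simp: basis_index_def)
    qed
    show "F_twisted S ` twisted S \<subseteq> ?N"
    proof
      fix x assume "x \<in> F_twisted S ` twisted S"
      then obtain \<gamma> where \<gamma>: "\<gamma> \<in> twisted S" "x = F_twisted S \<gamma>" by blast
      have star: "box_star S \<gamma> \<in> twisted S" using \<gamma>(1) by (rule box_star_in_twisted)
      then have "box_star S \<gamma> \<noteq> 0" using twisted_nonzero by metis
      then have "Hc_basis (Inl (box_star S \<gamma>)) = sector_weight S \<gamma> \<odot>\<^bsub>Hc\<^esub> x"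
        using \<gamma> by (simp add: Hc_basis_def box_star_involutive sector_weight_star)
      moreover have "(1 / sector_weight S \<gamma>) \<odot>\<^bsub>Hc\<^esub> Hc_basis (Inl (box_star S \<gamma>)) \<in> ?N"
        using W.submoduleE(4)[OF N] basis star by (auto simp: basis_index_def)
      moreover have "(1 / sector_weight S \<gamma>) \<odot>\<^bsub>Hc\<^esub> (sector_weight S \<gamma> \<odot>\<^bsub>Hc\<^esub> x) = x"
        using W.smult_assoc1[of "1 / sector_weight S \<gamma>" "sector_weight S \<gamma>" x] W.smult_one[of x]
          sector_weight_nonzero[OF \<gamma>(1)] \<gamma> by simp
      ultimately show "x \<in> ?N" by simp
    qed
  qed
qed

sublocale dual_bases H Hc "euler_pairing S" basis_index H_basis Hc_basis
proof (intro dual_bases.intro dual_bases_axioms.intro two_spaces_axioms)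
  show "finite basis_index" by (simp add: basis_index_def finite_twisted fan_finite)
qed (rule linear_map_euler_right linear_map_euler_left H_basis_closed Hc_basis_closed
    H_basis_span Hc_basis_span biorthogonal_basis; assumption)+

theorem euler_pairing_inverse:
  "pairing_inverse H Hc (euler_pairing S) =
    (\<Oplus>\<^bsub>T\<^esub>\<gamma>\<in>twisted S. sector_weight S \<gamma> \<odot>\<^bsub>T\<^esub> tens (unit_sector S \<gamma>) (F_twisted S (box_star S \<gamma>)))
    \<oplus>\<^bsub>T\<^esub> tens (unit_sector S 0) (F_elt S)
    \<oplus>\<^bsub>T\<^esub> (\<Oplus>\<^bsub>T\<^esub>p\<in>interior \<times> interior.
        of_real (green n (fst p) (snd p)) \<odot>\<^bsub>T\<^esub> tens (D_elt S (fst p)) (F_ray S (snd p)))"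
proof -
  let ?t = "\<lambda>b. tens (H_basis b) (Hc_basis b)"
  have t: "?t b \<in> carrier T" if "b \<in> basis_index" for b
    using that H_basis_closed Hc_basis_closed by blast
  have "(\<Oplus>\<^bsub>T\<^esub>b\<in>basis_index. ?t b) =
      (\<Oplus>\<^bsub>T\<^esub>b\<in>Inl ` insert 0 (twisted S). ?t b) \<oplus>\<^bsub>T\<^esub> (\<Oplus>\<^bsub>T\<^esub>b\<in>Inr ` interior. ?t b)"
    unfolding basis_index_def
    by (rule T.finsum_Un_disjoint) (use t finite_twisted fan_finite in \<open>auto simp: basis_index_def\<close>)
  also have "(\<Oplus>\<^bsub>T\<^esub>b\<in>Inl ` insert 0 (twisted S). ?t b) = (\<Oplus>\<^bsub>T\<^esub>\<gamma>\<in>insert 0 (twisted S). ?t (Inl \<gamma>))"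
    by (rule T.finsum_reindex) (use t in \<open>auto simp: basis_index_def\<close>)
  also have "\<dots> = ?t (Inl 0) \<oplus>\<^bsub>T\<^esub> (\<Oplus>\<^bsub>T\<^esub>\<gamma>\<in>twisted S. ?t (Inl \<gamma>))"
    by (rule T.finsum_insert) (use t twisted_nonzero finite_twisted in \<open>auto simp: basis_index_def\<close>)
  also have "?t (Inl 0) = tens (unit_sector S 0) (F_elt S)"
    by (simp add: H_basis_def Hc_basis_def)
  also have "(\<Oplus>\<^bsub>T\<^esub>\<gamma>\<in>twisted S. ?t (Inl \<gamma>)) =
      (\<Oplus>\<^bsub>T\<^esub>\<gamma>\<in>twisted S. sector_weight S \<gamma> \<odot>\<^bsub>T\<^esub> tens (unit_sector S \<gamma>) (F_twisted S (box_star S \<gamma>)))"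
  proof (rule T.finsum_cong'[OF refl])
    fix \<gamma> assume \<gamma>: "\<gamma> \<in> twisted S"
    interpret l: linear_map Hc T "tens (unit_sector S \<gamma>)"
      by (rule linear_map_tens_right) (use \<gamma> in simp)
    have "\<gamma> \<noteq> 0" using \<gamma> twisted_nonzero by metis
    then show "?t (Inl \<gamma>) = sector_weight S \<gamma> \<odot>\<^bsub>T\<^esub> tens (unit_sector S \<gamma>) (F_twisted S (box_star S \<gamma>))"
      using \<gamma> by (simp add: H_basis_def Hc_basis_def l.smult box_star_in_twisted)
  qed (use box_star_in_twisted in \<open>auto intro!: T.smult_closed tens_closed\<close>)
  also have "(\<Oplus>\<^bsub>T\<^esub>b\<in>Inr ` interior. ?t b) = (\<Oplus>\<^bsub>T\<^esub>k\<in>interior. ?t (Inr k))"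
    by (rule T.finsum_reindex) (use t in \<open>auto simp: basis_index_def\<close>)
  also have "\<dots> = (\<Oplus>\<^bsub>T\<^esub>k\<in>interior. \<Oplus>\<^bsub>T\<^esub>l\<in>interior.
      of_real (green n k l) \<odot>\<^bsub>T\<^esub> tens (D_elt S k) (F_ray S l))"
  proof (rule T.finsum_cong'[OF refl])
    fix k assume k: "k \<in> interior"
    interpret l: linear_map Hc T "tens (D_elt S k)"
      by (rule linear_map_tens_right) (use k in auto)
    show "?t (Inr k) = (\<Oplus>\<^bsub>T\<^esub>l\<in>interior. of_real (green n k l) \<odot>\<^bsub>T\<^esub> tens (D_elt S k) (F_ray S l))"
      unfolding H_basis_def Hc_basis_def sum.case
      by (subst l.finsum, force, rule T.finsum_cong'[OF refl])
        (use k in \<open>auto simp: l.smult intro!: T.smult_closed tens_closed\<close>)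
  qed (auto intro!: T.finsum_closed T.smult_closed tens_closed)
  also have "\<dots> = (\<Oplus>\<^bsub>T\<^esub>p\<in>interior \<times> interior.
      of_real (green n (fst p) (snd p)) \<odot>\<^bsub>T\<^esub> tens (D_elt S (fst p)) (F_ray S (snd p)))"
    by (subst T.finsum_Times)
      (use fan_finite in \<open>auto intro!: T.smult_closed tens_closed\<close>)
  finally have "(\<Oplus>\<^bsub>T\<^esub>b\<in>basis_index. ?t b) = tens (unit_sector S 0) (F_elt S) \<oplus>\<^bsub>T\<^esub>
      (\<Oplus>\<^bsub>T\<^esub>\<gamma>\<in>twisted S. sector_weight S \<gamma> \<odot>\<^bsub>T\<^esub> tens (unit_sector S \<gamma>) (F_twisted S (box_star S \<gamma>)))
    \<oplus>\<^bsub>T\<^esub> (\<Oplus>\<^bsub>T\<^esub>p\<in>interior \<times> interior.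
        of_real (green n (fst p) (snd p)) \<odot>\<^bsub>T\<^esub> tens (D_elt S (fst p)) (F_ray S (snd p)))" .
  moreover have "tens (unit_sector S 0) (F_elt S) \<in> carrier T" by (intro tens_closed) auto
  moreover have "(\<Oplus>\<^bsub>T\<^esub>\<gamma>\<in>twisted S. sector_weight S \<gamma> \<odot>\<^bsub>T\<^esub>
      tens (unit_sector S \<gamma>) (F_twisted S (box_star S \<gamma>))) \<in> carrier T"
    using box_star_in_twisted by (intro T.finsum_closed) (auto intro!: T.smult_closed tens_closed)
  ultimately show ?thesis unfolding pairing_inverse_eq by (simp add: T.a_comm)
qed

end

theorem theorem4p24:
  fixes n r :: nat and idx :: "nat \<Rightarrow> nat" and S :: "nat set" and g :: "nat \<Rightarrow> nat \<Rightarrow> real"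
  assumes "n \<ge> 1"
    and "strict_mono_on {0..r+1} idx" and "idx 0 = 0" and "idx (r+1) = n"
    and S_def: "S = idx ` {0..r+1}"
    and "\<And>k l. k \<in> {1..r} \<Longrightarrow> l \<in> {1..r} \<Longrightarrow> k \<le> l \<Longrightarrow>
           g k l = - (real (idx k) / real n) * (real n - real (idx l))"
    and "\<And>k l. k \<in> {1..r} \<Longrightarrow> l \<in> {1..r} \<Longrightarrow> k \<ge> l \<Longrightarrow>
           g k l = - (real (idx l) / real n) * (real n - real (idx k))"
  shows "nondegenerate_pairing (H_space S) (Hc_space S) (euler_pairing S) \<and>
    (let T = tensor_product (H_space S) (Hc_space S); tens = pure_tensor (H_space S) (Hc_space S) in
      pairing_inverse (H_space S) (Hc_space S) (euler_pairing S) =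
        (\<Oplus>\<^bsub>T\<^esub>\<gamma>\<in>twisted S.
           (case coords S \<gamma> of (i, j, a, b) \<Rightarrow>
              complex_of_real (4 * (real j - real i) * (sin (pi * a))\<^sup>2))
           \<odot>\<^bsub>T\<^esub> tens (unit_sector S \<gamma>) (F_twisted S (box_star S \<gamma>)))
        \<oplus>\<^bsub>T\<^esub> tens (unit_sector S 0) (F_elt S)
        \<ominus>\<^bsub>T\<^esub> (\<Oplus>\<^bsub>T\<^esub>p\<in>{1..r} \<times> {1..r}.
           complex_of_real (g (fst p) (snd p))
           \<odot>\<^bsub>T\<^esub> tens (D_elt S (idx (fst p))) (F_ray S (idx (snd p)))))"
proof -
  have less: "idx a < idx b" if "a < b" "b \<le> r + 1" for a b
    using assms(2) that by (auto simp: strict_mono_on_def)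
  have le: "idx a \<le> idx b" if "a \<le> b" "b \<le> r + 1" for a b
    using less[of a b] that by (cases "a = b") auto
  interpret fan S n
  proof
    show "finite S" by (simp add: S_def)
    show "0 \<in> S" unfolding S_def using assms(3) by (intro image_eqI[of _ _ 0]) auto
    show "n \<in> S" unfolding S_def using assms(4) by (intro image_eqI[of _ _ "r + 1"]) auto
    show "i \<le> n" if "i \<in> S" for i using that le assms(4) unfolding S_def by auto
    show "0 < n" using assms(1) by simp
  qed
  have inj: "inj_on idx {0..r + 1}" using assms(2) by (rule strict_mono_on_imp_inj_on)
  have interior: "S - {0, n} = idx ` {1..r}"
  proof -
    have "{0..r + 1} = insert 0 (insert (r + 1) {1..r})" by auto
    then have "S = insert 0 (insert n (idx ` {1..r}))" using assms(3,4) by (simp add: S_def)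
    moreover have "0 < idx k" "idx k < n" if "k \<in> {1..r}" for k
      using less[of 0 k] less[of k "r + 1"] that assms(3,4) by auto
    ultimately show ?thesis by fastforce
  qed
  have g: "g k l = - green n (idx k) (idx l)" if "k \<in> {1..r}" "l \<in> {1..r}" for k l
  proof (cases "k \<le> l")
    case True
    then show ?thesis
      using assms(6)[OF that True] le[of k l] that by (simp add: green_def min_absorb1 max_absorb2)
  next
    case False
    then show ?thesis
      using assms(7)[OF that] le[of l k] that by (simp add: green_def min_absorb2 max_absorb1)
  qed
  let ?t = "\<lambda>p. tens (D_elt S (fst p)) (F_ray S (snd p))"
  let ?i = "\<lambda>p. (idx (fst p), idx (snd p))"
  let ?s = "\<Oplus>\<^bsub>T\<^esub>p\<in>{1..r} \<times> {1..r}. complex_of_real (g (fst p) (snd p)) \<odot>\<^bsub>T\<^esub> ?t (?i p)"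
  have t: "?t (?i p) \<in> carrier T" if "p \<in> {1..r} \<times> {1..r}" for p
    using that interior by (intro tens_closed H_closed Hc_closed) auto
  have "(\<Oplus>\<^bsub>T\<^esub>p\<in>interior \<times> interior. of_real (green n (fst p) (snd p)) \<odot>\<^bsub>T\<^esub> ?t p) =
      (\<Oplus>\<^bsub>T\<^esub>p\<in>?i ` ({1..r} \<times> {1..r}). of_real (green n (fst p) (snd p)) \<odot>\<^bsub>T\<^esub> ?t p)"
  proof -
    have "interior \<times> interior = ?i ` ({1..r} \<times> {1..r})" unfolding interior by force
    then show ?thesis by simp
  qed
  also have "\<dots> = (\<Oplus>\<^bsub>T\<^esub>p\<in>{1..r} \<times> {1..r}.
      of_real (green n (fst (?i p)) (snd (?i p))) \<odot>\<^bsub>T\<^esub> ?t (?i p))"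
  proof (rule T.finsum_reindex)
    show "inj_on ?i ({1..r} \<times> {1..r})"
      using inj by (auto simp: inj_on_def)
    show "(\<lambda>p. of_real (green n (fst p) (snd p)) \<odot>\<^bsub>T\<^esub> ?t p) \<in> ?i ` ({1..r} \<times> {1..r}) \<rightarrow> carrier T"
      using t by (intro funcsetI T.smult_closed) auto
  qed
  also have "\<dots> = (\<Oplus>\<^bsub>T\<^esub>p\<in>{1..r} \<times> {1..r}. (- 1) \<odot>\<^bsub>T\<^esub>
      (complex_of_real (g (fst p) (snd p)) \<odot>\<^bsub>T\<^esub> ?t (?i p)))"
  proof (rule T.finsum_cong'[OF refl])
    fix p assume p: "p \<in> {1..r} \<times> {1..r}"
    show "of_real (green n (fst (?i p)) (snd (?i p))) \<odot>\<^bsub>T\<^esub> ?t (?i p) =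
        (- 1) \<odot>\<^bsub>T\<^esub> (complex_of_real (g (fst p) (snd p)) \<odot>\<^bsub>T\<^esub> ?t (?i p))"
      using T.smult_assoc1[OF _ _ t[OF p], of "- 1" "complex_of_real (g (fst p) (snd p))"]
        g[of "fst p" "snd p"] p by (auto simp: mem_Times_iff)
  qed (use t in \<open>auto intro!: T.smult_closed\<close>)
  also have "\<dots> = (- 1) \<odot>\<^bsub>T\<^esub> ?s"
    by (rule T.finsum_smult_ldistr[symmetric]) (use t in \<open>auto intro!: T.smult_closed\<close>)
  also have "\<dots> = \<ominus>\<^bsub>T\<^esub> ?s"
    by (rule module_CC_smult_uminus_one[OF T.module_axioms])
      (use t in \<open>auto intro!: T.finsum_closed T.smult_closed\<close>)
  finally show ?thesis
    using nondegenerate euler_pairing_inverse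
    by (simp add: Let_def sector_weight_def a_minus_def split_def)
qed

end
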